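(* Every tree of cycles is sc-greedy. That is, if $G$ is a tree of $k$ cycles for some $k\ge 1$, then $\chi_{SC}(G)=|V(G)|+|E(G)|$.
   Context: Graphs are finite and simple. For a graph $G=(V,E)$, a size function is a map $f:V\to\mathbb{N}$. An $f$-assignment is a map $L:V\to 2^{\mathbb{N}}$ assigning to each vertex $v$ a list (finite set) of colors with $|L(v)|=f(v)$. $G$ is $L$-colorable if there is a proper coloring $c$ of $G$ with $c(v)\in L(v)$ for all $v\in V$. $G$ is $f$-choosable, and $f$ is called a choice function for $G$, if $G$ is $L$-colorable for every $f$-assignment $L$. Put $\operatorname{size}(f)=\sum_{v\in V}f(v)$. The sum choice number $\chi_{SC}(G)$ is the minimum of $\operatorname{size}(f)$ over all choice functions $f$ for $G$. $G$ is sc-greedy if $\chi_{SC}(G)=|V(G)|+|E(G)|$. The weak dual of a plane graph is its dual graph with the vertex corresponding to the unbounded face removed. A graph $G$ is called a tree of $k$ cycles (or tree of cycles) if $G=\bigcup_{i=1}^k G_i$ where: (1) each $G_i$ is a cycle of length $a_i\ge 4$, for $i=1,\ldots,k$; (2) for all pairs $i\neq j$, either $V(G_i)\cap V(G_j)=\emptyset$ or $V(G_i)\cap V(G_j)=\{u,v\}$ for two adjacent vertices $u,v\in V(G)$; (3) if $V(G_i)\cap V(G_j)=\{u,v\}$ (with $i\ne j$), then $u,v\notin V(G_l)$ for all $l\ne i,j$; (4) if $w_i\in V(G_i)$, then $w_i\notin V(G_j)$ for all $j\ne i$ unless $V(G_i)\cap V(G_j)=\{u,v\}$ and $w_i\in\{u,v\}$;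 (5) $G$ can be drawn in the plane so that the weak dual of $G$ is a tree; (6) $G$ can be drawn in the plane so that in the dual of $G$, the vertex corresponding to the unbounded face of $G$ is adjacent to all other vertices. *)

theory Defs
  imports "HOL-Analysis.Analysis"
begin

section \<open>Finite simple graphs\<close>

record 'a graph =
  verts :: "'a set"
  edges :: "'a set set"

definition simple_graph :: "'a graph \<Rightarrow> bool" where
  "simple_graph G \<longleftrightarrow>
     finite (verts G) \<and> (\<forall>e\<in>edges G. e \<subseteq> verts G \<and> card e = 2)"

definition cycle_graph :: "nat \<Rightarrow> 'a graph \<Rightarrow> bool" where
  "cycle_graph n C \<longleftrightarrow> 3 \<le> n \<and>
     (\<exists>vs. distinct vs \<and> length vs = n \<and> verts C = set vs \<and>
           edges C = {{vs ! i, vs ! (Suc i mod n)} | i. i < n})"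


section \<open>Sum list colouring\<close>

definition f_assignment :: "'a graph \<Rightarrow> ('a \<Rightarrow> nat) \<Rightarrow> ('a \<Rightarrow> nat set) \<Rightarrow> bool" where
  "f_assignment G f L \<longleftrightarrow> (\<forall>v\<in>verts G. finite (L v) \<and> card (L v) = f v)"

definition L_colorable :: "'a graph \<Rightarrow> ('a \<Rightarrow> nat set) \<Rightarrow> bool" where
  "L_colorable G L \<longleftrightarrow>
     (\<exists>c. (\<forall>v\<in>verts G. c v \<in> L v) \<and> (\<forall>u v. {u, v} \<in> edges G \<longrightarrow> c u \<noteq> c v))"

definition choice_function :: "'a graph \<Rightarrow> ('a \<Rightarrow> nat) \<Rightarrow> bool" where
  "choice_function G f \<longleftrightarrow> (\<forall>L. f_assignment G f L \<longrightarrow> L_colorable G L)"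

definition size_of :: "'a graph \<Rightarrow> ('a \<Rightarrow> nat) \<Rightarrow> nat" where
  "size_of G f = (\<Sum>v\<in>verts G. f v)"

text \<open>
  For a simple graph the minimum is attained: the constant function with value
  \<open>card (verts G)\<close> is a choice function.
\<close>

definition sum_choice_number :: "'a graph \<Rightarrow> nat" where
  "sum_choice_number G = (LEAST s. \<exists>f. choice_function G f \<and> size_of G f = s)"

definition sc_greedy :: "'a graph \<Rightarrow> bool" where
  "sc_greedy G \<longleftrightarrow> sum_choice_number G = card (verts G) + card (edges G)"


section \<open>Multigraphs\<close>

text \<open>
  \<open>ends M e\<close> is the set of end vertices of \<open>e\<close>; it is a singleton when \<open>e\<close> is a loop.
\<close>

record ('v, 'e) multigraph =
  mverts :: "'v set"
  medges :: "'e set"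
  ends :: "'e \<Rightarrow> 'v set"

definition mg_adjacent :: "('v, 'e) multigraph \<Rightarrow> 'v \<Rightarrow> 'v \<Rightarrow> bool" where
  "mg_adjacent M x y \<longleftrightarrow> (\<exists>e\<in>medges M. ends M e = {x, y})"

definition mg_delete :: "('v, 'e) multigraph \<Rightarrow> 'v \<Rightarrow> ('v, 'e) multigraph" where
  "mg_delete M x =
     \<lparr>mverts = mverts M - {x}, medges = {e \<in> medges M. x \<notin> ends M e}, ends = ends M\<rparr>"

definition mg_connected :: "('v, 'e) multigraph \<Rightarrow> bool" where
  "mg_connected M \<longleftrightarrow> mverts M \<noteq> {} \<and>
     (\<forall>x\<in>mverts M. \<forall>y\<in>mverts M. (mg_adjacent M)\<^sup>*\<^sup>* x y)"

text \<open>
  Loops (\<open>length es = 1\<close>) and pairs of parallel edges (\<open>length es = 2\<close>) are cycles.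
\<close>

definition mg_cycle :: "('v, 'e) multigraph \<Rightarrow> 'v list \<Rightarrow> 'e list \<Rightarrow> bool" where
  "mg_cycle M vs es \<longleftrightarrow>
     es \<noteq> [] \<and> length vs = length es \<and> distinct vs \<and> distinct es \<and>
     set vs \<subseteq> mverts M \<and> set es \<subseteq> medges M \<and>
     (\<forall>i<length es. ends M (es ! i) = {vs ! i, vs ! (Suc i mod length es)})"

definition mg_tree :: "('v, 'e) multigraph \<Rightarrow> bool" where
  "mg_tree M \<longleftrightarrow> mg_connected M \<and> \<not> (\<exists>vs es. mg_cycle M vs es)"


section \<open>Plane drawings and their duals\<close>

text \<open>
  The plane is the type of complex numbers. A drawing places each vertex \<open>v\<close> at \<open>p v\<close>
  and draws each edge \<open>e\<close> as the simple arc \<open>\<gamma> e\<close> between its end vertices. An arc passes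
  through no other vertex, and two arcs meet only at common end vertices.
\<close>

definition plane_drawing :: "'a graph \<Rightarrow> ('a \<Rightarrow> complex) \<Rightarrow> ('a set \<Rightarrow> real \<Rightarrow> complex) \<Rightarrow> bool" where
  "plane_drawing G p \<gamma> \<longleftrightarrow>
     inj_on p (verts G) \<and>
     (\<forall>e\<in>edges G. arc (\<gamma> e) \<and> {pathstart (\<gamma> e), pathfinish (\<gamma> e)} = p ` e) \<and>
     (\<forall>e\<in>edges G. \<forall>v\<in>verts G. p v \<in> path_image (\<gamma> e) \<longrightarrow> v \<in> e) \<and>
     (\<forall>e\<in>edges G. \<forall>e'\<in>edges G. e \<noteq> e' \<longrightarrow>
        path_image (\<gamma> e) \<inter> path_image (\<gamma> e') \<subseteq> p ` (e \<inter> e'))"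

definition drawn_set :: "'a graph \<Rightarrow> ('a \<Rightarrow> complex) \<Rightarrow> ('a set \<Rightarrow> real \<Rightarrow> complex) \<Rightarrow> complex set" where
  "drawn_set G p \<gamma> = p ` verts G \<union> (\<Union>e\<in>edges G. path_image (\<gamma> e))"

definition faces :: "'a graph \<Rightarrow> ('a \<Rightarrow> complex) \<Rightarrow> ('a set \<Rightarrow> real \<Rightarrow> complex) \<Rightarrow> complex set set" where
  "faces G p \<gamma> = components (- drawn_set G p \<gamma>)"

text \<open>
  The dual edge of \<open>e\<close> joins the faces whose frontier contains the arc of \<open>e\<close>, that is, the
  one or two faces on the two sides of \<open>e\<close>. Distinct edges of \<open>G\<close> give distinct dual edges.
\<close>

definition dual :: "'a graph \<Rightarrow> ('a \<Rightarrow> complex) \<Rightarrow> ('a set \<Rightarrow> real \<Rightarrow> complex)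
    \<Rightarrow> (complex set, 'a set) multigraph" where
  "dual G p \<gamma> =
     \<lparr>mverts = faces G p \<gamma>,
      medges = edges G,
      ends = (\<lambda>e. {F \<in> faces G p \<gamma>. path_image (\<gamma> e) \<subseteq> frontier F})\<rparr>"

text \<open>A drawing of a finite graph has exactly one unbounded face.\<close>

definition unbounded_face :: "'a graph \<Rightarrow> ('a \<Rightarrow> complex) \<Rightarrow> ('a set \<Rightarrow> real \<Rightarrow> complex) \<Rightarrow> complex set" where
  "unbounded_face G p \<gamma> = (THE F. F \<in> faces G p \<gamma> \<and> \<not> bounded F)"

definition weak_dual :: "'a graph \<Rightarrow> ('a \<Rightarrow> complex) \<Rightarrow> ('a set \<Rightarrow> real \<Rightarrow> complex)
    \<Rightarrow> (complex set, 'a set) multigraph" where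
  "weak_dual G p \<gamma> = mg_delete (dual G p \<gamma>) (unbounded_face G p \<gamma>)"


section \<open>Trees of cycles\<close>

definition tree_of_cycles :: "nat \<Rightarrow> 'a graph \<Rightarrow> bool" where
  "tree_of_cycles k G \<longleftrightarrow>
     simple_graph G \<and>
     (\<exists>(C :: nat \<Rightarrow> 'a graph) (a :: nat \<Rightarrow> nat).
        verts G = (\<Union>i\<in>{1..k}. verts (C i)) \<and>
        edges G = (\<Union>i\<in>{1..k}. edges (C i)) \<and>
        (\<forall>i\<in>{1..k}. 4 \<le> a i \<and> cycle_graph (a i) (C i)) \<and>
        (\<forall>i\<in>{1..k}. \<forall>j\<in>{1..k}. i \<noteq> j \<longrightarrow>
           verts (C i) \<inter> verts (C j) = {} \<or>
           (\<exists>u v. {u, v} \<in> edges G \<and> verts (C i) \<inter> verts (C j) = {u, v})) \<and>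
        (\<forall>i\<in>{1..k}. \<forall>j\<in>{1..k}. \<forall>u v. i \<noteq> j \<and> verts (C i) \<inter> verts (C j) = {u, v} \<longrightarrow>
           (\<forall>l\<in>{1..k} - {i, j}. u \<notin> verts (C l) \<and> v \<notin> verts (C l))) \<and>
        (\<forall>i\<in>{1..k}. \<forall>w\<in>verts (C i). \<forall>j\<in>{1..k} - {i}.
           w \<notin> verts (C j) \<or>
           (\<exists>u v. {u, v} \<in> edges G \<and> verts (C i) \<inter> verts (C j) = {u, v} \<and> w \<in> {u, v}))) \<and>
     (\<exists>p \<gamma>. plane_drawing G p \<gamma> \<and> mg_tree (weak_dual G p \<gamma>)) \<and>
     (\<exists>p \<gamma>. plane_drawing G p \<gamma> \<and>
        (\<forall>F\<in>faces G p \<gamma> - {unbounded_face G p \<gamma>}.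
           mg_adjacent (dual G p \<gamma>) (unbounded_face G p \<gamma>) F))"

end

theory Submission
  imports Defs "HOL-Complex_Analysis.Winding_Numbers"
begin

text \<open>
  Giving every vertex one colour more than it has neighbours among its predecessors in some
  enumeration is a choice function of size \<open>|V| + |E|\<close>, so only the lower bound needs work: if
  \<open>sum f < |V| + |E|\<close>, some lists of the sizes \<open>f\<close> admit no proper colouring.

  The topology enters through one fact (\<open>no_theta\<close> in the locale \<open>plane_graph\<close>): the graph has no
  two vertices joined by three internally disjoint paths that all have inner vertices. Indeed, if
  the weak dual is acyclic, every vertex lies on the boundary of the unbounded face
  (\<open>edge_ends_on_unbounded_face\<close>): at an edge with an end off that boundary, Janiszewski's theorem
  lets one walk from one side of the edge to the other without meeting the edge or the boundary, and
  such a walk closes up to a cycle of the weak dual. On the other hand, no connected set in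
  the complement of a theta curve has points of all three open arcs in its closure
  (\<open>no_region_touches_theta\<close>).

  Without such thetas, two vertices shared by two cycles are adjacent in both, and the cycles meet like the
  nodes of a forest (\<open>no_bypass\<close>, \<open>only_one_overlap\<close>): each component is obtained by gluing new cycles
  one at a time onto edges disjoint from those used before. The component is therefore a root
  edge \<open>uv\<close> with at most two attachments; an attachment is a \<open>u\<close>-\<open>v\<close> path some of whose edges, pairwise
  disjoint and away from \<open>u\<close> and \<open>v\<close>, carry attachments themselves. As the cycles have length at least
  \<open>4\<close>, the path has at least two inner vertices.

  The colouring argument measures an attachment by its slack, the number of its vertices and edges
  minus the total size of its lists. Induction along the path and into the nested attachments
  (\<open>slack_forbids\<close>) shows that slack \<open>1\<close> lets the lists forbid any prescribed pair of distinct
  colours at \<open>(u, v)\<close>, slack \<open>2\<close> lets them forbid any colour at \<open>u\<close> together with any different colour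
  at \<open>v\<close>, and slack \<open>3\<close> makes the attachment uncolourable. If \<open>sum f < |V| + |E|\<close>, the slacks of the
  attachments at a root edge are large enough to rule out every pair of colours there.
\<close>

section \<open>Theta curves in the plane\<close>

definition arc_from_to :: "(real \<Rightarrow> complex) \<Rightarrow> complex \<Rightarrow> complex \<Rightarrow> bool" where
  "arc_from_to g a b \<longleftrightarrow> arc g \<and> pathstart g = a \<and> pathfinish g = b"

lemma Jordan_two_arcs:
  assumes "arc_from_to g a b" "arc_from_to h a b" "path_image g \<inter> path_image h = {a, b}"
  defines "J \<equiv> path_image g \<union> path_image h"
  shows "simple_path (g +++ reversepath h)" "path_image (g +++ reversepath h) = J"
    "pathfinish (g +++ reversepath h) = pathstart (g +++ reversepath h)"
    "inside J \<noteq> {}" "open (inside J)" "connected (inside J)" "open (outside J)" "connected (outside J)"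
    "inside J \<inter> outside J = {}" "inside J \<union> outside J = - J"
    "frontier (inside J) = J" "frontier (outside J) = J"
proof -
  show sp: "simple_path (g +++ reversepath h)"
    using assms unfolding arc_from_to_def
    by (intro simple_path_join_loop) (auto simp: arc_reversepath)
  show im: "path_image (g +++ reversepath h) = J"
    using assms unfolding arc_from_to_def by (simp add: path_image_join)
  show cl: "pathfinish (g +++ reversepath h) = pathstart (g +++ reversepath h)"
    using assms unfolding arc_from_to_def by simp
  from Jordan_inside_outside[OF sp cl] show "inside J \<noteq> {}" "open (inside J)" "connected (inside J)"
    "open (outside J)" "connected (outside J)" "inside J \<inter> outside J = {}" 
    "inside J \<union> outside J = - J" "frontier (inside J) = J" "frontier (outside J) = J"
    unfolding im by auto
qed

lemma connected_disjoint_open_cases: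
  assumes "connected W" "W \<subseteq> A \<union> B" "open A" "open B" "A \<inter> B = {}"
  shows "W \<subseteq> A \<or> W \<subseteq> B"
proof (rule ccontr)
  assume "\<not> ?thesis"
  then have "A \<inter> W \<noteq> {}" "B \<inter> W \<noteq> {}" using assms(2) by auto
  then show False using connectedD[OF assms(1,3,4)] assms(2,5) by auto
qed

text \<open>
  An arc inside the closed curve of the other two would split its inside into two parts, each having
  only two of the three arcs on its frontier.
\<close>

lemma theta_inner_chord:
  assumes c1: "arc_from_to c1 a b" and c2: "arc_from_to c2 a b" and c: "arc_from_to c a b"
    and i12: "path_image c1 \<inter> path_image c2 = {a, b}"
    and i1: "path_image c1 \<inter> path_image c = {a, b}"
    and i2: "path_image c2 \<inter> path_image c = {a, b}"
    and W: "connected W" "W \<inter> (path_image c1 \<union> path_image c2 \<union> path_image c) = {}"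
    and x: "x \<in> path_image c1 - {a, b}" "x \<in> closure W"
    and y: "y \<in> path_image c2 - {a, b}" "y \<in> closure W"
    and z: "z \<in> path_image c - {a, b}" "z \<in> closure W"
  shows "path_image c \<inter> inside (path_image c1 \<union> path_image c2) = {}"
proof (rule ccontr)
  assume ne: "path_image c \<inter> inside (path_image c1 \<union> path_image c2) \<noteq> {}"
  have ab: "a \<noteq> b" using c1 unfolding arc_from_to_def using arc_distinct_ends by blast
  have sp: "simple_path c1" "simple_path c2" "simple_path c"
    and se: "pathstart c1 = a" "pathfinish c1 = b" "pathstart c2 = a" "pathfinish c2 = b"
      "pathstart c = a" "pathfinish c = b"
    using c1 c2 c unfolding arc_from_to_def by (auto simp: arc_imp_simple_path)
  obtain dis: "inside(path_image c1 \<union> path_image c) \<inter> inside(path_image c2 \<union> path_image c) = {}"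
    and un: "inside(path_image c1 \<union> path_image c) \<union> inside(path_image c2 \<union> path_image c) \<union>
           (path_image c - {a,b}) = inside(path_image c1 \<union> path_image c2)"
    using split_inside_simple_closed_curve[OF sp(1) se(1,2) sp(2) se(3,4) sp(3) se(5,6) ab i12 i1 i2 ne]
    by blast
  note J12 = Jordan_two_arcs[OF c1 c2 i12]
  note J1 = Jordan_two_arcs[OF c1 c i1]
  note J2 = Jordan_two_arcs[OF c2 c i2]
  have "z \<in> inside (path_image c1 \<union> path_image c2)" using un z by blast
  then have "W \<inter> inside (path_image c1 \<union> path_image c2) \<noteq> {}"
    using z(2) J12(5) by (metis open_Int_closure_eq_empty Int_commute disjoint_iff)
  moreover have "W \<subseteq> inside (path_image c1 \<union> path_image c2) \<union> outside (path_image c1 \<union> path_image c2)"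
    using J12(10) W(2) by auto
  ultimately have "W \<subseteq> inside (path_image c1 \<union> path_image c2)"
    using connected_disjoint_open_cases[OF W(1) _ J12(5) J12(7) J12(9)] J12(9) by blast
  then have "W \<subseteq> inside(path_image c1 \<union> path_image c) \<union> inside(path_image c2 \<union> path_image c)"
    using un W(2) by blast
  then consider "W \<subseteq> inside(path_image c1 \<union> path_image c)" | "W \<subseteq> inside(path_image c2 \<union> path_image c)"
    using connected_disjoint_open_cases[OF W(1) _ J1(5) J2(5) dis] by blast
  then show False
  proof cases
    case 1
    then have "y \<in> closure (inside(path_image c1 \<union> path_image c))"
      using y(2) closure_mono by blast
    then have "y \<in> inside(path_image c1 \<union> path_image c) \<union> (path_image c1 \<union> path_image c)"
      using J1(11) closure_Un_frontier by blast
    moreover have "y \<notin> inside(path_image c1 \<union> path_image c)"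
      using un J12(10) y by blast
    ultimately show False using y i12 i2 by blast
  next
    case 2
    then have "x \<in> closure (inside(path_image c2 \<union> path_image c))"
      using x(2) closure_mono by blast
    then have "x \<in> inside(path_image c2 \<union> path_image c) \<union> (path_image c2 \<union> path_image c)"
      using J2(11) closure_Un_frontier by blast
    moreover have "x \<notin> inside(path_image c2 \<union> path_image c)"
      using un J12(10) x by blast
    ultimately show False using x i12 i1 by blast
  qed
qed

text \<open>
  Each inside avoids the remaining arc, so each of them is a component of the complement of the whole
  theta curve; two components that meet are equal and have the same frontier.
\<close>

lemma theta_insides_meet:
  assumes c1: "arc_from_to c1 a b" and c2: "arc_from_to c2 a b" and c: "arc_from_to c a b"
    and i12: "path_image c1 \<inter> path_image c2 = {a, b}"
    and i2: "path_image c2 \<inter> path_image c = {a, b}"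
    and w: "w \<in> inside (path_image c1 \<union> path_image c2)" "w \<in> inside (path_image c2 \<union> path_image c)"
    and n1: "path_image c \<inter> inside (path_image c1 \<union> path_image c2) = {}"
    and n2: "path_image c1 \<inter> inside (path_image c2 \<union> path_image c) = {}"
  shows "path_image c1 \<union> path_image c2 = path_image c2 \<union> path_image c"
proof -
  note J12 = Jordan_two_arcs[OF c1 c2 i12]
  note J2 = Jordan_two_arcs[OF c2 c i2]
  have "inside (path_image c1 \<union> path_image c2) \<subseteq>
      inside (path_image c2 \<union> path_image c) \<union> outside (path_image c2 \<union> path_image c)"
    using J12(10) n1 unfolding J2(10) by blast
  then have a: "inside (path_image c1 \<union> path_image c2) \<subseteq> inside (path_image c2 \<union> path_image c)"
    using connected_disjoint_open_cases[OF J12(6) _ J2(5,7,9)] w J2(9) by blast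
  have "inside (path_image c2 \<union> path_image c) \<subseteq>
      inside (path_image c1 \<union> path_image c2) \<union> outside (path_image c1 \<union> path_image c2)"
    using J2(10) n2 unfolding J12(10) by blast
  then have b: "inside (path_image c2 \<union> path_image c) \<subseteq> inside (path_image c1 \<union> path_image c2)"
    using connected_disjoint_open_cases[OF J2(6) _ J12(5,7,9)] w J12(9) by blast
  from a b have "inside (path_image c1 \<union> path_image c2) = inside (path_image c2 \<union> path_image c)" by blast
  then show ?thesis using J12(11) J2(11) by metis
qed

text \<open>
  It remains to exclude that each arc lies outside the closed curve of the other two. The winding
  numbers of the three closed curves, suitably oriented, add up to zero at every point off the curve,
  while they are \<open>1\<close> or \<open>-1\<close> inside and \<open>0\<close> outside. So a point inside one of the closed curves is
  inside a second one, which \<open>theta_insides_meet\<close> forbids.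
\<close>

lemma no_region_touches_theta:
  assumes c1: "arc_from_to c1 a b" and c2: "arc_from_to c2 a b" and c: "arc_from_to c a b"
    and i12: "path_image c1 \<inter> path_image c2 = {a, b}"
    and i1: "path_image c1 \<inter> path_image c = {a, b}"
    and i2: "path_image c2 \<inter> path_image c = {a, b}"
    and W: "connected W" "W \<inter> (path_image c1 \<union> path_image c2 \<union> path_image c) = {}"
    and x: "x \<in> path_image c1 - {a, b}" "x \<in> closure W"
    and y: "y \<in> path_image c2 - {a, b}" "y \<in> closure W"
    and z: "z \<in> path_image c - {a, b}" "z \<in> closure W"
  shows False
proof -
  note n12 = theta_inner_chord[OF c1 c2 c i12 i1 i2 W x y z]
  have n1: "path_image c2 \<inter> inside (path_image c1 \<union> path_image c) = {}"
    by (rule theta_inner_chord[OF c1 c c2 i1 i12 _ W(1) _ x z y]) (use i2 W in blast)+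
  have n2: "path_image c1 \<inter> inside (path_image c2 \<union> path_image c) = {}"
    by (rule theta_inner_chord[OF c2 c c1 i2 _ _ W(1) _ y z x]) (use i12 i1 W in blast)+
  note J12 = Jordan_two_arcs[OF c1 c2 i12]
  note J1 = Jordan_two_arcs[OF c1 c i1]
  note J2 = Jordan_two_arcs[OF c2 c i2]
  obtain w where w: "w \<in> inside (path_image c1 \<union> path_image c2)" using J12(4) by blast
  have wn: "w \<notin> path_image c1" "w \<notin> path_image c2" "w \<notin> path_image c"
    using w J12(10) n12 by blast+
  have pa: "path c1" "path c2" "path c"
    and se: "pathstart c1 = a" "pathfinish c1 = b" "pathstart c2 = a" "pathfinish c2 = b"
      "pathstart c = a" "pathfinish c = b"
    using c1 c2 c unfolding arc_from_to_def by (auto simp: arc_imp_path)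
  have wd: "winding_number (g +++ reversepath h) w = winding_number g w - winding_number h w"
    if "path g" "path h" "w \<notin> path_image g" "w \<notin> path_image h" "pathfinish g = pathfinish h" for g h
    using that by (simp add: winding_number_join winding_number_reversepath)
  \<comment> \<open>Both sides are \<open>n(c1) - n(c2)\<close>, where \<open>n\<close> is the winding number about \<open>w\<close>.\<close>
  have e: "winding_number (c1 +++ reversepath c2) w = 
      winding_number (c1 +++ reversepath c) w - winding_number (c2 +++ reversepath c) w"
    using wd[of c1 c2] wd[of c1 c] wd[of c2 c] pa wn se by simp
  have "norm (winding_number (c1 +++ reversepath c2) w) = 1"
    using simple_closed_path_norm_winding_number_inside[OF J12(1)] w J12(2) by simp
  then have "winding_number (c1 +++ reversepath c) w \<noteq> 0 \<or> winding_number (c2 +++ reversepath c) w \<noteq> 0"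
    using e by auto
  then have "w \<notin> outside (path_image c1 \<union> path_image c) \<or> w \<notin> outside (path_image c2 \<union> path_image c)"
    using winding_number_zero_in_outside[of "c1 +++ reversepath c" w]
      winding_number_zero_in_outside[of "c2 +++ reversepath c" w] J1(1-3) J2(1-3) 
    by (metis simple_path_imp_path)
  then consider "w \<in> inside (path_image c1 \<union> path_image c)" | "w \<in> inside (path_image c2 \<union> path_image c)"
    using wn J1(10) J2(10) by blast
  then show False
  proof cases
    case 1
    have "path_image c2 \<union> path_image c1 = path_image c1 \<union> path_image c"
      by (rule theta_insides_meet[OF c2 c1 c _ i1]) (use w 1 n12 n1 i12 in \<open>auto simp: Un_commute\<close>)
    then show False using y i12 i2 by blast
  next
    case 2
    have "path_image c1 \<union> path_image c2 = path_image c2 \<union> path_image c"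
      by (rule theta_insides_meet[OF c1 c2 c i12 i2]) (use w 2 n12 n2 in auto)
    then show False using x i12 i1 by blast
  qed
qed

section \<open>Faces of a drawing and the two sides of an edge\<close>

definition open_arc :: "('a \<Rightarrow> complex) \<Rightarrow> ('a set \<Rightarrow> real \<Rightarrow> complex) \<Rightarrow> 'a set \<Rightarrow> complex set" where
  "open_arc p \<gamma> e = path_image (\<gamma> e) - p ` e"

locale plane_graph =
  fixes G :: "'a graph" and p :: "'a \<Rightarrow> complex" and \<gamma> :: "'a set \<Rightarrow> real \<Rightarrow> complex"
  assumes simple: "simple_graph G" and drawing: "plane_drawing G p \<gamma>"
begin

abbreviation "S \<equiv> drawn_set G p \<gamma>"

lemma fin: "finite (verts G)" "finite (edges G)"
proof -
  show f: "finite (verts G)" using simple unfolding simple_graph_def by blast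
  have "edges G \<subseteq> Pow (verts G)" using simple unfolding simple_graph_def by blast
  then show "finite (edges G)" using f finite_subset by blast
qed

lemma edgeD:
  assumes e: "e \<in> edges G"
  shows "arc (\<gamma> e)" "{pathstart (\<gamma> e), pathfinish (\<gamma> e)} = p ` e" "e \<subseteq> verts G" "card e = 2"
proof -
  have "\<forall>e\<in>edges G. arc (\<gamma> e) \<and> {pathstart (\<gamma> e), pathfinish (\<gamma> e)} = p ` e"
    using drawing unfolding plane_drawing_def by (elim conjE)
  from bspec[OF this e] show "arc (\<gamma> e)" "{pathstart (\<gamma> e), pathfinish (\<gamma> e)} = p ` e" by simp_all
  have "\<forall>e\<in>edges G. e \<subseteq> verts G \<and> card e = 2"
    using simple unfolding simple_graph_def by (elim conjE)
  from bspec[OF this e] show "e \<subseteq> verts G" "card e = 2" by simp_all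
qed

lemma vertex_on_edge: "e \<in> edges G \<Longrightarrow> v \<in> verts G \<Longrightarrow> p v \<in> path_image (\<gamma> e) \<Longrightarrow> v \<in> e"
  using drawing unfolding plane_drawing_def by blast

lemma edges_meet: "e \<in> edges G \<Longrightarrow> e' \<in> edges G \<Longrightarrow> e \<noteq> e' \<Longrightarrow> 
    path_image (\<gamma> e) \<inter> path_image (\<gamma> e') \<subseteq> p ` (e \<inter> e')"
  using drawing unfolding plane_drawing_def by blast

lemma end_points_on_edge: "e \<in> edges G \<Longrightarrow> p ` e \<subseteq> path_image (\<gamma> e)"
  using edgeD(2)[of e] pathstart_in_path_image[of "\<gamma> e"] pathfinish_in_path_image[of "\<gamma> e"]
  by (metis empty_subsetI insert_subset)

lemma inj_p: "inj_on p (verts G)" using drawing unfolding plane_drawing_def by blast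

text \<open>
  In particular the drawing without one open arc is still compact.
\<close>

lemma drawn_minus_open_arc:
  assumes e: "e \<in> edges G"
  shows "S - open_arc p \<gamma> e = p ` verts G \<union> (\<Union>e'\<in>edges G - {e}. path_image (\<gamma> e'))"
proof -
  define A where "A = p ` verts G \<union> (\<Union>e'\<in>edges G - {e}. path_image (\<gamma> e'))"
  have "p ` verts G \<inter> open_arc p \<gamma> e = {}"
    unfolding open_arc_def using vertex_on_edge[OF e] by blast
  moreover have "path_image (\<gamma> e') \<inter> open_arc p \<gamma> e = {}" if "e' \<in> edges G - {e}" for e'
    using edges_meet[of e e'] that e unfolding open_arc_def by blast
  ultimately have d: "A \<inter> open_arc p \<gamma> e = {}" unfolding A_def by blast
  have "p ` e \<subseteq> A" using edgeD(3)[OF e] unfolding A_def by blast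
  then have sub: "path_image (\<gamma> e) - open_arc p \<gamma> e \<subseteq> A" unfolding open_arc_def by blast
  have "(\<Union>e'\<in>edges G. path_image (\<gamma> e')) = (\<Union>e'\<in>edges G - {e}. path_image (\<gamma> e')) \<union> path_image (\<gamma> e)"
    using e by blast
  then have "S = A \<union> path_image (\<gamma> e)" unfolding drawn_set_def A_def by (simp add: Un_assoc)
  moreover have "open_arc p \<gamma> e \<subseteq> path_image (\<gamma> e)" unfolding open_arc_def by blast
  ultimately have "S - open_arc p \<gamma> e = A" using d sub by auto
  then show ?thesis unfolding A_def .
qed

lemma compact_edges: 
  assumes "E \<subseteq> edges G" shows "compact (\<Union>e\<in>E. path_image (\<gamma> e))"
proof (rule compact_UN)
  show "finite E" by (rule finite_subset[OF assms fin(2)])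
  show "compact (path_image (\<gamma> e))" if "e \<in> E" for e
  proof -
    have "e \<in> edges G" using that assms by blast
    from edgeD(1)[OF this] show ?thesis by (rule compact_arc_image)
  qed
qed

lemma compact_vertices: "compact (p ` verts G)"
  using fin(1) by (simp add: finite_imp_compact)

lemma open_compl_drawn: "open (- S)"
proof -
  have "compact S" unfolding drawn_set_def
    by (rule compact_Un[OF compact_vertices compact_edges]) (rule order_refl)
  then show ?thesis by (simp add: compact_imp_closed open_Compl)
qed

lemma face_open: "F \<in> faces G p \<gamma> \<Longrightarrow> open F"
  unfolding faces_def using open_components[OF open_compl_drawn] by blast

lemma face_connected: "F \<in> faces G p \<gamma> \<Longrightarrow> connected F"
  unfolding faces_def by (rule in_components_connected)

lemma face_disjoint: "F \<in> faces G p \<gamma> \<Longrightarrow> F \<inter> S = {}"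
  unfolding faces_def using in_components_subset by fastforce

lemma face_unique: "F \<in> faces G p \<gamma> \<Longrightarrow> F' \<in> faces G p \<gamma> \<Longrightarrow> F \<inter> F' \<noteq> {} \<Longrightarrow> F = F'"
  unfolding faces_def using components_eq by blast

lemma face_cover: "z \<notin> S \<Longrightarrow> \<exists>F\<in>faces G p \<gamma>. z \<in> F"
  unfolding faces_def using Union_components[of "- S"] by (metis Compl_iff Union_iff)

lemma open_arc_eq_image: assumes e: "e \<in> edges G" shows "open_arc p \<gamma> e = \<gamma> e ` {0<..<1}"
proof -
  have a: "arc (\<gamma> e)" using edgeD[OF e] by simp
  have "p ` e = {\<gamma> e 0, \<gamma> e 1}" using edgeD(2)[OF e] unfolding pathstart_def pathfinish_def by simp
  moreover have "\<gamma> e t = \<gamma> e s \<longrightarrow> t = s" if "t \<in> {0..1}" "s \<in> {0..1}" for t s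
    using a that unfolding arc_def inj_on_def by blast
  ultimately have inj: "\<gamma> e t \<in> p ` e \<longleftrightarrow> t = 0 \<or> t = 1" if "t \<in> {0..1}" for t
    using that by (metis atLeastAtMost_iff insert_iff order_refl singletonD zero_le_one)
  show ?thesis
  proof
    show "open_arc p \<gamma> e \<subseteq> \<gamma> e ` {0<..<1}"
    proof
      fix z assume "z \<in> open_arc p \<gamma> e"
      then obtain t where t: "t \<in> {0..1}" "z = \<gamma> e t" "z \<notin> p ` e"
        unfolding open_arc_def path_image_def by blast
      then have "t \<noteq> 0" "t \<noteq> 1" using inj[OF t(1)] by auto
      then show "z \<in> \<gamma> e ` {0<..<1}" using t by (intro image_eqI[of _ _ t]) auto
    qed
    show "\<gamma> e ` {0<..<1} \<subseteq> open_arc p \<gamma> e"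
    proof
      fix z assume "z \<in> \<gamma> e ` {0<..<1}"
      then obtain t where t: "t \<in> {0<..<1}" "z = \<gamma> e t" by blast
      then have "t \<in> {0..1}" "t \<noteq> 0" "t \<noteq> 1" by auto
      then show "z \<in> open_arc p \<gamma> e" using inj[of t] t(2) unfolding open_arc_def path_image_def by auto
    qed
  qed
qed

lemma open_arc_connected: assumes e: "e \<in> edges G" shows "connected (open_arc p \<gamma> e)" "open_arc p \<gamma> e \<noteq> {}"
proof -
  have "continuous_on {0..1} (\<gamma> e)" using edgeD(1)[OF e] unfolding arc_def path_def by blast
  then have "continuous_on {0<..<1} (\<gamma> e)" by (rule continuous_on_subset) auto
  then show "connected (open_arc p \<gamma> e)" unfolding open_arc_eq_image[OF e]
    by (intro connected_continuous_image) auto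
  have "(1/2::real) \<in> {0<..<1}" by simp
  then show "open_arc p \<gamma> e \<noteq> {}" unfolding open_arc_eq_image[OF e] by blast
qed

lemma closure_open_arc: assumes e: "e \<in> edges G" shows "path_image (\<gamma> e) \<subseteq> closure (open_arc p \<gamma> e)"
proof -
  have "continuous_on (closure {0<..<1}) (\<gamma> e)" using edgeD(1)[OF e] unfolding arc_def path_def by simp
  then have "\<gamma> e ` closure {0<..<1} \<subseteq> closure (\<gamma> e ` {0<..<1})"
    by (intro image_closure_subset) (auto intro: closure_subset[THEN subsetD])
  then show ?thesis unfolding open_arc_eq_image[OF e] path_image_def by simp
qed

abbreviation "sides e \<equiv> ends (dual G p \<gamma>) e"

lemma sides_eq: "sides e = {F \<in> faces G p \<gamma>. path_image (\<gamma> e) \<subseteq> frontier F}"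
  unfolding dual_def by simp

text \<open>
  The arc \<open>g\<close> closes \<open>e\<close> up to a Jordan curve \<open>J\<close> in the drawing \<open>S\<close>, and the two sides of \<open>e\<close> are the faces
  just inside and just outside \<open>J\<close>. Let \<open>S0\<close> be the drawing without the open arc of \<open>e\<close>, and let \<open>D\<close> be
  the component of the complement of \<open>S0\<close> that contains this open arc. Two points of \<open>D\<close> on the same
  side of \<open>J\<close> are separated neither by \<open>S0\<close> nor by \<open>J\<close>; since \<open>S0\<close> meets \<open>J\<close> in the connected set \<open>g\<close>,
  Janiszewski's theorem puts them into the same face.
\<close>

lemma two_sides:
  assumes e: "e \<in> edges G" and ge: "arc_from_to (\<gamma> e) a b" and g: "arc_from_to g a b"
    and eg: "path_image (\<gamma> e) \<inter> path_image g = {a, b}" and gS: "path_image g \<subseteq> S"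
  obtains D F1 F2 where "open D" "connected D" "open_arc p \<gamma> e \<subseteq> D" "D \<subseteq> F1 \<union> F2 \<union> open_arc p \<gamma> e"
    "F1 \<noteq> F2" "sides e = {F1, F2}" "D \<inter> F1 \<noteq> {}" "D \<inter> F2 \<noteq> {}"
proof -
  define O' where "O' = open_arc p \<gamma> e"
  define S0 where "S0 = S - O'"
  define J where "J = path_image (\<gamma> e) \<union> path_image g"
  note Jo = Jordan_two_arcs[OF ge g eg, folded J_def]
  have pe: "p ` e = {a, b}" using ge edgeD(2)[OF e] unfolding arc_from_to_def by auto
  have OS: "O' \<subseteq> S" unfolding O'_def open_arc_def drawn_set_def using e by blast
  have cS0: "compact S0" unfolding S0_def O'_def drawn_minus_open_arc[OF e]
    by (intro compact_Un compact_vertices compact_edges) auto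
  have gO: "path_image g \<inter> O' = {}" unfolding O'_def open_arc_def pe using eg by blast
  have int: "S0 \<inter> J = path_image g"
    using gS gO eg unfolding S0_def J_def O'_def open_arc_def pe by blast
  have un: "S0 \<union> J = S"
    using gS OS e unfolding S0_def J_def O'_def open_arc_def drawn_set_def by blast
  have OJ: "O' \<subseteq> J" unfolding O'_def open_arc_def J_def by blast
  obtain z0 where z0: "z0 \<in> O'" using open_arc_connected[OF e] unfolding O'_def by blast
  define D where "D = connected_component_set (- S0) z0"
  have D: "open D" "connected D" "D \<inter> S0 = {}"
    unfolding D_def using cS0 connected_component_subset[of "- S0" z0]
    by (auto simp: open_connected_component compact_imp_closed open_Compl)
  have OD: "O' \<subseteq> D"
    unfolding D_def using open_arc_connected(1)[OF e] z0
    by (intro connected_component_maximal) (auto simp: S0_def O'_def)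
  have cJ: "compact J" using ge g unfolding J_def arc_from_to_def by (auto intro: compact_arc_image)
  have cg: "connected (path_image g)" using g unfolding arc_from_to_def by (simp add: connected_arc_image)
  \<comment> \<open>\<open>A\<close> is the inside or the outside of \<open>J\<close>, and \<open>A'\<close> the other one.\<close>
  have side: "\<exists>F. F \<in> faces G p \<gamma> \<and> D \<inter> A \<subseteq> F \<and> F \<subseteq> A \<and> D \<inter> F \<noteq> {} \<and> path_image (\<gamma> e) \<subseteq> frontier F"
    if A: "open A" "connected A" "A \<inter> J = {}" "frontier A = J" "open A'" "A' \<inter> A = {}" "A \<union> A' = - J" for A A'
  proof -
    have cl: "O' \<subseteq> closure (D \<inter> A)"
    proof -
      have "O' \<subseteq> D \<inter> closure A" using OD OJ A(4) unfolding frontier_def by blast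
      then show ?thesis using open_Int_closure_subset[OF D(1)] by blast
    qed
    then obtain w where w: "w \<in> D \<inter> A" using z0 closure_empty by (metis empty_iff ex_in_conv subsetD)
    have wS: "w \<notin> S" using w un D(3) A(3) by blast
    then obtain F where F: "F \<in> faces G p \<gamma>" "w \<in> F" using face_cover by blast
    have DF: "D \<inter> A \<subseteq> F"
    proof
      fix w' assume w': "w' \<in> D \<inter> A"
      have "connected_component (- S0) w w'" 
        using D w w' unfolding connected_component_def by (intro exI[of _ D]) auto
      moreover have "connected_component (- J) w w'"
        using A w w' unfolding connected_component_def by (intro exI[of _ A]) auto
      ultimately have "connected_component (- S) w w'"
        using Janiszewski[OF cS0 compact_imp_closed[OF cJ], of w w'] int cg un by simp
      then show "w' \<in> F" using F unfolding faces_def components_def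
        by (metis (no_types, lifting) connected_component_eq imageE mem_Collect_eq)
    qed
    have "F \<subseteq> A \<union> A'" using face_disjoint[OF F(1)] un A(7) by blast
    then have FA: "F \<subseteq> A" using connected_disjoint_open_cases[OF face_connected[OF F(1)] _ A(1,5)] A(6) F(2) w
      by blast
    have "O' \<subseteq> closure F" using cl DF closure_mono by blast
    then have "path_image (\<gamma> e) \<subseteq> closure F" using closure_open_arc[OF e] closure_minimal[of O' "closure F"]
      unfolding O'_def by auto
    moreover have "path_image (\<gamma> e) \<inter> F = {}" using face_disjoint[OF F(1)] e unfolding drawn_set_def by blast
    ultimately have "path_image (\<gamma> e) \<subseteq> frontier F"
      unfolding frontier_def using face_open[OF F(1)] by (auto simp: interior_open)
    then show ?thesis using F DF FA w by blast
  qed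
  have "inside J \<inter> J = {}" "outside J \<inter> J = {}" using Jo(10) by blast+
  obtain F1 where F1: "F1 \<in> faces G p \<gamma>" "D \<inter> inside J \<subseteq> F1" "F1 \<subseteq> inside J" "D \<inter> F1 \<noteq> {}" "path_image (\<gamma> e) \<subseteq> frontier F1"
    using side[of "inside J" "outside J"] Jo \<open>inside J \<inter> J = {}\<close> by blast
  obtain F2 where F2: "F2 \<in> faces G p \<gamma>" "D \<inter> outside J \<subseteq> F2" "F2 \<subseteq> outside J" "D \<inter> F2 \<noteq> {}" "path_image (\<gamma> e) \<subseteq> frontier F2"
    using side[of "outside J" "inside J"] Jo \<open>outside J \<inter> J = {}\<close> by blast
  have ne: "F1 \<noteq> F2" using F1 F2 Jo(9) by blast
  have Dsub: "D \<subseteq> F1 \<union> F2 \<union> O'"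
  proof
    fix w assume w: "w \<in> D"
    have "w \<in> inside J \<union> outside J \<union> J" using Jo(10) by blast
    moreover have "w \<in> O'" if "w \<in> J"
      using that w D(3) un unfolding S0_def by blast
    ultimately show "w \<in> F1 \<union> F2 \<union> O'" using F1(2) F2(2) w by blast
  qed
  have "F = F1 \<or> F = F2" if F: "F \<in> faces G p \<gamma>" "path_image (\<gamma> e) \<subseteq> frontier F" for F
  proof -
    have "z0 \<in> closure F" "z0 \<in> D" using F(2) z0 OD unfolding O'_def open_arc_def frontier_def by auto
    then have "D \<inter> F \<noteq> {}" using D(1) by (metis open_Int_closure_eq_empty disjoint_iff)
    moreover have "F \<inter> O' = {}" using face_disjoint[OF F(1)] OS by blast
    ultimately show ?thesis using Dsub face_unique F(1) F1(1) F2(1) by blast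
  qed
  then have sd: "sides e = {F1, F2}" using F1(1,5) F2(1,5) unfolding sides_eq by auto
  show thesis
    by (rule that[OF D(1,2) OD[unfolded O'_def] Dsub[unfolded O'_def] ne sd F1(4) F2(4)])
qed

end

section \<open>Acyclic weak duals put every vertex on the outer boundary\<close>

lemma rtranclp_imp_distinct_path:
  assumes "r\<^sup>*\<^sup>* x y"
  shows "\<exists>vs. vs \<noteq> [] \<and> hd vs = x \<and> last vs = y \<and> distinct vs \<and> successively r vs"
  using assms
proof (induction rule: converse_rtranclp_induct)
  case base
  show ?case by (intro exI[of _ "[y]"]) simp
next
  case (step x z)
  then obtain vs where vs: "vs \<noteq> []" "hd vs = z" "last vs = y" "distinct vs" "successively r vs" by blast
  show ?case
  proof (cases "x \<in> set vs")
    case True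
    then obtain as bs where ab: "vs = as @ x # bs" by (meson split_list)
    show ?thesis using vs unfolding ab
      by (intro exI[of _ "x # bs"]) (auto simp: successively_append_iff)
  next
    case False
    then show ?thesis using vs step(1)
      by (intro exI[of _ "x # vs"]) (auto simp: successively_Cons)
  qed
qed

context plane_graph
begin

text \<open>
  The hypothesis of \<open>two_sides\<close>, satisfied by every edge of a cycle (\<open>cycle_edge_on_cycle\<close>).
\<close>

definition on_cycle :: "'a set \<Rightarrow> bool" where
  "on_cycle e \<longleftrightarrow> (\<exists>g a b. arc_from_to (\<gamma> e) a b \<and> arc_from_to g a b \<and>
     path_image (\<gamma> e) \<inter> path_image g = {a, b} \<and> path_image g \<subseteq> S)"

text \<open>
  The open arc of an edge together with the faces on its sides: stepping across that edge stays within
  this set, so an edge of the dual graph becomes an open set of the plane.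
\<close>

definition region :: "'a set \<Rightarrow> complex set" where
  "region e = \<Union>(sides e) \<union> open_arc p \<gamma> e"

lemma region_open:
  assumes e: "e \<in> edges G" "on_cycle e" shows "open (region e)"
proof -
  obtain g a b where g: "arc_from_to (\<gamma> e) a b" "arc_from_to g a b"
    "path_image (\<gamma> e) \<inter> path_image g = {a, b}" "path_image g \<subseteq> S"
    using e(2) unfolding on_cycle_def by auto
  obtain D F1 F2 where D: "open D" "open_arc p \<gamma> e \<subseteq> D" "D \<subseteq> F1 \<union> F2 \<union> open_arc p \<gamma> e"
    "sides e = {F1, F2}" using two_sides[OF e(1) g] by metis
  have "F1 \<in> faces G p \<gamma>" "F2 \<in> faces G p \<gamma>" using D(4) unfolding sides_eq by auto
  then have "open (F1 \<union> F2 \<union> D)" using face_open D(1) by (intro open_Un) simp_all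
  moreover have "F1 \<union> F2 \<union> D = region e" unfolding region_def D(4) using D(2,3) by auto
  ultimately show ?thesis by simp
qed

lemma open_arc_in_drawn_set: assumes "e \<in> edges G" shows "open_arc p \<gamma> e \<subseteq> S"
  using assms unfolding open_arc_def drawn_set_def by auto

lemma open_arcs_disjoint:
  assumes "e \<in> edges G" "e' \<in> edges G" "e \<noteq> e'" shows "open_arc p \<gamma> e \<inter> open_arc p \<gamma> e' = {}"
  using edges_meet[OF assms] unfolding open_arc_def by auto

text \<open>
  A walk between the two sides of \<open>e\<close> across other edges contains a path, which \<open>e\<close> closes up to a cycle.
\<close>

lemma acyclic_imp_not_linked:
  assumes acyc: "\<not> (\<exists>vs es. mg_cycle (weak_dual G p \<gamma>) vs es)"
    and e: "e \<in> medges (weak_dual G p \<gamma>)" "sides e = {F1, F2}" "F1 \<noteq> F2"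
    and r: "r = (\<lambda>x y. \<exists>e'\<in>medges (weak_dual G p \<gamma>) - {e}. sides e' = {x, y})"
  shows "\<not> r\<^sup>*\<^sup>* F1 F2"
proof
  assume "r\<^sup>*\<^sup>* F1 F2"
  then obtain vs where vs: "vs \<noteq> []" "hd vs = F1" "last vs = F2" "distinct vs" "successively r vs"
    using rtranclp_imp_distinct_path by metis
  define n where "n = length vs - 1"
  have n: "length vs = Suc n" "n \<noteq> 0" using vs e(3) unfolding n_def
    by (auto simp: neq_Nil_conv)
  have "\<forall>i<n. \<exists>e'. e' \<in> medges (weak_dual G p \<gamma>) - {e} \<and> sides e' = {vs ! i, vs ! Suc i}"
    using vs(5) n(1) unfolding successively_conv_nth r by auto
  then obtain h where h: "\<And>i. i < n \<Longrightarrow> h i \<in> medges (weak_dual G p \<gamma>) - {e} \<and> sides (h i) = {vs ! i, vs ! Suc i}"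
    by metis
  define es where "es = map h [0..<n] @ [e]"
  have les: "length es = Suc n" unfolding es_def by simp
  have esn: "es ! i = (if i < n then h i else e)" if "i < Suc n" for i
    using that unfolding es_def by (auto simp: nth_append less_Suc_eq)
  have "distinct es"
  proof -
    have "inj_on h {0..<n}"
    proof (rule inj_onI)
      fix i j assume ij: "i \<in> {0..<n}" "j \<in> {0..<n}" "h i = h j"
      then have "{vs ! i, vs ! Suc i} = {vs ! j, vs ! Suc j}" using h by (metis atLeastLessThan_iff)
      then have "i = j \<or> (i = Suc j \<and> j = Suc i)"
        using ij n(1) vs(4) by (auto simp: doubleton_eq_iff nth_eq_iff_index_eq)
      then show "i = j" by (elim disjE conjE) simp_all
    qed
    moreover have "e \<notin> h ` {0..<n}"
    proof
      assume "e \<in> h ` {0..<n}"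
      then obtain i where "i < n" "e = h i" by auto
      then show False using h[of i] by simp
    qed
    ultimately show ?thesis unfolding es_def by (simp add: distinct_map)
  qed
  moreover have "\<forall>i<length es. ends (weak_dual G p \<gamma>) (es ! i) = {vs ! i, vs ! (Suc i mod length es)}"
  proof (intro allI impI)
    fix i assume i: "i < length es"
    show "ends (weak_dual G p \<gamma>) (es ! i) = {vs ! i, vs ! (Suc i mod length es)}"
    proof (cases "i < n")
      case True
      then show ?thesis using esn[of i] h[of i] les by (simp add: weak_dual_def mg_delete_def)
    next
      case False
      then have "i = n" using i les by simp
      then show ?thesis using esn[of i] les e(2) vs(1-3) n
        by (auto simp: weak_dual_def mg_delete_def hd_conv_nth last_conv_nth)
    qed
  qed
  moreover have "set es \<subseteq> medges (weak_dual G p \<gamma>)" using h e(1) unfolding es_def by auto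
  moreover have "set vs \<subseteq> mverts (weak_dual G p \<gamma>)"
  proof
    fix F assume "F \<in> set vs"
    then obtain i where i: "i < Suc n" "F = vs ! i" using n(1) by (metis in_set_conv_nth)
    have "\<exists>e'\<in>medges (weak_dual G p \<gamma>). F \<in> sides e'"
    proof (cases "i < n")
      case True then show ?thesis using h[OF True] i(2) by (intro bexI[of _ "h i"]) auto
    next
      case False
      then have "F = F2" using i vs(1,3) n by (simp add: last_conv_nth less_Suc_eq)
      then show ?thesis using e by (intro bexI[of _ e]) auto
    qed
    then show "F \<in> mverts (weak_dual G p \<gamma>)"
      unfolding weak_dual_def mg_delete_def dual_def by auto
  qed
  ultimately have "mg_cycle (weak_dual G p \<gamma>) vs es"
    unfolding mg_cycle_def using les n(1) vs(4) by (auto simp: es_def)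
  then show False using acyc by blast
qed

text \<open>
  Suppose that \<open>p v\<close> is missed by \<open>SB\<close>, the union of the arcs on the frontier of the unbounded face.
  The faces reachable from the first side \<open>F1\<close> of \<open>e\<close> in the weak dual without crossing \<open>e\<close>, together with
  the arcs crossed on the way, form an open set; so do the remaining faces with the remaining arcs,
  and \<open>F2\<close> is among the latter since the weak dual is acyclic. Hence \<open>F1\<close> and \<open>F2\<close> are separated by \<open>SB\<close>,
  the arc of \<open>e\<close> and the finitely many vertices. However, neither \<open>SB\<close> nor the arc alone separates them
  near \<open>e\<close>, and the two meet in at most the other end of \<open>e\<close>, so by Janiszewski's theorem their union does
  not separate them either, and finitely many points make no difference.
\<close>

lemma ends_on_outer_edges:
  assumes cyc: "\<And>e. e \<in> edges G \<Longrightarrow> on_cycle e"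
    and acyc: "\<not> (\<exists>vs es. mg_cycle (weak_dual G p \<gamma>) vs es)"
    and e: "e \<in> edges G" and v: "v \<in> e"
  defines "B \<equiv> {b \<in> edges G. unbounded_face G p \<gamma> \<in> sides b}"
  shows "p v \<in> (\<Union>b\<in>B. path_image (\<gamma> b))"
proof (rule ccontr)
  define SB where "SB = (\<Union>b\<in>B. path_image (\<gamma> b))"
  assume "p v \<notin> (\<Union>b\<in>B. path_image (\<gamma> b))"
  then have vSB: "p v \<notin> SB" unfolding SB_def .
  have eB: "e \<notin> B"
  proof
    assume "e \<in> B"
    then have "path_image (\<gamma> e) \<subseteq> SB" unfolding SB_def by auto
    then show False using vSB end_points_on_edge[OF e] v by auto
  qed
  have med: "medges (weak_dual G p \<gamma>) = edges G - B"
    unfolding weak_dual_def mg_delete_def dual_def B_def by auto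
  obtain g a b where g: "arc_from_to (\<gamma> e) a b" "arc_from_to g a b"
    "path_image (\<gamma> e) \<inter> path_image g = {a, b}" "path_image g \<subseteq> S"
    using cyc[OF e] unfolding on_cycle_def by auto
  obtain D F1 F2 where D: "open D" "connected D" "open_arc p \<gamma> e \<subseteq> D" "D \<subseteq> F1 \<union> F2 \<union> open_arc p \<gamma> e"
    "F1 \<noteq> F2" "sides e = {F1, F2}" "D \<inter> F1 \<noteq> {}" "D \<inter> F2 \<noteq> {}" using two_sides[OF e g] by metis
  have F: "F1 \<in> faces G p \<gamma>" "F2 \<in> faces G p \<gamma>" using D(6) unfolding sides_eq by auto
  define A where "A = edges G - B - {e}"
  define r where "r = (\<lambda>x y. \<exists>e'\<in>A. sides e' = {x, y})"
  have nr: "\<not> r\<^sup>*\<^sup>* F1 F2"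
    by (rule acyclic_imp_not_linked[OF acyc _ D(6,5)]) (use e eB in \<open>auto simp: med A_def r_def\<close>)
  define K where "K = {F. r\<^sup>*\<^sup>* F1 F}"
  have K12: "F1 \<in> K" "F2 \<notin> K" using nr unfolding K_def by auto
  have Kcl: "sides e' \<subseteq> K \<or> sides e' \<inter> K = {}" "card (sides e') = 2" if e': "e' \<in> A" for e'
  proof -
    have eE: "e' \<in> edges G" using e' unfolding A_def by simp
    obtain g a b where g: "arc_from_to (\<gamma> e') a b" "arc_from_to g a b"
      "path_image (\<gamma> e') \<inter> path_image g = {a, b}" "path_image g \<subseteq> S"
      using cyc[OF eE] unfolding on_cycle_def by auto
    obtain x y where xy: "x \<noteq> y" "sides e' = {x, y}" using two_sides[OF eE g] by metis
    then show "card (sides e') = 2" by simp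
    have "r x y" "r y x" unfolding r_def using xy(2) e' by auto
    then have "x \<in> K \<longleftrightarrow> y \<in> K" unfolding K_def mem_Collect_eq
      by (metis rtranclp.rtrancl_into_rtrancl)
    then show "sides e' \<subseteq> K \<or> sides e' \<inter> K = {}" unfolding xy(2) by auto
  qed
  define Y where "Y = SB \<union> path_image (\<gamma> e) \<union> p ` verts G"
  define X where "X L = \<Union>(L \<inter> faces G p \<gamma>) \<union> \<Union>(region ` {e' \<in> A. sides e' \<subseteq> L})" for L
  have oX: "open (X L)" for L
    unfolding X_def using face_open region_open cyc by (intro open_Un open_Union) (auto simp: A_def)
  have cover: "- Y \<subseteq> X K \<union> X (- K)"
  proof
    fix z assume z: "z \<in> - Y"
    show "z \<in> X K \<union> X (- K)"
    proof (cases "z \<in> S")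
      case False
      then obtain F where "F \<in> faces G p \<gamma>" "z \<in> F" using face_cover by auto
      then show ?thesis unfolding X_def by auto
    next
      case True
      then obtain e' where e': "e' \<in> edges G" "z \<in> path_image (\<gamma> e')"
        using z unfolding Y_def drawn_set_def by auto
      then have e'A: "e' \<in> A" using z unfolding Y_def SB_def A_def by auto
      have "z \<in> open_arc p \<gamma> e'" using e' z edgeD(3)[OF e'(1)] unfolding Y_def open_arc_def by auto
      then have "z \<in> region e'" unfolding region_def by simp
      then show ?thesis using Kcl(1)[OF e'A] e'A unfolding X_def by auto
    qed
  qed
  \<comment> \<open>An edge with one side in \<open>K\<close> has both sides in \<open>K\<close>, so no open arc is in both sets.\<close>
  have disj: "X K \<inter> X (- K) = {}"
  proof -
    have ff: "F \<inter> F' = {}" if "F \<in> faces G p \<gamma>" "F' \<in> faces G p \<gamma>" "F \<in> K" "F' \<notin> K" for F F'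
      using face_unique[OF that(1,2)] that(3,4) by auto
    have fo: "F \<inter> open_arc p \<gamma> e' = {}" if "F \<in> faces G p \<gamma>" "e' \<in> A" for F e'
      using face_disjoint[OF that(1)] open_arc_in_drawn_set[of e'] that(2) unfolding A_def by auto
    have oo: "open_arc p \<gamma> e' \<inter> open_arc p \<gamma> e'' = {}" if "e' \<in> A" "e'' \<in> A" "sides e' \<subseteq> K" "sides e'' \<subseteq> - K" for e' e''
    proof -
      have "sides e' \<noteq> {}" using Kcl(2)[OF that(1)] by (metis card.empty zero_neq_numeral)
      then have "e' \<noteq> e''" using that(3,4) by auto
      then show ?thesis using open_arcs_disjoint that(1,2) unfolding A_def by simp
    qed
    define O' where "O' L = (\<Union>e'\<in>{e' \<in> A. sides e' \<subseteq> L}. open_arc p \<gamma> e')" for L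
    have XO: "X L = \<Union>(L \<inter> faces G p \<gamma>) \<union> O' L" for L
      unfolding X_def region_def O'_def sides_eq by auto
    have "\<Union>(K \<inter> faces G p \<gamma>) \<inter> \<Union>(- K \<inter> faces G p \<gamma>) = {}" using ff by fastforce
    moreover have "\<Union>(L \<inter> faces G p \<gamma>) \<inter> O' L' = {}" for L L' using fo unfolding O'_def by fastforce
    moreover have "O' K \<inter> O' (- K) = {}" using oo unfolding O'_def by fastforce
    ultimately show ?thesis unfolding XO by (simp add: Int_Un_distrib Int_Un_distrib2 Int_commute)
  qed
  obtain w1 w2 where w: "w1 \<in> D \<inter> F1" "w2 \<in> D \<inter> F2" using D(7,8) by auto
  have FS: "F1 \<inter> S = {}" "F2 \<inter> S = {}" using face_disjoint F by auto
  have cSB: "compact SB" unfolding SB_def by (rule compact_edges) (auto simp: B_def)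
  have SBS: "SB \<subseteq> S" unfolding SB_def B_def drawn_set_def by auto
  have SBO: "SB \<inter> open_arc p \<gamma> e = {}"
    using edges_meet[OF e] eB unfolding SB_def B_def open_arc_def by fastforce
  have cg: "compact (path_image (\<gamma> e))" using edgeD(1)[OF e] by (rule compact_arc_image)
  have "\<exists>w. e = {v, w}" using edgeD(4)[OF e] v by (auto simp: card_2_iff)
  then obtain w where ew: "e = {v, w}" by blast
  have "SB \<inter> path_image (\<gamma> e) \<subseteq> {p w}" using SBO vSB unfolding open_arc_def ew by auto
  then have con: "connected (SB \<inter> path_image (\<gamma> e))"
    by (metis connected_empty connected_sing subset_singletonD)
  have c1: "connected_component (- SB) w1 w2"
  proof -
    have "D \<inter> SB = {}" using D(4) FS SBS SBO by blast
    then show ?thesis unfolding connected_component_def using w D(2) by (intro exI[of _ D]) auto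
  qed
  have "w1 \<notin> path_image (\<gamma> e)" "w2 \<notin> path_image (\<gamma> e)" using w FS e unfolding drawn_set_def by auto
  moreover have "connected (- path_image (\<gamma> e))"
    using connected_arc_complement[OF edgeD(1)[OF e]] by simp
  ultimately have c2: "connected_component (- path_image (\<gamma> e)) w1 w2"
    unfolding connected_component_def by (intro exI[of _ "- path_image (\<gamma> e)"]) auto
  have c3: "connected_component (- (SB \<union> path_image (\<gamma> e))) w1 w2"
    using Janiszewski[OF cSB compact_imp_closed[OF cg] con c1 c2] .
  \<comment> \<open>Removing the finite set of vertices keeps a connected open set connected.\<close>
  define C where "C = connected_component_set (- (SB \<union> path_image (\<gamma> e))) w1 - p ` verts G"
  have "open (- (SB \<union> path_image (\<gamma> e)))" using cSB cg by (auto intro: compact_imp_closed)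
  then have "connected C" unfolding C_def
    by (intro connected_open_delete_finite) (auto simp: open_connected_component fin(1))
  moreover have "C \<subseteq> - Y" unfolding C_def Y_def using connected_component_subset by fastforce
  then have "C \<subseteq> X K \<union> X (- K)" using cover by auto
  ultimately have "C \<subseteq> X K \<or> C \<subseteq> X (- K)"
    using connected_disjoint_open_cases oX disj by metis
  moreover have "w1 \<in> C" "w2 \<in> C"
    using w c3 FS unfolding C_def drawn_set_def by (auto simp: connected_component_refl_eq dest: connected_component_in)
  moreover have "w1 \<in> X K" "w2 \<in> X (- K)" using w F K12 unfolding X_def by auto
  ultimately show False using disj by auto
qed

lemma edge_ends_on_unbounded_face:
  assumes cyc: "\<And>e. e \<in> edges G \<Longrightarrow> on_cycle e"
    and acyc: "\<not> (\<exists>vs es. mg_cycle (weak_dual G p \<gamma>) vs es)"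
    and e: "e \<in> edges G" and v: "v \<in> e"
  shows "unbounded_face G p \<gamma> \<in> faces G p \<gamma>" "p v \<in> closure (unbounded_face G p \<gamma>)"
proof -
  obtain b where b: "b \<in> edges G" "unbounded_face G p \<gamma> \<in> sides b" "p v \<in> path_image (\<gamma> b)"
    using ends_on_outer_edges[OF cyc acyc e v] by auto
  then show "unbounded_face G p \<gamma> \<in> faces G p \<gamma>" "p v \<in> closure (unbounded_face G p \<gamma>)"
    unfolding sides_eq frontier_def by auto
qed

end

section \<open>Thetas in a drawn graph\<close>

fun path_edges :: "'a list \<Rightarrow> 'a set set" where
  "path_edges (x # y # zs) = insert {x, y} (path_edges (y # zs))"
| "path_edges zs = {}"

lemma path_edges_subset: "e \<in> path_edges xs \<Longrightarrow> e \<subseteq> set xs"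
  by (induction xs rule: path_edges.induct) auto

lemma path_edges_append:
  "path_edges (xs @ y # ys) = path_edges (xs @ [y]) \<union> path_edges (y # ys)"
proof (induction xs)
  case Nil
  then show ?case by simp
next
  case (Cons x xs)
  then show ?case by (cases xs) auto
qed

lemma path_edges_rev: "path_edges (rev xs) = path_edges xs"
proof (induction xs rule: path_edges.induct)
  case (1 x y zs)
  then show ?case using path_edges_append[of "rev zs" y "[x]"] by (simp add: insert_commute)
qed auto

lemma path_edges_no_shortcut:
  assumes "distinct (s # A @ [t])" "A \<noteq> []" shows "{s, t} \<notin> path_edges (s # A @ [t])"
proof -
  obtain a A' where A: "A = a # A'" using assms(2) by (cases A) auto
  have "s \<notin> set (a # A' @ [t])" using assms(1) A by auto
  then have "{s, t} \<notin> path_edges (a # A' @ [t])" using path_edges_subset by fastforce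
  then show ?thesis using assms(1) A by (auto simp: doubleton_eq_iff)
qed

context plane_graph
begin

lemma path_arc:
  assumes "length xs \<ge> 2" "distinct xs" "path_edges xs \<subseteq> edges G"
  shows "\<exists>g. arc_from_to g (p (hd xs)) (p (last xs)) \<and> path_image g = (\<Union>e\<in>path_edges xs. path_image (\<gamma> e))"
  using assms
proof (induction xs rule: path_edges.induct)
  case (1 x y zs)
  define h where "h = (if pathstart (\<gamma> {x, y}) = p x then \<gamma> {x, y} else reversepath (\<gamma> {x, y}))"
  have e: "{x, y} \<in> edges G" using 1 by simp
  have xy: "x \<noteq> y" using 1(3) by simp
  have "{pathstart (\<gamma> {x, y}), pathfinish (\<gamma> {x, y})} = {p x, p y}" using edgeD(2)[OF e] by simp
  moreover have "p x \<noteq> p y" using inj_p xy edgeD(3)[OF e] unfolding inj_on_def by auto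
  ultimately have h: "arc_from_to h (p x) (p y)" "path_image h = path_image (\<gamma> {x, y})"
    using edgeD(1)[OF e] unfolding arc_from_to_def h_def
    by (auto simp: doubleton_eq_iff arc_reversepath)
  show ?case
  proof (cases zs)
    case Nil
    then show ?thesis using h by (intro exI[of _ h]) simp
  next
    case (Cons z zs')
    then obtain g where g: "arc_from_to g (p y) (p (last (y # zs)))"
      "path_image g = (\<Union>e\<in>path_edges (y # zs). path_image (\<gamma> e))"
      using 1 by auto
    have "path_image h \<inter> path_image g \<subseteq> {p y}"
    proof -
      have "path_image (\<gamma> {x, y}) \<inter> path_image (\<gamma> e) \<subseteq> {p y}" if e': "e \<in> path_edges (y # zs)" for e
      proof -
        have "x \<notin> e" using path_edges_subset[OF e'] 1(3) by auto
        moreover have "e \<in> edges G" using 1(4) e' by auto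
        ultimately show ?thesis using edges_meet[OF \<open>{x, y} \<in> edges G\<close>, of e] by auto
      qed
      then show ?thesis unfolding h g by auto
    qed
    then have "arc (h +++ g)" using h(1) g(1) unfolding arc_from_to_def by (intro arc_join) auto
    then have "arc_from_to (h +++ g) (p x) (p (last (y # zs)))"
      using h(1) g(1) unfolding arc_from_to_def by simp
    moreover have "path_image (h +++ g) = path_image h \<union> path_image g"
      using h(1) g(1) unfolding arc_from_to_def by (intro path_image_join) auto
    ultimately show ?thesis using h(2) g(2) by (intro exI[of _ "h +++ g"]) auto
  qed
qed auto

lemma internally_disjoint_images:
  assumes E: "E \<subseteq> edges G" "E' \<subseteq> edges G" "E \<inter> E' = {}"
    and st: "\<And>e e'. e \<in> E \<Longrightarrow> e' \<in> E' \<Longrightarrow> e \<inter> e' \<subseteq> {s, t}"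
  shows "(\<Union>e\<in>E. path_image (\<gamma> e)) \<inter> (\<Union>e\<in>E'. path_image (\<gamma> e)) \<subseteq> {p s, p t}"
proof -
  have "path_image (\<gamma> e) \<inter> path_image (\<gamma> e') \<subseteq> {p s, p t}" if "e \<in> E" "e' \<in> E'" for e e'
  proof -
    have "e \<noteq> e'" "e \<in> edges G" "e' \<in> edges G" using that E by auto
    then have "path_image (\<gamma> e) \<inter> path_image (\<gamma> e') \<subseteq> p ` (e \<inter> e')" using edges_meet by blast
    also have "\<dots> \<subseteq> p ` {s, t}" using st[OF that] by (rule image_mono)
    finally show ?thesis by simp
  qed
  then show ?thesis by auto
qed

lemma internally_disjoint_paths_meet:
  assumes "distinct (s # A @ B @ [t])" "A \<noteq> []"
    and "path_edges (s # A @ [t]) \<subseteq> edges G" "path_edges (s # B @ [t]) \<subseteq> edges G"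
    and g: "arc_from_to g (p s) (p t)" "path_image g = (\<Union>e\<in>path_edges (s # A @ [t]). path_image (\<gamma> e))"
    and h: "arc_from_to h (p s) (p t)" "path_image h = (\<Union>e\<in>path_edges (s # B @ [t]). path_image (\<gamma> e))"
  shows "path_image g \<inter> path_image h = {p s, p t}"
proof -
  have sub: "e \<inter> e' \<subseteq> {s, t}" if "e \<in> path_edges (s # A @ [t])" "e' \<in> path_edges (s # B @ [t])" for e e'
    using path_edges_subset[OF that(1)] path_edges_subset[OF that(2)] assms(1) by auto
  have "e \<notin> path_edges (s # B @ [t])" if e: "e \<in> path_edges (s # A @ [t])" for e
  proof
    assume e': "e \<in> path_edges (s # B @ [t])"
    have "card e = 2" using edgeD(4) e assms(3) by auto
    moreover have "e \<subseteq> {s, t}" using sub[OF e e'] by simp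
    ultimately have "e = {s, t}" using assms(1) by (intro card_subset_eq) auto
    then show False using path_edges_no_shortcut[of s A t] assms(1,2) e by auto
  qed
  then have "path_edges (s # A @ [t]) \<inter> path_edges (s # B @ [t]) = {}" by auto
  then have "path_image g \<inter> path_image h \<subseteq> {p s, p t}"
    unfolding g(2) h(2) using internally_disjoint_images[OF assms(3,4)] sub by blast
  moreover have "{p s, p t} \<subseteq> path_image g" "{p s, p t} \<subseteq> path_image h"
    using g(1) h(1) pathstart_in_path_image[of g] pathfinish_in_path_image[of g]
      pathstart_in_path_image[of h] pathfinish_in_path_image[of h] unfolding arc_from_to_def by auto
  ultimately show ?thesis by auto
qed

lemma cycle_edge_on_cycle:
  assumes "distinct (u # A @ [v])" "A \<noteq> []" "path_edges (u # A @ [v]) \<subseteq> edges G" "{u, v} \<in> edges G"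
  shows "on_cycle {u, v}"
proof -
  obtain g where g: "arc_from_to g (p u) (p v)" "path_image g = (\<Union>e\<in>path_edges (u # A @ [v]). path_image (\<gamma> e))"
    using path_arc[of "u # A @ [v]"] assms by auto
  obtain h where h: "arc_from_to h (p u) (p v)" "path_image h = (\<Union>e\<in>path_edges (u # [] @ [v]). path_image (\<gamma> e))"
    using path_arc[of "[u, v]"] assms by auto
  have "path_image g \<inter> path_image h = {p u, p v}"
    by (rule internally_disjoint_paths_meet[OF _ assms(2,3) _ g h]) (use assms in auto)
  then have i: "path_image (\<gamma> {u, v}) \<inter> path_image g = {p u, p v}" using h(2) by auto
  have gS: "path_image g \<subseteq> S" unfolding g(2) drawn_set_def using assms(3) by auto
  have "{pathstart (\<gamma> {u, v}), pathfinish (\<gamma> {u, v})} = {p u, p v}" using edgeD(2)[OF assms(4)] by simp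
  then consider "pathstart (\<gamma> {u, v}) = p u" "pathfinish (\<gamma> {u, v}) = p v"
    | "pathstart (\<gamma> {u, v}) = p v" "pathfinish (\<gamma> {u, v}) = p u" by (auto simp: doubleton_eq_iff)
  then show ?thesis
  proof cases
    case 1
    then show ?thesis unfolding on_cycle_def using g i gS edgeD(1)[OF assms(4)]
      by (intro exI[of _ g] exI[of _ "p u"] exI[of _ "p v"]) (auto simp: arc_from_to_def)
  next
    case 2
    then show ?thesis unfolding on_cycle_def using g i gS edgeD(1)[OF assms(4)]
      by (intro exI[of _ "reversepath g"] exI[of _ "p v"] exI[of _ "p u"]) 
        (auto simp: arc_from_to_def arc_reversepath)
  qed
qed

text \<open>
  The inner vertices of the three paths would all lie in the closure of the unbounded face.
\<close>

lemma no_theta: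
  assumes cyc: "\<And>e. e \<in> edges G \<Longrightarrow> on_cycle e"
    and acyc: "\<not> (\<exists>vs es. mg_cycle (weak_dual G p \<gamma>) vs es)"
    and dist: "distinct (s # t # A @ B @ C)" and ne: "A \<noteq> []" "B \<noteq> []" "C \<noteq> []"
    and pA: "path_edges (s # A @ [t]) \<subseteq> edges G"
    and pB: "path_edges (s # B @ [t]) \<subseteq> edges G"
    and pC: "path_edges (s # C @ [t]) \<subseteq> edges G"
  shows False
proof -
  let ?U = "unbounded_face G p \<gamma>"
  have arc: "\<exists>g. arc_from_to g (p s) (p t) \<and> path_image g = (\<Union>e\<in>path_edges (s # X @ [t]). path_image (\<gamma> e))"
    if "distinct (s # X @ [t])" "path_edges (s # X @ [t]) \<subseteq> edges G" for X
    using path_arc[of "s # X @ [t]"] that by simp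
  obtain gA where gA: "arc_from_to gA (p s) (p t)" "path_image gA = (\<Union>e\<in>path_edges (s # A @ [t]). path_image (\<gamma> e))"
    using arc[OF _ pA] dist by auto
  obtain gB where gB: "arc_from_to gB (p s) (p t)" "path_image gB = (\<Union>e\<in>path_edges (s # B @ [t]). path_image (\<gamma> e))"
    using arc[OF _ pB] dist by auto
  obtain gC where gC: "arc_from_to gC (p s) (p t)" "path_image gC = (\<Union>e\<in>path_edges (s # C @ [t]). path_image (\<gamma> e))"
    using arc[OF _ pC] dist by auto
  have iAB: "path_image gA \<inter> path_image gB = {p s, p t}"
    by (rule internally_disjoint_paths_meet[OF _ ne(1) pA pB gA gB]) (use dist in auto)
  have iAC: "path_image gA \<inter> path_image gC = {p s, p t}"
    by (rule internally_disjoint_paths_meet[OF _ ne(1) pA pC gA gC]) (use dist in auto)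
  have iBC: "path_image gB \<inter> path_image gC = {p s, p t}"
    by (rule internally_disjoint_paths_meet[OF _ ne(2) pB pC gB gC]) (use dist in auto)
  have pt: "\<exists>x. x \<in> path_image g - {p s, p t} \<and> x \<in> closure ?U"
    if X: "X \<noteq> []" "distinct (s # X @ [t])" "path_edges (s # X @ [t]) \<subseteq> edges G"
      and g: "path_image g = (\<Union>e\<in>path_edges (s # X @ [t]). path_image (\<gamma> e))" for X g
  proof -
    obtain a X' where X': "X = a # X'" using X(1) by (cases X) auto
    have e: "{s, a} \<in> path_edges (s # X @ [t])" "{s, a} \<in> edges G" using X(3) X' by auto
    have "p a \<in> path_image g" using e end_points_on_edge[OF e(2)] unfolding g by auto
    moreover have "p a \<in> closure ?U" using edge_ends_on_unbounded_face(2)[OF cyc acyc e(2)] by simp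
    moreover have "a \<in> verts G" "s \<in> verts G" using edgeD(3)[OF e(2)] by auto
    moreover have "t \<in> verts G"
    proof -
      obtain Y l where "X = Y @ [l]" using X(1) by (cases X rule: rev_cases) auto
      then have "{l, t} \<in> path_edges (s # X @ [t])"
        using path_edges_append[of "s # Y" l "[t]"] by simp
      then have "{l, t} \<in> edges G" using X(3) by auto
      then show ?thesis using edgeD(3) by auto
    qed
    moreover have "a \<noteq> s" "a \<noteq> t" using X(2) X' by auto
    ultimately show ?thesis using inj_p unfolding inj_on_def by (intro exI[of _ "p a"]) auto
  qed
  obtain x where x: "x \<in> path_image gA - {p s, p t}" "x \<in> closure ?U" using pt[OF ne(1) _ pA gA(2)] dist by auto
  obtain y where y: "y \<in> path_image gB - {p s, p t}" "y \<in> closure ?U" using pt[OF ne(2) _ pB gB(2)] dist by auto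
  obtain z where z: "z \<in> path_image gC - {p s, p t}" "z \<in> closure ?U" using pt[OF ne(3) _ pC gC(2)] dist by auto
  have "\<exists>e. e \<in> edges G" using pA by (cases A) auto
  then obtain e where e: "e \<in> edges G" by blast
  then obtain v where v: "v \<in> e" using edgeD(4)[OF e] by fastforce
  have U: "?U \<in> faces G p \<gamma>" using edge_ends_on_unbounded_face(1)[OF cyc acyc e v] .
  have "path_image gA \<union> path_image gB \<union> path_image gC \<subseteq> S"
    unfolding gA(2) gB(2) gC(2) drawn_set_def using pA pB pC by auto
  then have "?U \<inter> (path_image gA \<union> path_image gB \<union> path_image gC) = {}"
    using face_disjoint[OF U] by auto
  from no_region_touches_theta[OF gA(1) gB(1) gC(1) iAB iAC iBC face_connected[OF U] this x y z]
  show False .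
qed

end

section \<open>List colourings of nested attachments\<close>

text \<open>
  An attachment at a pair \<open>(u, v)\<close> is a path from \<open>u\<close> to \<open>v\<close> without its ends, stored as a list: \<open>Vx x\<close> is a
  vertex \<open>x\<close> of the path, and \<open>Ed x y h\<close> is two consecutive vertices \<open>x\<close> and \<open>y\<close> whose edge carries a further
  attachment \<open>h\<close> at \<open>(x, y)\<close>. In this form edges with attachments are automatically disjoint from each
  other and from \<open>u\<close> and \<open>v\<close>.
\<close>

datatype 'a seg = Vx 'a | Ed 'a 'a "'a seg list"

fun sverts :: "'a seg list \<Rightarrow> 'a list" where
  "sverts [] = []"
| "sverts (Vx x # g) = x # sverts g"
| "sverts (Ed x y h # g) = x # y # sverts h @ sverts g"

text \<open>
  The edges of the attachment, including those to \<open>u\<close> and \<open>v\<close>; the empty list is the bare edge \<open>uv\<close>. The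
  edge \<open>xy\<close> of an entry \<open>Ed x y h\<close> belongs to the path and not to \<open>h\<close>.
\<close>

fun slinks :: "'a \<Rightarrow> 'a seg list \<Rightarrow> 'a \<Rightarrow> ('a \<times> 'a) list" where
  "slinks u [] v = [(u, v)]"
| "slinks u (Vx x # g) v = (u, x) # slinks x g v"
| "slinks u (Ed x y h # g) v = (u, x) # (x, y) # slinks x h y @ slinks y g v"

text \<open>
  A nested attachment with at least two vertices closes a cycle of length at least \<open>4\<close>. With a single
  vertex \<open>slack_forbids\<close> would be weaker, since that vertex is adjacent to both ends.
\<close>

fun swf :: "'a seg list \<Rightarrow> bool" where
  "swf [] \<longleftrightarrow> True"
| "swf (Vx x # g) \<longleftrightarrow> swf g"
| "swf (Ed x y h # g) \<longleftrightarrow> swf h \<and> 2 \<le> length (sverts h) \<and> swf g"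

text \<open>
  The amount by which lists of sizes \<open>f\<close> fall short of the number of vertices and edges, see \<open>slack_eq\<close>.
\<close>

fun slack :: "('a \<Rightarrow> nat) \<Rightarrow> 'a seg list \<Rightarrow> int" where
  "slack f [] = 1"
| "slack f (Vx x # g) = slack f g + 2 - int (f x)"
| "slack f (Ed x y h # g) = slack f h + slack f g + 4 - int (f x) - int (f y)"

lemma slack_eq: "slack f g = int (length (sverts g)) + int (length (slinks u g v)) - int (sum_list (map f (sverts g)))"
  by (induction u g v rule: slinks.induct) auto

definition proper :: "('a \<Rightarrow> nat) \<Rightarrow> ('a \<times> 'a) list \<Rightarrow> bool" where
  "proper c es \<longleftrightarrow> (\<forall>(x, y)\<in>set es. c x \<noteq> c y)"

definition fits :: "('a \<Rightarrow> nat) \<Rightarrow> ('a \<Rightarrow> nat set) \<Rightarrow> 'a set \<Rightarrow> bool" where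
  "fits f L A \<longleftrightarrow> (\<forall>x\<in>A. finite (L x) \<and> card (L x) = f x)"

definition forbids :: "('a \<Rightarrow> nat) \<Rightarrow> 'a \<Rightarrow> 'a seg list \<Rightarrow> 'a \<Rightarrow> (nat \<times> nat) set \<Rightarrow> bool" where
  "forbids f u g v F \<longleftrightarrow> (\<exists>L. fits f L (set (sverts g)) \<and>
     (\<forall>c. (\<forall>x\<in>set (sverts g). c x \<in> L x) \<and> proper c (slinks u g v) \<longrightarrow> (c u, c v) \<notin> F))"

text \<open>
  The sets of pairs of end colours that lists of an attachment of slack \<open>\<sigma>\<close> can forbid, provided that
  it has at least two vertices (\<open>slack_forbids_affordable\<close>). The next lemmas only combine such sets with
  lists at the two ends, without reference to any graph.
\<close>

definition affordable :: "int \<Rightarrow> (nat \<times> nat) set \<Rightarrow> bool" where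
  "affordable \<sigma> F \<longleftrightarrow> F = {} \<or> (1 \<le> \<sigma> \<and> (\<exists>a b. a \<noteq> b \<and> F = {(a, b)})) \<or>
     (2 \<le> \<sigma> \<and> (\<exists>a b. a \<noteq> b \<and> F = {(p, q). p = a \<or> q = b})) \<or> 3 \<le> \<sigma>"

text \<open>
  There are lists of sizes \<open>m\<close> and \<open>n\<close> for the ends of an edge such that an attachment of slack \<open>\<sigma>\<close> at this
  edge leaves only pairs of colours satisfying \<open>R\<close>.
\<close>

definition blocks :: "nat \<Rightarrow> nat \<Rightarrow> int \<Rightarrow> (nat \<Rightarrow> nat \<Rightarrow> bool) \<Rightarrow> bool" where
  "blocks m n \<sigma> R \<longleftrightarrow> (\<exists>X Y F. finite X \<and> card X = m \<and> finite Y \<and> card Y = n \<and> affordable \<sigma> F \<and>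
     (\<forall>p\<in>X. \<forall>q\<in>Y. p = q \<or> (p, q) \<in> F \<or> R p q))"

lemma blocksI:
  assumes "finite X" "m \<le> card X" "finite Y" "n \<le> card Y" "affordable \<sigma> F"
    "\<And>p q. p \<in> X \<Longrightarrow> q \<in> Y \<Longrightarrow> p = q \<or> (p, q) \<in> F \<or> R p q"
  shows "blocks m n \<sigma> R"
proof -
  obtain X' where X': "X' \<subseteq> X" "card X' = m" "finite X'"
    using obtain_subset_with_card_n[OF assms(2)] assms(1) finite_subset by metis
  obtain Y' where Y': "Y' \<subseteq> Y" "card Y' = n" "finite Y'"
    using obtain_subset_with_card_n[OF assms(4)] assms(3) finite_subset by metis
  show ?thesis unfolding blocks_def using X' Y' assms(5,6) by (intro exI[of _ X'] exI[of _ Y'] exI[of _ F]) auto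
qed

lemma affordable_none: "affordable \<sigma> {}" unfolding affordable_def by simp
lemma affordable_pair: "1 \<le> \<sigma> \<Longrightarrow> a \<noteq> b \<Longrightarrow> affordable \<sigma> {(a, b)}" unfolding affordable_def by blast
lemma affordable_both: "2 \<le> \<sigma> \<Longrightarrow> a \<noteq> b \<Longrightarrow> affordable \<sigma> {(p, q). p = a \<or> q = b}" unfolding affordable_def by blast
lemma affordable_all: "3 \<le> \<sigma> \<Longrightarrow> affordable \<sigma> F" unfolding affordable_def by blast

lemma small_cases:
  fixes \<sigma> :: int
  shows "\<sigma> \<le> 0 \<or> \<sigma> = 1 \<or> \<sigma> = 2 \<or> 3 \<le> \<sigma>"
  by linarith

lemma blocks_trivial:
  assumes "m = 0 \<or> n = 0 \<or> 3 \<le> \<sigma>" shows "blocks m n \<sigma> R"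
proof (cases "3 \<le> \<sigma>")
  case True
  show ?thesis by (rule blocksI[of "{..<m}" _ "{..<n}" _ _ UNIV]) (use affordable_all[OF True] in auto)
next
  case False
  then have "m = 0 \<or> n = 0" using assms by simp
  then show ?thesis by (intro blocksI[of "{..<m}" _ "{..<n}" _ _ "{}"]) (auto simp: affordable_none)
qed

text \<open>
  Larger lists make the task harder, so it suffices to treat the largest admissible sizes for each
  value of \<open>\<sigma>\<close>; likewise in the lemmas below.
\<close>

lemma blocks_entirely:
  assumes "int m + int n \<le> 2 + \<sigma>" shows "blocks m n \<sigma> (\<lambda>p q. False)"
proof -
  have one_one: ?thesis if "m = 1 \<and> n = 1"
    by (rule blocksI[of "{0}" _ "{0}", OF _ _ _ _ affordable_none]) (use that in \<open>auto\<close>)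
  have one_two: ?thesis if "1 \<le> \<sigma> \<and> m = 1 \<and> n \<le> 2"
    by (rule blocksI[of "{0}" _ "{0, 1}", OF _ _ _ _ affordable_pair[of \<sigma> 0 1]]) (use that in \<open>auto\<close>)
  have two_one: ?thesis if "1 \<le> \<sigma> \<and> m \<le> 2 \<and> n = 1"
    by (rule blocksI[of "{0, 1}" _ "{0}", OF _ _ _ _ affordable_pair[of \<sigma> 1 0]]) (use that in \<open>auto\<close>)
  have one_any: ?thesis if "2 \<le> \<sigma> \<and> m = 1"
    by (rule blocksI[of "{0}" _ "{..<n}", OF _ _ _ _ affordable_both[of \<sigma> 0 1]]) (use that in \<open>auto\<close>)
  have any_one: ?thesis if "2 \<le> \<sigma> \<and> n = 1"
    by (rule blocksI[of "{..<m}" _ "{0}", OF _ _ _ _ affordable_both[of \<sigma> 1 0]]) (use that in \<open>auto\<close>)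
  have two_two: ?thesis if "2 \<le> \<sigma> \<and> m \<le> 2 \<and> n \<le> 2"
    by (rule blocksI[of "{0, 2}" _ "{1, 2}", OF _ _ _ _ affordable_both[of \<sigma> 0 1]]) (use that in \<open>auto\<close>)
  consider "m = 0 \<or> n = 0 \<or> 3 \<le> \<sigma>" | "\<sigma> \<le> 0" "1 \<le> m" "1 \<le> n" | "\<sigma> = 1" "1 \<le> m" "1 \<le> n" | "\<sigma> = 2" "1 \<le> m" "1 \<le> n"
    using small_cases[of \<sigma>] by (cases "m = 0"; cases "n = 0") auto
  then show ?thesis
  proof cases
    case 1 then show ?thesis by (rule blocks_trivial)
  next
    case 2
    then have "m = 1 \<and> n = 1" using assms(1) by linarith
    then show ?thesis using 2 one_one by auto
  next
    case 3
    then have "m = 1 \<and> n \<le> 2 \<or> m \<le> 2 \<and> n = 1" using assms(1) by linarith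
    then show ?thesis using 3 one_two two_one by auto
  next
    case 4
    then have "m = 1 \<or> n = 1 \<or> m \<le> 2 \<and> n \<le> 2" using assms(1) by linarith
    then show ?thesis using 4 one_any any_one two_two by auto
  qed
qed

text \<open>
  With one colour more than in \<open>blocks_entirely\<close>, one pair \<open>(c, d)\<close> survives, and it can be prescribed. The colours
  have to differ since the two ends are adjacent.
\<close>

lemma blocks_all_but_one:
  assumes "int m + int n \<le> 3 + \<sigma>" and cd: "c \<noteq> d" shows "blocks m n \<sigma> (\<lambda>p q. p = c \<and> q = d)"
proof -
  define r where "r = Suc (c + d)"
  define s where "s = Suc r"
  have rs: "r \<noteq> c" "r \<noteq> d" "s \<noteq> c" "s \<noteq> d" "r \<noteq> s" unfolding r_def s_def by auto
  note ne = rs rs[symmetric] cd cd[symmetric]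
  have one_two: ?thesis if "m = 1 \<and> n \<le> 2"
    by (rule blocksI[of "{c}" _ "{c, d}", OF _ _ _ _ affordable_none]) (use that in \<open>auto simp: ne\<close>)
  have two_one: ?thesis if "m \<le> 2 \<and> n = 1"
    by (rule blocksI[of "{c, d}" _ "{d}", OF _ _ _ _ affordable_none]) (use that in \<open>auto simp: ne\<close>)
  have one_three: ?thesis if "1 \<le> \<sigma> \<and> m = 1 \<and> n \<le> 3"
    by (rule blocksI[of "{c}" _ "{c, d, r}", OF _ _ _ _ affordable_pair[of \<sigma> c r]]) (use that in \<open>auto simp: ne\<close>)
  have three_one: ?thesis if "1 \<le> \<sigma> \<and> m \<le> 3 \<and> n = 1"
    by (rule blocksI[of "{c, d, r}" _ "{d}", OF _ _ _ _ affordable_pair[of \<sigma> r d]]) (use that in \<open>auto simp: ne\<close>)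
  have two_two: ?thesis if "1 \<le> \<sigma> \<and> m \<le> 2 \<and> n \<le> 2"
    by (rule blocksI[of "{c, d}" _ "{c, d}", OF _ _ _ _ affordable_pair[of \<sigma> d c]]) (use that in \<open>auto simp: ne\<close>)
  have one_any: ?thesis if "2 \<le> \<sigma> \<and> m = 1"
    by (rule blocksI[of "{c}" _ "{..<n}", OF _ _ _ _ affordable_both[of \<sigma> c d]]) (use that in \<open>auto simp: ne\<close>)
  have any_one: ?thesis if "2 \<le> \<sigma> \<and> n = 1"
    by (rule blocksI[of "{..<m}" _ "{d}", OF _ _ _ _ affordable_both[of \<sigma> c d]]) (use that in \<open>auto simp: ne\<close>)
  have two_three: ?thesis if "2 \<le> \<sigma> \<and> m \<le> 2 \<and> n \<le> 3"
    by (rule blocksI[of "{c, r}" _ "{d, s, c}", OF _ _ _ _ affordable_both[of \<sigma> r s]]) (use that in \<open>auto simp: ne\<close>)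
  have three_two: ?thesis if "2 \<le> \<sigma> \<and> m \<le> 3 \<and> n \<le> 2"
    by (rule blocksI[of "{c, r, d}" _ "{d, s}", OF _ _ _ _ affordable_both[of \<sigma> r s]]) (use that in \<open>auto simp: ne\<close>)
  consider "m = 0 \<or> n = 0 \<or> 3 \<le> \<sigma>" | "\<sigma> \<le> 0" "1 \<le> m" "1 \<le> n" | "\<sigma> = 1" "1 \<le> m" "1 \<le> n" | "\<sigma> = 2" "1 \<le> m" "1 \<le> n"
    using small_cases[of \<sigma>] by (cases "m = 0"; cases "n = 0") auto
  then show ?thesis
  proof cases
    case 1 then show ?thesis by (rule blocks_trivial)
  next
    case 2
    then have "m = 1 \<and> n \<le> 2 \<or> m \<le> 2 \<and> n = 1" using assms(1) by linarith
    then show ?thesis using 2 one_two two_one by auto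
  next
    case 3
    then have "m = 1 \<and> n \<le> 3 \<or> m \<le> 3 \<and> n = 1 \<or> m \<le> 2 \<and> n \<le> 2" using assms(1) by linarith
    then show ?thesis using 3 one_three three_one two_two by auto
  next
    case 4
    then have "m = 1 \<or> n = 1 \<or> m \<le> 2 \<and> n \<le> 3 \<or> m \<le> 3 \<and> n \<le> 2" using assms(1) by linarith
    then show ?thesis using 4 one_any any_one two_three three_two by auto
  qed
qed

text \<open>
  With two colours more, the surviving pairs still have the prescribed colour at one of the two ends.
\<close>

lemma blocks_off_cross:
  assumes "int m + int n \<le> 4 + \<sigma>" shows "blocks m n \<sigma> (\<lambda>p q. p = c \<or> q = d)"
proof -
  define r where "r = Suc (c + d)"
  define s where "s = Suc r"
  define t where "t = Suc s"
  have rs: "r \<noteq> c" "r \<noteq> d" "s \<noteq> c" "s \<noteq> d" "r \<noteq> s" "t \<noteq> c" "t \<noteq> d" "t \<noteq> r" "t \<noteq> s"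
    unfolding r_def s_def t_def by auto
  note ne = rs rs[symmetric]
  have one_any: ?thesis if "m = 1"
    by (rule blocksI[of "{c}" _ "{..<n}", OF _ _ _ _ affordable_none]) (use that in \<open>auto simp: ne\<close>)
  have any_one: ?thesis if "n = 1"
    by (rule blocksI[of "{..<m}" _ "{d}", OF _ _ _ _ affordable_none]) (use that in \<open>auto simp: ne\<close>)
  have two_two: ?thesis if "m \<le> 2 \<and> n \<le> 2"
    by (rule blocksI[of "{c, r}" _ "{d, r}", OF _ _ _ _ affordable_none]) (use that in \<open>auto simp: ne\<close>)
  have two_three: ?thesis if "1 \<le> \<sigma> \<and> m \<le> 2 \<and> n \<le> 3"
    by (rule blocksI[of "{c, r}" _ "{d, r, s}", OF _ _ _ _ affordable_pair[of \<sigma> r s]]) (use that in \<open>auto simp: ne\<close>)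
  have three_two: ?thesis if "1 \<le> \<sigma> \<and> m \<le> 3 \<and> n \<le> 2"
    by (rule blocksI[of "{c, r, s}" _ "{d, r}", OF _ _ _ _ affordable_pair[of \<sigma> s r]]) (use that in \<open>auto simp: ne\<close>)
  have two_any: ?thesis if "2 \<le> \<sigma> \<and> m \<le> 2"
    by (rule blocksI[of "{c, r}" _ "{..<n}", OF _ _ _ _ affordable_both[of \<sigma> r s]]) (use that in \<open>auto simp: ne\<close>)
  have any_two: ?thesis if "2 \<le> \<sigma> \<and> n \<le> 2"
    by (rule blocksI[of "{..<m}" _ "{d, s}", OF _ _ _ _ affordable_both[of \<sigma> r s]]) (use that in \<open>auto simp: ne\<close>)
  have three_three: ?thesis if "2 \<le> \<sigma> \<and> m \<le> 3 \<and> n \<le> 3"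
    by (rule blocksI[of "{c, r, t}" _ "{d, s, t}", OF _ _ _ _ affordable_both[of \<sigma> r s]]) (use that in \<open>auto simp: ne\<close>)
  consider "m = 0 \<or> n = 0 \<or> 3 \<le> \<sigma>" | "\<sigma> \<le> 0" "1 \<le> m" "1 \<le> n" | "\<sigma> = 1" "1 \<le> m" "1 \<le> n" | "\<sigma> = 2" "1 \<le> m" "1 \<le> n"
    using small_cases[of \<sigma>] by (cases "m = 0"; cases "n = 0") auto
  then show ?thesis
  proof cases
    case 1 then show ?thesis by (rule blocks_trivial)
  next
    case 2
    then have "m = 1 \<or> n = 1 \<or> m \<le> 2 \<and> n \<le> 2" using assms(1) by linarith
    then show ?thesis using 2 one_any any_one two_two by auto
  next
    case 3
    then have "m = 1 \<or> n = 1 \<or> m \<le> 2 \<and> n \<le> 3 \<or> m \<le> 3 \<and> n \<le> 2" using assms(1) by linarith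
    then show ?thesis using 3 one_any any_one two_three three_two by auto
  next
    case 4
    then have "m \<le> 2 \<or> n \<le> 2 \<or> m \<le> 3 \<and> n \<le> 3" using assms(1) by linarith
    then show ?thesis using 4 two_any any_two three_three by auto
  qed
qed

text \<open>
  Slacks of two attachments at the same edge add up.
\<close>

lemma two_attachments_block:
  assumes "int m + int n \<le> 2 + \<sigma> + \<tau>"
  shows "\<exists>X Y F F'. finite X \<and> card X = m \<and> finite Y \<and> card Y = n \<and> affordable \<sigma> F \<and> affordable \<tau> F' \<and>
     (\<forall>p\<in>X. \<forall>q\<in>Y. p = q \<or> (p, q) \<in> F \<union> F')"
proof -
  have split: ?thesis if "affordable \<tau> F'" "blocks m n \<sigma> (\<lambda>p q. (p, q) \<in> F')" for F'
    using that unfolding blocks_def by (metis UnCI)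
  have split': ?thesis if "affordable \<sigma> F" "blocks m n \<tau> (\<lambda>p q. (p, q) \<in> F)" for F
    using that unfolding blocks_def by (metis UnCI)
  have one: ?thesis if "blocks m n \<sigma> (\<lambda>p q. False)"
    using split[OF affordable_none] that by simp
  have one': ?thesis if "blocks m n \<tau> (\<lambda>p q. False)"
    using split'[OF affordable_none] that by simp
  have single: "blocks m n \<rho> (\<lambda>p q. False)" if "2 \<le> \<rho>" "m = 1 \<or> n = 1" for \<rho>
    using that(2)
  proof
    assume "m = 1"
    then show ?thesis using that(1)
      by (intro blocksI[of "{0}" _ "{..<n}" _ _ "{(p, q). p = 0 \<or> q = 1}"]) (auto intro: affordable_both)
  next
    assume "n = 1"
    then show ?thesis using that(1)
      by (intro blocksI[of "{..<m}" _ "{0}" _ _ "{(p, q). p = 1 \<or> q = 0}"]) (auto intro: affordable_both)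
  qed
  have mixed: "blocks m n 1 (\<lambda>p q. p = 0 \<or> q = 1)" if "m \<le> 2 \<and> n \<le> 3 \<or> m \<le> 3 \<and> n \<le> 2"
    using that
  proof (elim disjE conjE)
    assume "m \<le> 2" "n \<le> 3"
    then show ?thesis
      by (intro blocksI[of "{0, 2}" _ "{1, 2, 3}" _ _ "{(2, 3)}"]) (auto intro: affordable_pair)
  next
    assume "m \<le> 3" "n \<le> 2"
    then show ?thesis
      by (intro blocksI[of "{0, 2, 3}" _ "{1, 2}" _ _ "{(3, 2)}"]) (auto intro: affordable_pair)
  qed
  \<comment> \<open>If one slack is not positive, the other attachment alone suffices.\<close>
  consider "m = 0 \<or> n = 0 \<or> 3 \<le> \<sigma>" | "3 \<le> \<tau>" | "\<sigma> \<le> 0" | "\<tau> \<le> 0"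
    | "\<sigma> = 1" "\<tau> = 1" "1 \<le> m" "1 \<le> n" | "\<sigma> = 1" "\<tau> = 2" "1 \<le> m" "1 \<le> n"
    | "\<sigma> = 2" "\<tau> = 1" "1 \<le> m" "1 \<le> n" | "\<sigma> = 2" "\<tau> = 2" "1 \<le> m" "1 \<le> n"
    using small_cases[of \<sigma>] small_cases[of \<tau>] by (cases "m = 0"; cases "n = 0") auto
  then show ?thesis
  proof cases
    case 1 show ?thesis by (rule one[OF blocks_trivial[OF 1]])
  next
    case 2 show ?thesis by (rule one'[OF blocks_trivial]) (use 2 in simp)
  next
    case 3 show ?thesis by (rule one'[OF blocks_entirely]) (use 3 assms in simp)
  next
    case 4 show ?thesis by (rule one[OF blocks_entirely]) (use 4 assms in simp)
  next
    case 5
    consider "m = 1" "n \<le> 3" | "m \<le> 3" "n = 1" | "m \<le> 2" "n \<le> 2" using 5 assms by linarith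
    then show ?thesis
    proof cases
      case 1
      then have "blocks m n \<sigma> (\<lambda>p q. (p, q) \<in> {(0, 1)})" using 5
        by (intro blocksI[of "{0}" _ "{0, 1, 2}" _ _ "{(0, 2)}"]) (auto intro: affordable_pair)
      then show ?thesis using 5 by (intro split[OF affordable_pair[of _ 0 1]]) auto
    next
      case 2
      then have "blocks m n \<sigma> (\<lambda>p q. (p, q) \<in> {(1, 0)})" using 5
        by (intro blocksI[of "{0, 1, 2}" _ "{0}" _ _ "{(2, 0)}"]) (auto intro: affordable_pair)
      then show ?thesis using 5 by (intro split[OF affordable_pair[of _ 1 0]]) auto
    next
      case 3
      then have "blocks m n \<sigma> (\<lambda>p q. (p, q) \<in> {(0, 1)})" using 5
        by (intro blocksI[of "{0, 1}" _ "{0, 1}" _ _ "{(1, 0)}"]) (auto intro: affordable_pair)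
      then show ?thesis using 5 by (intro split[OF affordable_pair[of _ 0 1]]) auto
    qed
  next
    case 6
    consider "m = 1 \<or> n = 1" | "m \<le> 2 \<and> n \<le> 3 \<or> m \<le> 3 \<and> n \<le> 2" using 6 assms by linarith
    then show ?thesis
    proof cases
      case 1 show ?thesis by (rule one'[OF single]) (use 6 1 in auto)
    next
      case 2 show ?thesis using 6 mixed[OF 2] by (intro split[OF affordable_both[of _ 0 1]]) auto
    qed
  next
    case 7
    consider "m = 1 \<or> n = 1" | "m \<le> 2 \<and> n \<le> 3 \<or> m \<le> 3 \<and> n \<le> 2" using 7 assms by linarith
    then show ?thesis
    proof cases
      case 1 show ?thesis by (rule one[OF single]) (use 7 1 in auto)
    next
      case 2 show ?thesis using 7 mixed[OF 2] by (intro split'[OF affordable_both[of _ 0 1]]) auto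
    qed
  next
    case 8
    consider "m \<le> 2" | "n \<le> 2" | "m \<le> 3" "n \<le> 3" using 8 assms by linarith
    then show ?thesis
    proof cases
      case 1
      then have "blocks m n \<sigma> (\<lambda>p q. p = 0 \<or> q = 1)" using 8
        by (intro blocksI[of "{0, 1}" _ "{..<n}" _ _ "{(p, q). p = 1 \<or> q = 0}"]) (auto intro: affordable_both)
      then show ?thesis using 8 by (intro split[OF affordable_both[of _ 0 1]]) auto
    next
      case 2
      then have "blocks m n \<sigma> (\<lambda>p q. p = 0 \<or> q = 1)" using 8
        by (intro blocksI[of "{..<m}" _ "{0, 1}" _ _ "{(p, q). p = 1 \<or> q = 0}"]) (auto intro: affordable_both)
      then show ?thesis using 8 by (intro split[OF affordable_both[of _ 0 1]]) auto
    next
      case 3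
      then have "blocks m n \<sigma> (\<lambda>p q. p = 0 \<or> q = 1)" using 8
        by (intro blocksI[of "{0, 2, 4}" _ "{1, 3, 4}" _ _ "{(p, q). p = 2 \<or> q = 3}"]) (auto intro: affordable_both)
      then show ?thesis using 8 by (intro split[OF affordable_both[of _ 0 1]]) auto
    qed
  qed
qed

lemma forbids_mono: "forbids f u g v F \<Longrightarrow> F' \<subseteq> F \<Longrightarrow> forbids f u g v F'"
  unfolding forbids_def by blast

lemma forbids_none: "forbids f u g v {}"
  unfolding forbids_def fits_def by (intro exI[of _ "\<lambda>x. {..<f x}"]) auto

lemma proper_Cons: "proper c ((x, y) # es) \<longleftrightarrow> c x \<noteq> c y \<and> proper c es"
  and proper_append: "proper c (es @ es') \<longleftrightarrow> proper c es \<and> proper c es'"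
  unfolding proper_def by auto

text \<open>
  If \<open>x\<close> has the list \<open>Z\<close>, a pair \<open>(a, b)\<close> of end colours is forbidden as soon as each colour of \<open>Z\<close> is
  excluded, either by being \<open>a\<close> or by the rest of the path. A list of \<open>f x\<close> of these colours does as well.
\<close>

lemma forbids_Vx:
  assumes g: "forbids f x g v F'" and x: "x \<notin> set (sverts g)" and Z: "finite Z" "f x \<le> card Z"
    and F: "\<And>a b p. (a, b) \<in> F \<Longrightarrow> p \<in> Z \<Longrightarrow> p = a \<or> (p, b) \<in> F'"
  shows "forbids f u (Vx x # g) v F"
proof -
  obtain X where X: "X \<subseteq> Z" "card X = f x" "finite X"
    using obtain_subset_with_card_n[OF Z(2)] Z(1) finite_subset by metis
  obtain L where L: "fits f L (set (sverts g))"
    "\<And>c. (\<forall>x\<in>set (sverts g). c x \<in> L x) \<Longrightarrow> proper c (slinks x g v) \<Longrightarrow> (c x, c v) \<notin> F'"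
    using g unfolding forbids_def by blast
  have "fits f (L(x := X)) (set (sverts (Vx x # g)))" using L(1) X x unfolding fits_def by auto
  moreover have "(c u, c v) \<notin> F" if c: "\<forall>z\<in>set (sverts (Vx x # g)). c z \<in> (L(x := X)) z" 
    "proper c (slinks u (Vx x # g) v)" for c
  proof
    assume Fc: "(c u, c v) \<in> F"
    have "c x \<in> Z" using c(1) X(1) by auto
    then have "c x = c u \<or> (c x, c v) \<in> F'" by (rule F[OF Fc])
    moreover have "\<forall>z\<in>set (sverts g). c z \<in> L z" using c(1) x by (auto split: if_splits)
    ultimately show False using c(2) L(2) by (auto simp: proper_Cons)
  qed
  ultimately show ?thesis unfolding forbids_def by blast
qed

lemma forbids_Ed:
  assumes h: "\<And>F. affordable \<sigma> F \<Longrightarrow> forbids f x h y F" and b: "blocks (f x) (f y) \<sigma> R"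
    and g: "forbids f y g v F'" and d: "distinct (x # y # sverts h @ sverts g)"
    and F: "\<And>a b p q. (a, b) \<in> F \<Longrightarrow> R p q \<Longrightarrow> p = a \<or> (q, b) \<in> F'"
  shows "forbids f u (Ed x y h # g) v F"
proof -
  obtain X Y Fh where XY: "finite X" "card X = f x" "finite Y" "card Y = f y" "affordable \<sigma> Fh"
    "\<And>p q. p \<in> X \<Longrightarrow> q \<in> Y \<Longrightarrow> p = q \<or> (p, q) \<in> Fh \<or> R p q" using b unfolding blocks_def by blast
  obtain L' where L': "fits f L' (set (sverts h))"
    "\<And>c. (\<forall>x\<in>set (sverts h). c x \<in> L' x) \<Longrightarrow> proper c (slinks x h y) \<Longrightarrow> (c x, c y) \<notin> Fh"
    using h[OF XY(5)] unfolding forbids_def by blast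
  obtain L where L: "fits f L (set (sverts g))"
    "\<And>c. (\<forall>x\<in>set (sverts g). c x \<in> L x) \<Longrightarrow> proper c (slinks y g v) \<Longrightarrow> (c y, c v) \<notin> F'"
    using g unfolding forbids_def by blast
  define M where "M = (\<lambda>z. if z = x then X else if z = y then Y else if z \<in> set (sverts h) then L' z else L z)"
  have M: "M x = X" "M y = Y" "\<And>z. z \<in> set (sverts h) \<Longrightarrow> M z = L' z" "\<And>z. z \<in> set (sverts g) \<Longrightarrow> M z = L z"
    unfolding M_def using d by auto
  have "fits f M (set (sverts (Ed x y h # g)))"
    using L(1) L'(1) XY M unfolding fits_def by auto
  moreover have "(c u, c v) \<notin> F" if c: "\<forall>z\<in>set (sverts (Ed x y h # g)). c z \<in> M z" 
    "proper c (slinks u (Ed x y h # g) v)" for c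
  proof
    assume Fc: "(c u, c v) \<in> F"
    have c2: "c u \<noteq> c x" "c x \<noteq> c y" "proper c (slinks x h y)" "proper c (slinks y g v)"
      using c(2) by (auto simp: proper_Cons proper_append)
    have "c x \<in> X" "c y \<in> Y" using c(1) M by auto
    then have "c x = c y \<or> (c x, c y) \<in> Fh \<or> R (c x) (c y)" by (rule XY(6))
    moreover have "(c x, c y) \<notin> Fh" using L'(2)[OF _ c2(3)] c(1) M(3) by auto
    ultimately have "R (c x) (c y)" using c2(2) by simp
    then have "c x = c u \<or> (c y, c v) \<in> F'" by (rule F[OF Fc])
    moreover have "(c y, c v) \<notin> F'" using L(2)[OF _ c2(4)] c(1) M(4) by auto
    ultimately show False using c2(1) by simp
  qed
  ultimately show ?thesis unfolding forbids_def by blast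
qed

text \<open>
  The invariant of the induction. The two conditional clauses cover the exceptional short attachments:
  the bare edge forbids exactly the equal pairs, and a single vertex with one colour forbids this same
  colour at both ends.
\<close>

definition slack_forbids :: "('a \<Rightarrow> nat) \<Rightarrow> 'a \<Rightarrow> 'a seg list \<Rightarrow> 'a \<Rightarrow> bool" where
  "slack_forbids f u g v \<longleftrightarrow>
     (1 \<le> slack f g \<longrightarrow> (\<forall>a b. (if g = [] then a = b else a \<noteq> b) \<longrightarrow> forbids f u g v {(a, b)})) \<and>
     (2 \<le> slack f g \<longrightarrow> (\<forall>a b. (if length (sverts g) = 1 then a = b else a \<noteq> b) \<longrightarrow>
        forbids f u g v {(p, q). p = a \<or> q = b})) \<and>
     (3 \<le> slack f g \<longrightarrow> forbids f u g v UNIV)"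

lemma slack_forbids_affordable:
  assumes "slack_forbids f u g v" "2 \<le> length (sverts g)" "affordable (slack f g) F"
  shows "forbids f u g v F"
proof -
  have "g \<noteq> []" "length (sverts g) \<noteq> 1" using assms(2) by auto
  then show ?thesis
    using assms(1,3) unfolding slack_forbids_def affordable_def
    by (auto intro: forbids_none forbids_mono)
qed

text \<open>
  What the rest \<open>g\<close> of the path achieves for a fixed colour \<open>b\<close> at \<open>v\<close>, by the value of its slack. The colour
  \<open>q\<close> at the near end is at our disposal and avoids any finite set \<open>A\<close>, unless \<open>g\<close> is so short that it
  is forced to be \<open>b\<close>.
\<close>

lemma slack_forbids_tail:
  assumes P: "slack_forbids f x g v" and A: "finite (A :: nat set)"
  obtains "3 \<le> slack f g" "forbids f x g v UNIV"
    | q where "slack f g = 2" "forbids f x g v {(p, q'). p = q \<or> q' = b}" "q \<notin> A \<or> (length (sverts g) = 1 \<and> q = b)"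
    | q where "slack f g = 1" "forbids f x g v {(q, b)}" "q \<notin> A \<or> (g = [] \<and> q = b)"
    | "slack f g \<le> 0"
proof -
  obtain r where r: "r \<notin> A \<union> {b}" using A ex_new_if_finite[of "A \<union> {b}"] by auto
  consider "3 \<le> slack f g" | "slack f g = 2" | "slack f g = 1" | "slack f g \<le> 0" by linarith
  then show thesis
  proof cases
    case 1 then show ?thesis using that(1) P unfolding slack_forbids_def by simp
  next
    case 2
    show ?thesis
    proof (cases "length (sverts g) = 1")
      case True then show ?thesis using that(2)[of b] 2 P unfolding slack_forbids_def by simp
    next
      case False then show ?thesis using that(2)[of r] 2 P r unfolding slack_forbids_def by simp
    qed
  next
    case 3
    show ?thesis
    proof (cases "g = []")
      case True then show ?thesis using that(3)[of b] 3 P unfolding slack_forbids_def by simp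
    next
      case False then show ?thesis using that(3)[of r] 3 P r unfolding slack_forbids_def by simp
    qed
  next
    case 4 then show ?thesis by (rule that(4))
  qed
qed

text \<open>
  The list of \<open>x\<close> consists of the colour \<open>a\<close>, excluded by the edge to \<open>u\<close> when \<open>u\<close> has colour \<open>a\<close>, and of the
  colour \<open>q\<close> excluded by the rest of the path, as far as both are available.
\<close>

lemma slack_forbids_Vx:
  assumes P: "slack_forbids f x g v" and d: "x \<notin> set (sverts g)"
  shows "slack_forbids f u (Vx x # g) v"
proof -
  note V = forbids_Vx[OF _ d, where f = f and v = v and u = u]
  have one: "forbids f u (Vx x # g) v {(a, b)}" if s: "1 \<le> slack f (Vx x # g)" and ab: "a \<noteq> b" for a b
  proof (rule slack_forbids_tail[OF P, where A = "{a}" and b = b])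
    assume "forbids f x g v UNIV"
    then show ?thesis by (rule V[of _ "{..<f x}"]) auto
  next
    fix q assume "forbids f x g v {(p, q'). p = q \<or> q' = b}"
    then show ?thesis by (rule V[of _ "{..<f x}"]) auto
  next
    fix q assume q: "slack f g = 1" "forbids f x g v {(q, b)}" "q \<notin> {a} \<or> (g = [] \<and> q = b)"
    show ?thesis by (rule V[OF q(2), of "{a, q}"]) (use s q ab in auto)
  next
    assume "slack f g \<le> 0"
    then show ?thesis using s by (intro V[OF forbids_none, of "{a}"]) auto
  qed simp
  have two: "forbids f u (Vx x # g) v {(p, q). p = a \<or> q = b}"
    if s: "2 \<le> slack f (Vx x # g)" and ab: "if length (sverts (Vx x # g)) = 1 then a = b else a \<noteq> b" for a b
  proof (rule slack_forbids_tail[OF P, where A = "{a}" and b = b])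
    assume "forbids f x g v UNIV"
    then show ?thesis by (rule V[of _ "{..<f x}"]) auto
  next
    fix q assume q: "slack f g = 2" "forbids f x g v {(p, q'). p = q \<or> q' = b}" "q \<notin> {a} \<or> (length (sverts g) = 1 \<and> q = b)"
    show ?thesis by (rule V[OF q(2), of "{a, q}"]) (use s q ab in \<open>auto split: if_splits\<close>)
  next
    assume sg: "slack f g = 1"
    have "forbids f x g v {(a, b)}"
    proof (cases "g = []")
      case True then show ?thesis using P ab sg unfolding slack_forbids_def by simp
    next
      case False
      then have "sverts g \<noteq> []" by (cases g rule: sverts.cases) auto
      then show ?thesis using P ab sg False unfolding slack_forbids_def by simp
    qed
    then show ?thesis using s sg by (intro V[of _ "{a}"]) auto
  next
    assume "slack f g \<le> 0"
    then show ?thesis using s by (intro V[OF forbids_none, of "{}"]) auto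
  qed simp
  have three: "forbids f u (Vx x # g) v UNIV" if s: "3 \<le> slack f (Vx x # g)"
  proof (rule slack_forbids_tail[OF P, where A = "{}" and b = 0])
    assume "forbids f x g v UNIV"
    then show ?thesis by (rule V[of _ "{..<f x}"]) auto
  next
    fix q assume q: "slack f g = 2" "forbids f x g v {(p, q'). p = q \<or> q' = 0}"
    show ?thesis by (rule V[OF q(2), of "{q}"]) (use s q in auto)
  next
    assume "slack f g = 1"
    then show ?thesis using s by (intro V[OF forbids_none, of "{}"]) auto
  next
    assume "slack f g \<le> 0"
    then show ?thesis using s by (intro V[OF forbids_none, of "{}"]) auto
  qed simp
  show ?thesis unfolding slack_forbids_def using one two three by auto
qed

text \<open>
  The three lemmas on \<open>blocks\<close> leave pairs of colours at \<open>(x, y)\<close> that have colour \<open>a\<close> at \<open>x\<close> or colour \<open>q\<close> at \<open>y\<close>;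
  the former are excluded by the edge to \<open>u\<close>, the latter by the rest of the path. The smaller the slack of
  the rest, the fewer pairs may be left to it.
\<close>

lemma slack_forbids_Ed:
  assumes P: "slack_forbids f y g v" and d: "distinct (x # y # sverts h @ sverts g)"
    and h: "\<And>F. affordable (slack f h) F \<Longrightarrow> forbids f x h y F"
  shows "slack_forbids f u (Ed x y h # g) v"
proof -
  have E: "forbids f u (Ed x y h # g) v F" if "blocks (f x) (f y) (slack f h) R" "forbids f y g v F'" 
      "\<And>a b p q. (a, b) \<in> F \<Longrightarrow> R p q \<Longrightarrow> p = a \<or> (q, b) \<in> F'" for F F' R
    by (rule forbids_Ed[OF h that(1,2) d that(3)])
  have triv: "blocks m n \<sigma> (\<lambda>p q. True)" for m n \<sigma>
    by (rule blocksI[of "{..<m}" _ "{..<n}" _ _ "{}"]) (auto intro: affordable_none)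
  have all: "forbids f u (Ed x y h # g) v F" if "forbids f y g v UNIV" for F
    by (rule E[OF triv that]) auto
  have one: "forbids f u (Ed x y h # g) v {(a, b)}" if s: "1 \<le> slack f (Ed x y h # g)" and ab: "a \<noteq> b" for a b
  proof (rule slack_forbids_tail[OF P, where A = "{}" and b = b])
    assume "forbids f y g v UNIV" then show ?thesis by (rule all)
  next
    fix q assume "forbids f y g v {(p, q'). p = q \<or> q' = b}"
    then show ?thesis by (rule E[OF triv]) auto
  next
    fix q assume q: "slack f g = 1" "forbids f y g v {(q, b)}"
    show ?thesis by (rule E[OF blocks_off_cross[of _ _ _ a q] q(2)]) (use s q in auto)
  next
    assume q: "slack f g \<le> 0"
    show ?thesis by (rule E[OF blocks_all_but_one[of _ _ _ a "Suc a"] forbids_none]) (use s q in auto)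
  qed simp
  have two: "forbids f u (Ed x y h # g) v {(p, q). p = a \<or> q = b}"
    if s: "2 \<le> slack f (Ed x y h # g)" and ab: "a \<noteq> b" for a b
  proof (rule slack_forbids_tail[OF P, where A = "{a}" and b = b])
    assume "forbids f y g v UNIV" then show ?thesis by (rule all)
  next
    fix q assume q: "slack f g = 2" "forbids f y g v {(p, q'). p = q \<or> q' = b}"
    show ?thesis by (rule E[OF blocks_off_cross[of _ _ _ a q] q(2)]) (use s q in auto)
  next
    fix q assume q: "slack f g = 1" "forbids f y g v {(q, b)}" "q \<notin> {a} \<or> (g = [] \<and> q = b)"
    show ?thesis by (rule E[OF blocks_all_but_one[of _ _ _ a q] q(2)]) (use s q ab in auto)
  next
    assume q: "slack f g \<le> 0"
    show ?thesis by (rule E[OF blocks_entirely forbids_none]) (use s q in auto)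
  qed simp
  have three: "forbids f u (Ed x y h # g) v UNIV" if s: "3 \<le> slack f (Ed x y h # g)"
  proof (rule slack_forbids_tail[OF P, where A = "{}" and b = 0])
    assume "forbids f y g v UNIV" then show ?thesis by (rule all)
  next
    fix q assume q: "slack f g = 2" "forbids f y g v {(p, q'). p = q \<or> q' = 0}"
    show ?thesis by (rule E[OF blocks_all_but_one[of _ _ _ "Suc q" q] q(2)]) (use s q in auto)
  next
    assume q: "slack f g = 1"
    show ?thesis by (rule E[OF blocks_entirely forbids_none]) (use s q in auto)
  next
    assume q: "slack f g \<le> 0"
    show ?thesis by (rule E[OF blocks_entirely forbids_none]) (use s q in auto)
  qed simp
  show ?thesis unfolding slack_forbids_def using one two three by auto
qed

lemma slack_forbids:
  assumes "swf g" "distinct (sverts g)" shows "slack_forbids f u g v"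
  using assms
proof (induction u g v rule: slinks.induct)
  case (1 u v)
  have "forbids f u [] v {(a, a)}" for a unfolding forbids_def fits_def by (auto simp: proper_def)
  then show ?case unfolding slack_forbids_def by simp
next
  case (2 u x g v)
  then show ?case by (intro slack_forbids_Vx) auto
next
  case (3 u x y h g v)
  then have "slack_forbids f x h y" "slack_forbids f y g v" by auto
  then show ?case using 3(3,4) by (intro slack_forbids_Ed slack_forbids_affordable) auto
qed

lemma one_attachment_uncolourable:
  assumes "swf g" "2 \<le> length (sverts g)" "distinct (u # v # sverts g)"
    and s: "int (f u) + int (f v) \<le> 2 + slack f g"
  shows "\<exists>L. fits f L (set (u # v # sverts g)) \<and>
    (\<forall>c. (\<forall>x\<in>set (u # v # sverts g). c x \<in> L x) \<longrightarrow> \<not> proper c ((u, v) # slinks u g v))"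
proof -
  obtain X Y F where XY: "finite X" "card X = f u" "finite Y" "card Y = f v" "affordable (slack f g) F"
    "\<And>p q. p \<in> X \<Longrightarrow> q \<in> Y \<Longrightarrow> p = q \<or> (p, q) \<in> F" using blocks_entirely[OF s] unfolding blocks_def by blast
  have "forbids f u g v F" using slack_forbids_affordable[OF slack_forbids] assms XY(5) by auto
  then obtain L where L: "fits f L (set (sverts g))"
    "\<And>c. (\<forall>x\<in>set (sverts g). c x \<in> L x) \<Longrightarrow> proper c (slinks u g v) \<Longrightarrow> (c u, c v) \<notin> F"
    unfolding forbids_def by blast
  define M where "M = L(u := X, v := Y)"
  have M: "M u = X" "M v = Y" "\<And>z. z \<in> set (sverts g) \<Longrightarrow> M z = L z" unfolding M_def using assms(3) by auto
  have "\<not> proper c ((u, v) # slinks u g v)" if c: "\<forall>x\<in>set (u # v # sverts g). c x \<in> M x" for c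
  proof
    assume p: "proper c ((u, v) # slinks u g v)"
    have "c u \<in> X" "c v \<in> Y" "\<forall>x\<in>set (sverts g). c x \<in> L x" using c M by auto
    then show False using p XY(6)[of "c u" "c v"] L(2)[of c] by (auto simp: proper_Cons)
  qed
  moreover have "fits f M (set (u # v # sverts g))" using L(1) M XY unfolding fits_def by auto
  ultimately show ?thesis by blast
qed

lemma two_attachments_uncolourable:
  assumes "swf g" "2 \<le> length (sverts g)" "swf h" "2 \<le> length (sverts h)" 
    and d: "distinct (u # v # sverts g @ sverts h)"
    and s: "int (f u) + int (f v) \<le> 2 + slack f g + slack f h"
  shows "\<exists>L. fits f L (set (u # v # sverts g @ sverts h)) \<and>
    (\<forall>c. (\<forall>x\<in>set (u # v # sverts g @ sverts h). c x \<in> L x) \<longrightarrow>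
      \<not> proper c ((u, v) # slinks u g v @ slinks u h v))"
proof -
  obtain X Y F F' where XY: "finite X" "card X = f u" "finite Y" "card Y = f v" 
    "affordable (slack f g) F" "affordable (slack f h) F'"
    "\<And>p q. p \<in> X \<Longrightarrow> q \<in> Y \<Longrightarrow> p = q \<or> (p, q) \<in> F \<union> F'" using two_attachments_block[OF s] by blast
  have "forbids f u g v F" using slack_forbids_affordable[OF slack_forbids] assms XY(5) by auto
  then obtain L where L: "fits f L (set (sverts g))"
    "\<And>c. (\<forall>x\<in>set (sverts g). c x \<in> L x) \<Longrightarrow> proper c (slinks u g v) \<Longrightarrow> (c u, c v) \<notin> F"
    unfolding forbids_def by blast
  have "forbids f u h v F'" using slack_forbids_affordable[OF slack_forbids] assms XY(6) by auto
  then obtain L' where L': "fits f L' (set (sverts h))"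
    "\<And>c. (\<forall>x\<in>set (sverts h). c x \<in> L' x) \<Longrightarrow> proper c (slinks u h v) \<Longrightarrow> (c u, c v) \<notin> F'"
    unfolding forbids_def by blast
  define M where "M = (\<lambda>z. if z = u then X else if z = v then Y else if z \<in> set (sverts g) then L z else L' z)"
  have M: "M u = X" "M v = Y" "\<And>z. z \<in> set (sverts g) \<Longrightarrow> M z = L z" "\<And>z. z \<in> set (sverts h) \<Longrightarrow> M z = L' z"
    unfolding M_def using d by auto
  have "\<not> proper c ((u, v) # slinks u g v @ slinks u h v)" 
    if c: "\<forall>x\<in>set (u # v # sverts g @ sverts h). c x \<in> M x" for c
  proof
    assume p: "proper c ((u, v) # slinks u g v @ slinks u h v)"
    have "c z \<in> L z" if "z \<in> set (sverts g)" for z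
    proof -
      have "c z \<in> M z" using c that by auto
      then show ?thesis using M(3)[OF that] by simp
    qed
    moreover have "c z \<in> L' z" if "z \<in> set (sverts h)" for z
    proof -
      have "c z \<in> M z" using c that by auto
      then show ?thesis using M(4)[OF that] by simp
    qed
    moreover have "c u \<in> X" "c v \<in> Y" using c M(1,2) by auto
    ultimately
    show False using p XY(7)[of "c u" "c v"] L(2)[of c] L'(2)[of c] by (auto simp: proper_Cons proper_append)
  qed
  moreover have "fits f M (set (u # v # sverts g @ sverts h))" using L(1) L'(1) M XY unfolding fits_def by auto
  ultimately show ?thesis by blast
qed

section \<open>Cycles glued along edges\<close>

definition cycle_list :: "'a graph \<Rightarrow> 'a list \<Rightarrow> bool" where
  "cycle_list C xs \<longleftrightarrow> distinct xs \<and> 4 \<le> length xs \<and> verts C = set xs \<and> edges C = path_edges (xs @ [hd xs])"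

lemma path_edges_snoc: "xs \<noteq> [] \<Longrightarrow> path_edges (xs @ [v]) = insert {last xs, v} (path_edges xs)"
  using path_edges_append[of "butlast xs" "last xs" "[v]"]
  by (cases xs rule: rev_cases) auto

lemma path_edges_conv_nth: "path_edges xs = {{xs ! i, xs ! Suc i} | i. Suc i < length xs}"
proof (induction xs rule: path_edges.induct)
  case (1 x y zs)
  have "{{(x # y # zs) ! i, (x # y # zs) ! Suc i} | i. Suc i < length (x # y # zs)} =
    insert {x, y} {{(y # zs) ! i, (y # zs) ! Suc i} | i. Suc i < length (y # zs)}" (is "?A = ?B")
  proof
    show "?A \<subseteq> ?B"
    proof
      fix e assume "e \<in> ?A"
      then obtain i where i: "Suc i < length (x # y # zs)" "e = {(x # y # zs) ! i, (x # y # zs) ! Suc i}" by auto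
      show "e \<in> ?B"
      proof (cases i)
        case 0 then show ?thesis using i by simp
      next
        case (Suc i')
        then show ?thesis using i by (intro insertI2 CollectI exI[of _ i']) auto
      qed
    qed
    have "{x, y} \<in> ?A" by (intro CollectI exI[of _ 0]) simp
    moreover have "{(y # zs) ! i, (y # zs) ! Suc i} \<in> ?A" if "Suc i < length (y # zs)" for i
      using that by (intro CollectI exI[of _ "Suc i"]) simp
    ultimately show "?B \<subseteq> ?A" by auto
  qed
  then show ?case using 1 by simp
qed auto

lemma cycle_graph_imp_cycle_list:
  assumes "cycle_graph n C" "4 \<le> n" shows "\<exists>xs. cycle_list C xs"
proof -
  obtain xs where xs: "distinct xs" "length xs = n" "verts C = set xs"
    "edges C = {{xs ! i, xs ! (Suc i mod n)} | i. i < n}" using assms(1) unfolding cycle_graph_def by auto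
  have n: "xs \<noteq> []" using xs(2) assms(2) by auto
  have "{(xs @ [hd xs]) ! i, (xs @ [hd xs]) ! Suc i} = {xs ! i, xs ! (Suc i mod n)}" if "i < n" for i
    using that xs(2) n by (cases "Suc i = n") (auto simp: nth_append hd_conv_nth)
  then have "path_edges (xs @ [hd xs]) = edges C"
    unfolding path_edges_conv_nth xs(4) using xs(2) by (intro Collect_cong ex_cong1) auto
  then show ?thesis unfolding cycle_list_def using xs assms by auto
qed

lemma cycle_list_rotate:
  assumes "cycle_list C xs" "u \<in> verts C"
  shows "\<exists>R. cycle_list C (u # R)"
proof -
  obtain A B where AB: "xs = A @ u # B" using assms unfolding cycle_list_def by (metis split_list)
  have "path_edges (xs @ [hd xs]) = path_edges (u # (B @ A) @ [u])"
  proof (cases A)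
    case Nil then show ?thesis using AB by simp
  next
    case (Cons a A')
    have "path_edges (xs @ [hd xs]) = path_edges (A @ [u]) \<union> path_edges (u # B @ [a])"
      using path_edges_append[of A u "B @ [a]"] AB Cons by simp
    moreover have "path_edges (u # (B @ A) @ [u]) = path_edges (u # B @ [a]) \<union> path_edges (A @ [u])"
      using path_edges_append[of "u # B" a "A' @ [u]"] Cons by simp
    ultimately show ?thesis by auto
  qed
  then have "cycle_list C (u # B @ A)" using assms(1) AB unfolding cycle_list_def by auto
  then show ?thesis by blast
qed

lemma path_edges_closed:
  "path_edges (u # a # R @ [b, u]) = {{u, a}, {b, u}} \<union> path_edges (a # R @ [b])"
  using path_edges_append[of "u # a # R" b "[u]"] by auto

lemma cycle_open_edge:
  assumes C: "cycle_list C xs" and e: "{x, y} \<in> edges C"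
  obtains Q where "2 \<le> length Q" "distinct (x # Q @ [y])" "verts C = set (x # Q @ [y])"
    "edges C = insert {x, y} (path_edges (x # Q @ [y]))"
proof -
  have "x \<in> verts C" using e C path_edges_subset[of "{x, y}" "xs @ [hd xs]"] unfolding cycle_list_def
    by (cases xs) auto
  then obtain R where R: "cycle_list C (x # R)" using cycle_list_rotate[OF C] by blast
  obtain a R1 where "R = a # R1" using R unfolding cycle_list_def by (cases R) auto
  moreover obtain R' b where "R1 = R' @ [b]" using R calculation unfolding cycle_list_def
    by (cases R1 rule: rev_cases) auto
  ultimately have Ra: "R = a # R' @ [b]" by simp
  have d: "distinct (x # a # R' @ [b])" "verts C = set (x # a # R' @ [b])" "2 \<le> length (a # R')"
    and ed: "edges C = {{x, a}, {b, x}} \<union> path_edges (a # R' @ [b])"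
    using R path_edges_closed[of x a R' b] unfolding Ra cycle_list_def by auto
  have "{x, y} \<notin> path_edges (a # R' @ [b])" using path_edges_subset[of "{x, y}" "a # R' @ [b]"] d(1) by auto
  then have "y = a \<or> y = b" using e ed by (auto simp: doubleton_eq_iff)
  then show thesis
  proof
    assume y: "y = b"
    show thesis by (rule that[of "a # R'"]) (use y d ed in \<open>auto simp: insert_commute\<close>)
  next
    assume y: "y = a"
    have "path_edges (x # rev (R' @ [b]) @ [a]) = path_edges (rev (a # R' @ [b, x]))" by simp
    also have "\<dots> = path_edges (a # R' @ [b, x])" by (rule path_edges_rev)
    also have "\<dots> = path_edges (a # R' @ [b]) \<union> {{b, x}}" using path_edges_append[of "a # R'" b "[x]"] by simp
    finally have "path_edges (x # rev (R' @ [b]) @ [a]) = path_edges (a # R' @ [b]) \<union> {{b, x}}" .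
    then show thesis by (intro that[of "rev (R' @ [b])"]) (use y d ed in auto)
  qed
qed

text \<open>
  For two cycles that share \<open>{u, v}\<close> without sharing the edge \<open>uv\<close>, this yields two of the three paths of a
  theta.
\<close>

lemma cycle_split_at_nonedge:
  assumes C: "cycle_list C xs" and uv: "u \<in> verts C" "v \<in> verts C" "u \<noteq> v" "{u, v} \<notin> edges C"
  obtains A B where "A \<noteq> []" "B \<noteq> []" "distinct (u # v # A @ B)" "set A \<union> set B \<subseteq> verts C"
    "path_edges (u # A @ [v]) \<subseteq> edges C" "path_edges (u # B @ [v]) \<subseteq> edges C"
proof -
  obtain R where R: "cycle_list C (u # R)" using cycle_list_rotate[OF C uv(1)] by blast
  then have "v \<in> set R" using uv unfolding cycle_list_def by auto
  then obtain A B where AB: "R = A @ v # B" by (meson split_list)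
  have ed: "edges C = path_edges (u # A @ [v]) \<union> path_edges (v # B @ [u])"
    using R path_edges_append[of "u # A" v "B @ [u]"] unfolding AB cycle_list_def by simp
  have r: "path_edges (u # rev B @ [v]) = path_edges (v # B @ [u])"
    using path_edges_rev[of "v # B @ [u]"] by simp
  show thesis
  proof (rule that[of A "rev B"])
    show "A \<noteq> []" using ed uv(4) by auto
    show "rev B \<noteq> []" using ed uv(4) by (auto simp: insert_commute)
  qed (use R AB ed r in \<open>auto simp: cycle_list_def\<close>)
qed

lemma cycle_edge_doubleton:
  assumes "cycle_list C xs" "e \<in> edges C" obtains x y where "e = {x, y}"
proof -
  have "e \<in> {{(xs @ [hd xs]) ! i, (xs @ [hd xs]) ! Suc i} | i. Suc i < length (xs @ [hd xs])}"
    using assms unfolding cycle_list_def path_edges_conv_nth by blast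
  then show thesis using that by blast
qed

definition union_verts :: "(nat \<Rightarrow> 'a graph) \<Rightarrow> nat set \<Rightarrow> 'a set" where
  "union_verts C K = (\<Union>i\<in>K. verts (C i))"

definition union_edges :: "(nat \<Rightarrow> 'a graph) \<Rightarrow> nat set \<Rightarrow> 'a set set" where
  "union_edges C K = (\<Union>i\<in>K. edges (C i))"

text \<open>
  Cut the list after the last element of \<open>A\<close> that precedes the first element of \<open>B\<close>.
\<close>

lemma segment_between:
  assumes "vs \<noteq> []" "hd vs \<in> A" "last vs \<in> B" "A \<inter> B = {}"
  obtains as a W b bs where "vs = as @ a # W @ b # bs" "a \<in> A" "b \<in> B" "set W \<inter> (A \<union> B) = {}"
proof -
  have "\<exists>x\<in>set vs. x \<in> B" using assms(1,3) last_in_set by blast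
  then obtain p b bs where p: "vs = p @ b # bs" "b \<in> B" "\<forall>z\<in>set p. z \<notin> B"
    using split_list_first_prop[of vs "\<lambda>z. z \<in> B"] by blast
  have "p \<noteq> []" using p assms(2,4) by auto
  then have "\<exists>x\<in>set p. x \<in> A" using assms(2) p(1) by (intro bexI[of _ "hd p"]) auto
  then obtain as a W where q: "p = as @ a # W" "a \<in> A" "\<forall>z\<in>set W. z \<notin> A"
    using split_list_last_prop[of p "\<lambda>z. z \<in> A"] by blast
  show thesis by (rule that[of as a W b bs]) (use p q in auto)
qed

lemma successively_path_edges:
  assumes "successively r xs" "\<And>x y. r x y \<Longrightarrow> {x, y} \<in> E"
  shows "path_edges xs \<subseteq> E"
  using assms by (induction xs rule: path_edges.induct) auto

text \<open>
  The combinatorial content of a tree of cycles. That the cycles meet like the nodes of a forest is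
  not assumed; it follows from the absence of thetas.
\<close>

locale cycle_forest =
  fixes C :: "nat \<Rightarrow> 'a graph" and I :: "nat set"
  assumes finite_I: "finite I"
    and cycle: "i \<in> I \<Longrightarrow> \<exists>xs. cycle_list (C i) xs"
    and share: "i \<in> I \<Longrightarrow> j \<in> I \<Longrightarrow> i \<noteq> j \<Longrightarrow> verts (C i) \<inter> verts (C j) \<noteq> {} \<Longrightarrow>
      \<exists>u v. u \<noteq> v \<and> verts (C i) \<inter> verts (C j) = {u, v} \<and> {u, v} \<in> edges (C i) \<and> {u, v} \<in> edges (C j)"
    and at_most_two: "i \<in> I \<Longrightarrow> j \<in> I \<Longrightarrow> l \<in> I \<Longrightarrow> i \<noteq> j \<Longrightarrow> i \<noteq> l \<Longrightarrow> j \<noteq> l \<Longrightarrow> 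
      verts (C i) \<inter> verts (C j) \<inter> verts (C l) = {}"
    and no_theta: "distinct (s # t # P @ Q @ R) \<Longrightarrow> P \<noteq> [] \<Longrightarrow> Q \<noteq> [] \<Longrightarrow> R \<noteq> [] \<Longrightarrow>
      path_edges (s # P @ [t]) \<subseteq> union_edges C I \<Longrightarrow> path_edges (s # Q @ [t]) \<subseteq> union_edges C I \<Longrightarrow>
      path_edges (s # R @ [t]) \<subseteq> union_edges C I \<Longrightarrow> False"
begin

definition linked_avoiding :: "'a \<Rightarrow> 'a \<Rightarrow> 'a \<Rightarrow> 'a \<Rightarrow> bool" where
  "linked_avoiding u v = (\<lambda>a b. {a, b} \<in> union_edges C I \<and> a \<notin> {u, v} \<and> b \<notin> {u, v})\<^sup>*\<^sup>*"

text \<open>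
  Let \<open>Q1\<close> and \<open>Q2\<close> be the cycles without the edge \<open>uv\<close>, and take a path outside both from an inner vertex \<open>a\<close>
  of \<open>Q2\<close> to an inner vertex \<open>b\<close> of \<open>Q1\<close>. Since \<open>Q2\<close> has at least two inner vertices, one of its two parts
  at \<open>a\<close>, say the one ending in \<open>u\<close>, has an inner vertex. It forms a theta with the path from \<open>u\<close> over \<open>v\<close> along
  the other part to \<open>a\<close> and the path from \<open>u\<close> along \<open>Q1\<close> to \<open>b\<close> and on to \<open>a\<close>.
\<close>

lemma no_bypass:
  assumes ij: "i \<in> I" "j \<in> I" "i \<noteq> j" and uv: "u \<noteq> v" "verts (C i) \<inter> verts (C j) = {u, v}" 
    "{u, v} \<in> edges (C i)" "{u, v} \<in> edges (C j)"
    and y: "y \<in> verts (C j) - {u, v}" and x: "x \<in> verts (C i) - {u, v}"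
  shows "\<not> linked_avoiding u v y x"
proof
  assume "linked_avoiding u v y x"
  from rtranclp_imp_distinct_path[OF this[unfolded linked_avoiding_def]]
  obtain vs where vs: "vs \<noteq> []" "hd vs = y" "last vs = x" "distinct vs" 
    "successively (\<lambda>a b. {a, b} \<in> union_edges C I \<and> a \<notin> {u, v} \<and> b \<notin> {u, v}) vs"
    by (elim exE conjE)
  have dj: "(verts (C j) - {u, v}) \<inter> (verts (C i) - {u, v}) = {}" using uv(2) by blast
  obtain as a W b bs where w: "vs = as @ a # W @ b # bs" "a \<in> verts (C j) - {u, v}" "b \<in> verts (C i) - {u, v}"
    "set W \<inter> ((verts (C j) - {u, v}) \<union> (verts (C i) - {u, v})) = {}"
    by (rule segment_between[OF vs(1) _ _ dj]) (use vs(2,3) x y in simp_all)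
  have suc: "successively (\<lambda>a b. {a, b} \<in> union_edges C I \<and> a \<notin> {u, v} \<and> b \<notin> {u, v}) (a # W @ [b])"
  proof -
    have "vs = as @ (a # W @ [b]) @ bs" using w(1) by simp
    from vs(5)[unfolded this] show ?thesis unfolding successively_append_iff by blast
  qed
  have pW: "path_edges (a # W @ [b]) \<subseteq> union_edges C I"
    by (rule successively_path_edges[OF suc]) simp
  have Wuv: "u \<notin> set W" "v \<notin> set W"
  proof -
    have "z \<notin> {u, v}" if z: "z \<in> set W" for z
    proof -
      obtain W1 W2 where "W = W1 @ z # W2" using z by (meson split_list)
      then have "a # W @ [b] = (a # W1) @ (z # W2 @ [b])" by simp
      then have "successively (\<lambda>a b. {a, b} \<in> union_edges C I \<and> a \<notin> {u, v} \<and> b \<notin> {u, v})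
          ((a # W1) @ (z # W2 @ [b]))" using suc by simp
      then show ?thesis unfolding successively_append_iff by simp
    qed
    then show "u \<notin> set W" "v \<notin> set W" by auto
  qed
  have dW: "distinct (a # W @ [b])" using vs(4) w(1) by auto
  obtain xs ys where cyc: "cycle_list (C i) xs" "cycle_list (C j) ys" using cycle ij by metis
  obtain Q2 where Q2: "2 \<le> length Q2" "distinct (u # Q2 @ [v])" "verts (C j) = set (u # Q2 @ [v])"
    "edges (C j) = insert {u, v} (path_edges (u # Q2 @ [v]))" using cycle_open_edge[OF cyc(2) uv(4)] .
  obtain Q1 where Q1: "2 \<le> length Q1" "distinct (u # Q1 @ [v])" "verts (C i) = set (u # Q1 @ [v])"
    "edges (C i) = insert {u, v} (path_edges (u # Q1 @ [v]))" using cycle_open_edge[OF cyc(1) uv(3)] .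
  have "a \<in> set Q2" "b \<in> set Q1" using w Q1(3) Q2(3) by auto
  then obtain S T P P' where ST: "Q2 = S @ a # T" "Q1 = P @ b # P'" by (meson split_list)
  have dis: "set Q1 \<inter> set Q2 = {}" "set W \<inter> set Q1 = {}" "set W \<inter> set Q2 = {}"
    using uv(2) Q1(2,3) Q2(2,3) w(4) by auto
  have sub: "edges (C i) \<subseteq> union_edges C I" "edges (C j) \<subseteq> union_edges C I"
    using ij unfolding union_edges_def by auto
  have e2: "edges (C j) = {{u, v}} \<union> path_edges (u # S @ [a]) \<union> path_edges (a # T @ [v])"
    using Q2(4) path_edges_append[of "u # S" a "T @ [v]"] unfolding ST by auto
  have e1: "edges (C i) = {{u, v}} \<union> path_edges (u # P @ [b]) \<union> path_edges (b # P' @ [v])"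
    using Q1(4) path_edges_append[of "u # P" b "P' @ [v]"] unfolding ST by auto
  have rT: "path_edges (v # rev T @ [a]) = path_edges (a # T @ [v])" using path_edges_rev[of "a # T @ [v]"] by simp
  have rW: "path_edges (b # rev W @ [a]) = path_edges (a # W @ [b])" using path_edges_rev[of "a # W @ [b]"] by simp
  have rP: "path_edges (v # rev P' @ [b]) = path_edges (b # P' @ [v])" using path_edges_rev[of "b # P' @ [v]"] by simp
  have vu: "{v, u} = {u, v}" by auto
  show False
  proof (cases "S = []")
    case False
    show False
    proof (rule no_theta[of u a S "v # rev T" "P @ b # rev W"])
      show "distinct (u # a # S @ (v # rev T) @ P @ b # rev W)"
        using Q1(2) Q2(2) dW dis Wuv unfolding ST by auto
      show "path_edges (u # S @ [a]) \<subseteq> union_edges C I" using e2 sub by auto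
      show "path_edges (u # (v # rev T) @ [a]) \<subseteq> union_edges C I" using e2 sub rT by auto
      show "path_edges (u # (P @ b # rev W) @ [a]) \<subseteq> union_edges C I"
        using path_edges_append[of "u # P" b "rev W @ [a]"] e1 sub rW pW by auto
    qed (use False in auto)
  next
    case True
    then have T: "T \<noteq> []" using Q2(1) ST by auto
    show False
    proof (rule no_theta[of v a "rev T" "u # S" "rev P' @ b # rev W"])
      show "distinct (v # a # rev T @ (u # S) @ rev P' @ b # rev W)"
        using Q1(2) Q2(2) dW dis Wuv unfolding ST by auto
      show "path_edges (v # rev T @ [a]) \<subseteq> union_edges C I" using e2 sub rT by auto
      show "path_edges (v # (u # S) @ [a]) \<subseteq> union_edges C I" using e2 sub by (auto simp: vu)
      show "path_edges (v # (rev P' @ b # rev W) @ [a]) \<subseteq> union_edges C I"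
        using path_edges_append[of "v # rev P'" b "rev W @ [a]"] e1 sub rW rP pW by auto
    qed (use T in auto)
  qed
qed

lemma path_linked:
  assumes "path_edges xs \<subseteq> union_edges C I" "u \<notin> set xs" "v \<notin> set xs" "a \<in> set xs" "b \<in> set xs"
  shows "linked_avoiding u v a b"
proof -
  let ?r = "\<lambda>a b. {a, b} \<in> union_edges C I \<and> a \<notin> {u, v} \<and> b \<notin> {u, v}"
  have from_hd: "?r\<^sup>*\<^sup>* (hd xs) z" if "z \<in> set xs" for z
    using assms(1-3) that
  proof (induction xs rule: path_edges.induct)
    case (1 x y zs)
    show ?case
    proof (cases "z = x")
      case False
      then have yz: "?r\<^sup>*\<^sup>* y z" using 1 by auto
      have "?r x y" using 1 by auto
      from converse_rtranclp_into_rtranclp[of ?r, OF this yz] show ?thesis by simp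
    qed simp
  qed auto
  have "symp ?r" by (auto simp: symp_def insert_commute)
  then have "symp ?r\<^sup>*\<^sup>*" by (rule symp_rtranclp)
  then have "?r\<^sup>*\<^sup>* a (hd xs)" using from_hd[OF assms(4)] by (auto dest: sympD)
  then show ?thesis using from_hd[OF assms(5)] unfolding linked_avoiding_def by (rule rtranclp_trans)
qed

definition overlap :: "nat set \<Rightarrow> nat \<Rightarrow> nat \<Rightarrow> bool" where
  "overlap K i j \<longleftrightarrow> i \<in> K \<and> j \<in> K \<and> verts (C i) \<inter> verts (C j) \<noteq> {}"

definition linked_cycles :: "nat set \<Rightarrow> bool" where
  "linked_cycles K \<longleftrightarrow> (\<forall>i\<in>K. \<forall>j\<in>K. (overlap K)\<^sup>*\<^sup>* i j)"

text \<open>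
  The ends \<open>u\<close> and \<open>v\<close> of the edge shared with \<open>C j\<close> lie on no other cycle of \<open>K\<close>. So one can walk from \<open>C j\<close>
  through the linked cycles of \<open>K\<close> to any other of them without using \<open>u\<close> and \<open>v\<close>; if the new cycle met that one
  too, this would be a bypass.
\<close>

lemma only_one_overlap:
  assumes K: "K \<subseteq> I" "linked_cycles K" and i: "i \<in> I" "i \<notin> K" and j: "j \<in> K" "verts (C i) \<inter> verts (C j) \<noteq> {}"
    and l: "l \<in> K" "l \<noteq> j"
  shows "verts (C i) \<inter> verts (C l) = {}"
proof (rule ccontr)
  assume "verts (C i) \<inter> verts (C l) \<noteq> {}"
  then obtain z where z: "z \<in> verts (C i)" "z \<in> verts (C l)" by blast
  have jI: "j \<in> I" "l \<in> I" "i \<noteq> j" "i \<noteq> l" using K i j l by auto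
  obtain u v where uv: "u \<noteq> v" "verts (C i) \<inter> verts (C j) = {u, v}" "{u, v} \<in> edges (C i)" "{u, v} \<in> edges (C j)"
    using share[OF i(1) jI(1,3) j(2)] by blast
  have only: "u \<notin> verts (C m)" "v \<notin> verts (C m)" if "m \<in> K" "m \<noteq> j" for m
  proof -
    have "verts (C i) \<inter> verts (C j) \<inter> verts (C m) = {}"
      using at_most_two[of i j m] that K i jI by auto
    then show "u \<notin> verts (C m)" "v \<notin> verts (C m)" unfolding uv(2) by auto
  qed
  obtain ys where ys: "cycle_list (C j) ys" using cycle[OF jI(1)] by blast
  obtain Q where Q: "2 \<le> length Q" "distinct (u # Q @ [v])" "verts (C j) = set (u # Q @ [v])"
    "edges (C j) = insert {u, v} (path_edges (u # Q @ [v]))" using cycle_open_edge[OF ys uv(4)] .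
  obtain y0 Q' where y0: "Q = y0 # Q'" using Q(1) by (cases Q) auto
  have pQ: "path_edges Q \<subseteq> union_edges C I"
  proof -
    have "path_edges Q \<subseteq> path_edges (Q @ [v])" using path_edges_snoc[of Q v] y0 by auto
    also have "\<dots> \<subseteq> edges (C j)" using Q(4) y0 by auto
    finally show ?thesis using jI unfolding union_edges_def by auto
  qed
  have start: "linked_avoiding u v y0 w" if "w \<in> verts (C j) - {u, v}" for w
    by (rule path_linked[OF pQ]) (use that Q(2,3) y0 in auto)
  have "(overlap K)\<^sup>*\<^sup>* j l" using K(2) j l unfolding linked_cycles_def by blast
  then have "\<forall>w\<in>verts (C l) - {u, v}. linked_avoiding u v y0 w"
  proof (induction rule: rtranclp_induct)
    case base show ?case using start by blast
  next
    case (step m m')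
    have m: "m \<in> K" "m' \<in> K" "verts (C m) \<inter> verts (C m') \<noteq> {}" using step(2) unfolding overlap_def by auto
    show ?case
    proof (cases "m' = j")
      case True then show ?thesis using start by blast
    next
      case False
      obtain w where w: "w \<in> verts (C m)" "w \<in> verts (C m')" using m(3) by blast
      have m'I: "m' \<in> I" using m K by blast
      obtain xs where xs: "cycle_list (C m') xs" using cycle[OF m'I] by blast
      have uvx: "u \<notin> set xs" "v \<notin> set xs" using only[OF m(2) False] xs unfolding cycle_list_def by auto
      have "xs \<noteq> []" using xs unfolding cycle_list_def by auto
      then have "path_edges xs \<subseteq> path_edges (xs @ [hd xs])" using path_edges_snoc[of xs "hd xs"] by auto
      then have pxs: "path_edges xs \<subseteq> union_edges C I"
        using xs m'I unfolding cycle_list_def union_edges_def by auto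
      have "linked_avoiding u v y0 w" using step(3) w only[OF m(2) False] by auto
      moreover have "linked_avoiding u v w w'" if "w' \<in> verts (C m')" for w'
        by (rule path_linked[OF pxs uvx]) (use that w xs in \<open>auto simp: cycle_list_def\<close>)
      ultimately show ?thesis unfolding linked_avoiding_def by (meson DiffD1 rtranclp_trans)
    qed
  qed
  moreover have "z \<notin> {u, v}" using only[OF l] z by auto
  ultimately have "linked_avoiding u v y0 z" using z by blast
  moreover have "y0 \<in> verts (C j) - {u, v}" using Q(2,3) y0 by auto
  ultimately show False using no_bypass[OF i(1) jI(1,3) uv] z \<open>z \<notin> {u, v}\<close> by auto
qed

end

section \<open>Decomposition into a root edge and its attachments\<close>

text \<open>
  The vertices to which no further attachment may be added.
\<close>

fun attachment_points :: "'a seg list \<Rightarrow> 'a set" where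
  "attachment_points [] = {}"
| "attachment_points (Vx x # g) = attachment_points g"
| "attachment_points (Ed x y h # g) = {x, y} \<union> attachment_points h \<union> attachment_points g"

definition link_edges :: "('a \<times> 'a) list \<Rightarrow> 'a set set" where
  "link_edges es = (\<lambda>(x, y). {x, y}) ` set es"

lemma link_edges_simps: "link_edges [] = {}" "link_edges ((x, y) # es) = insert {x, y} (link_edges es)"
  "link_edges (es @ es') = link_edges es \<union> link_edges es'"
  unfolding link_edges_def by auto

lemma link_edges_mset: "mset es = mset es1 + mset es2 \<Longrightarrow> link_edges es = link_edges es1 \<union> link_edges es2"
proof -
  assume "mset es = mset es1 + mset es2"
  then have "set_mset (mset es) = set_mset (mset es1 + mset es2)" by simp
  then show ?thesis unfolding link_edges_def by (simp add: image_Un)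
qed

lemma slinks_verts: "(x, y) \<in> set (slinks u g v) \<Longrightarrow> x \<in> insert u (set (sverts g)) \<and> y \<in> insert v (set (sverts g))"
  by (induction u g v rule: slinks.induct) auto

lemma plain_path: "sverts (map Vx Q) = Q" "swf (map Vx Q)" "attachment_points (map Vx Q) = {}"
  "link_edges (slinks x (map Vx Q) y) = path_edges (x # Q @ [y])"
proof -
  show "sverts (map Vx Q) = Q" "swf (map Vx Q)" "attachment_points (map Vx Q) = {}" by (induction Q) auto
  show "link_edges (slinks x (map Vx Q) y) = path_edges (x # Q @ [y])"
    by (induction Q arbitrary: x) (auto simp: link_edges_simps)
qed

text \<open>
  Two plain consecutive entries \<open>Vx x\<close> and \<open>Vx y\<close>, at whatever depth, turn into \<open>Ed x y h\<close>. Multisets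
  record that no vertex and no edge is duplicated.
\<close>

lemma insert_attachment:
  assumes "(x, y) \<in> set (slinks u g v)" "distinct (u # v # sverts g)"
    "{x, y} \<inter> ({u, v} \<union> attachment_points g) = {}" "swf g" "swf h" "2 \<le> length (sverts h)"
  shows "\<exists>g'. swf g' \<and> mset (sverts g') = mset (sverts g) + mset (sverts h) \<and>
    mset (slinks u g' v) = mset (slinks u g v) + mset (slinks x h y) \<and>
    attachment_points g' = attachment_points g \<union> {x, y} \<union> attachment_points h"
  using assms(1-4)
proof (induction u g v rule: slinks.induct)
  case (1 u v)
  then show ?case by auto
next
  case (2 u w g v)
  have xy: "(x, y) \<in> set (slinks w g v)" using "2.prems"(1,3) by auto
  show ?case
  proof (cases "w \<in> {x, y}")
    case False
    have "\<exists>g'. swf g' \<and> mset (sverts g') = mset (sverts g) + mset (sverts h) \<and>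
      mset (slinks w g' v) = mset (slinks w g v) + mset (slinks x h y) \<and>
      attachment_points g' = attachment_points g \<union> {x, y} \<union> attachment_points h"
      by (rule "2.IH"[OF xy]) (use "2.prems" False in auto)
    then obtain g' where "swf g'" "mset (sverts g') = mset (sverts g) + mset (sverts h)"
      "mset (slinks w g' v) = mset (slinks w g v) + mset (slinks x h y)"
      "attachment_points g' = attachment_points g \<union> {x, y} \<union> attachment_points h" by blast
    then show ?thesis by (intro exI[of _ "Vx w # g'"]) auto
  next
    case True
    have "w \<notin> insert v (set (sverts g))" using "2.prems"(2) by auto
    then have "w = x" using slinks_verts[OF xy] True by auto
    show ?thesis
    proof (cases g rule: attachment_points.cases)
      case 1
      then show ?thesis using xy "2.prems"(3) by auto
    next
      case (2 z g1)
      have "x \<notin> insert z (set (sverts g1))" using \<open>w \<notin> insert v (set (sverts g))\<close> 2 \<open>w = x\<close> by auto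
      then have "y = z" using xy slinks_verts[of x y z g1 v] 2 \<open>w = x\<close> by auto
      then show ?thesis using 2 \<open>w = x\<close> "2.prems" assms(5,6)
        by (intro exI[of _ "Ed x y h # g1"]) auto
    next
      case (3 a b k g1)
      have n: "x \<notin> {a, b} \<union> set (sverts k) \<union> set (sverts g1)"
        using \<open>w \<notin> insert v (set (sverts g))\<close> 3 \<open>w = x\<close> by auto
      then have "y = a" using xy slinks_verts[of x y a k b] slinks_verts[of x y b g1 v] 3 \<open>w = x\<close> by auto
      then show ?thesis using 3 "2.prems" by auto
    qed
  qed
next
  case (3 u a b k g v)
  have ab: "x \<notin> {a, b}" "y \<notin> {a, b}" using "3.prems"(3) by auto
  then consider "(x, y) \<in> set (slinks a k b)" | "(x, y) \<in> set (slinks b g v)" using "3.prems"(1) by auto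
  then show ?case
  proof cases
    case 1
    have "\<exists>k'. swf k' \<and> mset (sverts k') = mset (sverts k) + mset (sverts h) \<and>
      mset (slinks a k' b) = mset (slinks a k b) + mset (slinks x h y) \<and>
      attachment_points k' = attachment_points k \<union> {x, y} \<union> attachment_points h"
      by (rule "3.IH"(1)[OF 1]) (use "3.prems" ab in auto)
    then obtain k' where k': "swf k'" "mset (sverts k') = mset (sverts k) + mset (sverts h)"
      "mset (slinks a k' b) = mset (slinks a k b) + mset (slinks x h y)"
      "attachment_points k' = attachment_points k \<union> {x, y} \<union> attachment_points h" by blast
    have "length (sverts k') = length (sverts k) + length (sverts h)"
      using k'(2) by (metis size_mset size_union)
    then show ?thesis using k' "3.prems" by (intro exI[of _ "Ed a b k' # g"]) auto
  next
    case 2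
    have "\<exists>g'. swf g' \<and> mset (sverts g') = mset (sverts g) + mset (sverts h) \<and>
      mset (slinks b g' v) = mset (slinks b g v) + mset (slinks x h y) \<and>
      attachment_points g' = attachment_points g \<union> {x, y} \<union> attachment_points h"
      by (rule "3.IH"(2)[OF 2]) (use "3.prems" ab in auto)
    then obtain g' where "swf g'" "mset (sverts g') = mset (sverts g) + mset (sverts h)"
      "mset (slinks b g' v) = mset (slinks b g v) + mset (slinks x h y)"
      "attachment_points g' = attachment_points g \<union> {x, y} \<union> attachment_points h" by blast
    then show ?thesis using "3.prems" by (intro exI[of _ "Ed a b k # g'"]) auto
  qed
qed

lemma insert_plain_path:
  assumes e: "{x, y} \<in> link_edges (slinks u g v)" and d: "distinct (u # v # sverts g)"
    and n: "{x, y} \<inter> ({u, v} \<union> attachment_points g) = {}" and g: "swf g" and Q: "2 \<le> length Q"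
  shows "\<exists>g'. swf g' \<and> mset (sverts g') = mset (sverts g) + mset Q \<and>
    link_edges (slinks u g' v) = link_edges (slinks u g v) \<union> path_edges (x # Q @ [y]) \<and>
    attachment_points g' = attachment_points g \<union> {x, y}"
proof -
  consider "(x, y) \<in> set (slinks u g v)" | "(y, x) \<in> set (slinks u g v)"
    using e unfolding link_edges_def by (auto simp: doubleton_eq_iff)
  then show ?thesis
  proof cases
    case 1
    from insert_attachment[OF this d n g plain_path(2)[of Q]] Q
    show ?thesis by (auto simp: plain_path dest!: link_edges_mset)
  next
    case 2
    have n': "{y, x} \<inter> ({u, v} \<union> attachment_points g) = {}" using n by auto
    have r: "path_edges (y # rev Q @ [x]) = path_edges (x # Q @ [y])" using path_edges_rev[of "x # Q @ [y]"] by simp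
    from insert_attachment[OF 2 d n' g plain_path(2)[of "rev Q"]] Q r
    show ?thesis by (auto simp: plain_path insert_commute dest!: link_edges_mset)
  qed
qed

definition colours_edges :: "('a \<Rightarrow> nat) \<Rightarrow> 'a set set \<Rightarrow> bool" where
  "colours_edges c E \<longleftrightarrow> (\<forall>a b. {a, b} \<in> E \<longrightarrow> c a \<noteq> c b)"

text \<open>
  No choice function is smaller than \<open>|V| + |E|\<close>. Stated for sets so that it can be combined over
  components, see \<open>no_cheap_choice_disjoint\<close>.
\<close>

definition no_cheap_choice :: "'a set \<Rightarrow> 'a set set \<Rightarrow> bool" where
  "no_cheap_choice V E \<longleftrightarrow> (\<forall>f. sum f V < card V + card E \<longrightarrow>
     (\<exists>L. fits f L V \<and> (\<forall>c. (\<forall>x\<in>V. c x \<in> L x) \<longrightarrow> \<not> colours_edges c E)))"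

lemma colours_link_edges: "colours_edges c (link_edges es) \<Longrightarrow> proper c es"
  unfolding colours_edges_def link_edges_def proper_def by force

lemma card_link_edges: "card (link_edges es) \<le> length es"
  unfolding link_edges_def using card_image_le[of "set es" "\<lambda>(x, y). {x, y}"] card_length[of es] by simp

lemma no_cheap_choice_disjoint:
  assumes V: "finite V1" "finite V2" "V1 \<inter> V2 = {}" and n: "no_cheap_choice V1 E1" "no_cheap_choice V2 E2"
  shows "no_cheap_choice (V1 \<union> V2) (E1 \<union> E2)"
  unfolding no_cheap_choice_def
proof (intro allI impI)
  fix f assume "sum f (V1 \<union> V2) < card (V1 \<union> V2) + card (E1 \<union> E2)"
  then have "sum f V1 + sum f V2 < card V1 + card V2 + (card E1 + card E2)"
    using V card_Un_le[of E1 E2] by (simp add: sum.union_disjoint card_Un_disjoint)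
  then have "sum f V1 < card V1 + card E1 \<or> sum f V2 < card V2 + card E2" by linarith
  moreover have "\<exists>L. fits f L (V1 \<union> V2) \<and> (\<forall>c. (\<forall>x\<in>V1 \<union> V2. c x \<in> L x) \<longrightarrow> \<not> colours_edges c (E1 \<union> E2))"
    if VE: "no_cheap_choice V E" "sum f V < card V + card E" and sub: "V \<subseteq> V1 \<union> V2" "E \<subseteq> E1 \<union> E2" for V E
  proof -
    obtain L where L: "fits f L V" "\<And>c. (\<forall>x\<in>V. c x \<in> L x) \<Longrightarrow> \<not> colours_edges c E"
      using VE unfolding no_cheap_choice_def by blast
    define M where "M = (\<lambda>x. if x \<in> V then L x else {..<f x})"
    have "fits f M (V1 \<union> V2)" using L(1) unfolding fits_def M_def by auto
    moreover have "\<not> colours_edges c (E1 \<union> E2)" if c: "\<forall>x\<in>V1 \<union> V2. c x \<in> M x" for c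
    proof -
      have "\<forall>x\<in>V. c x \<in> L x" using c sub(1) unfolding M_def by (metis subsetD)
      then have "\<not> colours_edges c E" by (rule L(2))
      then show ?thesis using sub(2) unfolding colours_edges_def by blast
    qed
    ultimately show ?thesis by blast
  qed
  ultimately show "\<exists>L. fits f L (V1 \<union> V2) \<and> (\<forall>c. (\<forall>x\<in>V1 \<union> V2. c x \<in> L x) \<longrightarrow> \<not> colours_edges c (E1 \<union> E2))"
    using n by blast
qed

lemma no_cheap_choice_one:
  assumes g: "swf g" "2 \<le> length (sverts g)" "distinct (u # v # sverts g)"
  shows "no_cheap_choice (set (u # v # sverts g)) (link_edges ((u, v) # slinks u g v))"
  unfolding no_cheap_choice_def
proof (intro allI impI)
  fix f assume f: "sum f (set (u # v # sverts g)) 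
    < card (set (u # v # sverts g)) + card (link_edges ((u, v) # slinks u g v))"
  have "sum f (set (u # v # sverts g)) = f u + f v + sum_list (map f (sverts g))"
    using g(3) by (simp add: sum_list_distinct_conv_sum_set)
  moreover have "card (set (u # v # sverts g)) = 2 + length (sverts g)"
    using distinct_card[OF g(3)] by simp
  ultimately have "int (f u) + int (f v) \<le> 2 + slack f g"
    using f card_link_edges[of "(u, v) # slinks u g v"] slack_eq[of f g u v] by simp
  from one_attachment_uncolourable[OF g this] 
  show "\<exists>L. fits f L (set (u # v # sverts g)) \<and> (\<forall>c. (\<forall>x\<in>set (u # v # sverts g). c x \<in> L x) \<longrightarrow> 
    \<not> colours_edges c (link_edges ((u, v) # slinks u g v)))"
    using colours_link_edges by blast
qed

lemma no_cheap_choice_two: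
  assumes g: "swf g" "2 \<le> length (sverts g)" "swf h" "2 \<le> length (sverts h)"
    and d: "distinct (u # v # sverts g @ sverts h)"
  shows "no_cheap_choice (set (u # v # sverts g @ sverts h)) (link_edges ((u, v) # slinks u g v @ slinks u h v))"
  unfolding no_cheap_choice_def
proof (intro allI impI)
  fix f assume f: "sum f (set (u # v # sverts g @ sverts h)) 
    < card (set (u # v # sverts g @ sverts h)) + card (link_edges ((u, v) # slinks u g v @ slinks u h v))"
  have "sum f (set (u # v # sverts g @ sverts h)) = sum_list (map f (u # v # sverts g @ sverts h))"
    using sum_list_distinct_conv_sum_set[OF d] by metis
  then have "sum f (set (u # v # sverts g @ sverts h)) = 
    f u + f v + sum_list (map f (sverts g)) + sum_list (map f (sverts h))" by simp
  moreover have "card (set (u # v # sverts g @ sverts h)) = 2 + length (sverts g) + length (sverts h)"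
    using distinct_card[OF d] by simp
  ultimately have "int (f u) + int (f v) \<le> 2 + slack f g + slack f h"
    using f card_link_edges[of "(u, v) # slinks u g v @ slinks u h v"] slack_eq[of f g u v] slack_eq[of f h u v] by simp
  from two_attachments_uncolourable[OF g d this] 
  show "\<exists>L. fits f L (set (u # v # sverts g @ sverts h)) \<and> (\<forall>c. (\<forall>x\<in>set (u # v # sverts g @ sverts h). c x \<in> L x) \<longrightarrow> 
    \<not> colours_edges c (link_edges ((u, v) # slinks u g v @ slinks u h v)))"
    using colours_link_edges by blast
qed

context cycle_forest
begin

text \<open>
  The union of the cycles in \<open>K\<close> is the root edge \<open>uv\<close> with the attachments \<open>g\<close> and \<open>h\<close>. By the last
  clause, an edge whose ends lie on one cycle of \<open>K\<close> only is free for a new attachment; the root satisfies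
  it because it is chosen as an edge shared by two cycles.
\<close>

definition two_sided :: "nat set \<Rightarrow> 'a \<Rightarrow> 'a \<Rightarrow> 'a seg list \<Rightarrow> 'a seg list \<Rightarrow> bool" where
  "two_sided K u v g h \<longleftrightarrow> swf g \<and> 2 \<le> length (sverts g) \<and> swf h \<and> 2 \<le> length (sverts h) \<and>
     distinct (u # v # sverts g @ sverts h) \<and> union_verts C K = set (u # v # sverts g @ sverts h) \<and>
     union_edges C K = link_edges ((u, v) # slinks u g v @ slinks u h v) \<and>
     (\<forall>z\<in>{u, v} \<union> attachment_points g \<union> attachment_points h.
        \<exists>i\<in>K. \<exists>j\<in>K. i \<noteq> j \<and> z \<in> verts (C i) \<inter> verts (C j))"

lemma two_sided_commute: "two_sided K u v g h \<Longrightarrow> two_sided K u v h g"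
  unfolding two_sided_def by (auto simp: link_edges_simps)

definition decomposed :: "nat set \<Rightarrow> bool" where
  "decomposed K \<longleftrightarrow> K \<subseteq> I \<and> linked_cycles K \<and> (\<exists>u v g h. two_sided K u v g h)"

lemma decomposed_imp: "decomposed K \<Longrightarrow> no_cheap_choice (union_verts C K) (union_edges C K)"
  unfolding decomposed_def two_sided_def using no_cheap_choice_two by metis

lemma finite_union_verts: "K \<subseteq> I \<Longrightarrow> finite (union_verts C K)"
  unfolding union_verts_def
proof (intro finite_UN_I)
  assume "K \<subseteq> I" 
  then show "finite K" using finite_I finite_subset by blast
  show "finite (verts (C i))" if "i \<in> K" for i
  proof -
    have "i \<in> I" using that \<open>K \<subseteq> I\<close> by blast
    from cycle[OF this] show ?thesis unfolding cycle_list_def by auto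
  qed
qed

lemma single_cycle: assumes "i \<in> I" shows "no_cheap_choice (verts (C i)) (edges (C i))"
proof -
  obtain xs where xs: "cycle_list (C i) xs" using cycle[OF assms] by blast
  then obtain x ys where "xs = x # ys" unfolding cycle_list_def by (cases xs) auto
  moreover from this obtain y zs where "ys = y # zs" using xs unfolding cycle_list_def by (cases ys) auto
  ultimately have "xs = x # y # zs" by simp
  then have "{x, y} \<in> edges (C i)" using xs unfolding cycle_list_def by auto
  then obtain Q where Q: "2 \<le> length Q" "distinct (x # Q @ [y])" "verts (C i) = set (x # Q @ [y])"
    "edges (C i) = insert {x, y} (path_edges (x # Q @ [y]))" using cycle_open_edge[OF xs] by metis
  have "no_cheap_choice (set (x # y # sverts (map Vx Q))) (link_edges ((x, y) # slinks x (map Vx Q) y))"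
    by (rule no_cheap_choice_one) (use Q in \<open>auto simp: plain_path\<close>)
  moreover have "set (x # y # sverts (map Vx Q)) = verts (C i)" using Q(3) by (auto simp: plain_path)
  moreover have "link_edges ((x, y) # slinks x (map Vx Q) y) = edges (C i)"
    using Q(4) by (simp add: plain_path link_edges_simps)
  ultimately show ?thesis by simp
qed

lemma decomposed_pair:
  assumes ij: "i \<in> I" "j \<in> I" "i \<noteq> j" "verts (C i) \<inter> verts (C j) \<noteq> {}"
  shows "decomposed {i, j}"
proof -
  obtain u v where uv: "u \<noteq> v" "verts (C i) \<inter> verts (C j) = {u, v}" "{u, v} \<in> edges (C i)" "{u, v} \<in> edges (C j)"
    using share[OF ij] by blast
  obtain xs ys where cyc: "cycle_list (C i) xs" "cycle_list (C j) ys" using cycle ij by metis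
  obtain P where P: "2 \<le> length P" "distinct (u # P @ [v])" "verts (C i) = set (u # P @ [v])"
    "edges (C i) = insert {u, v} (path_edges (u # P @ [v]))" using cycle_open_edge[OF cyc(1) uv(3)] .
  obtain Q where Q: "2 \<le> length Q" "distinct (u # Q @ [v])" "verts (C j) = set (u # Q @ [v])"
    "edges (C j) = insert {u, v} (path_edges (u # Q @ [v]))" using cycle_open_edge[OF cyc(2) uv(4)] .
  have dPQ: "set P \<inter> set Q = {}" using uv(2) P(2,3) Q(2,3) by auto
  have o: "overlap {i, j} i j" "overlap {i, j} j i" using ij(4) unfolding overlap_def by auto
  have "linked_cycles {i, j}" unfolding linked_cycles_def using o by auto
  moreover have "union_verts C {i, j} = set (u # v # sverts (map Vx P) @ sverts (map Vx Q))"
    unfolding union_verts_def using P(3) Q(3) by (auto simp: plain_path)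
  moreover have "union_edges C {i, j} = link_edges ((u, v) # slinks u (map Vx P) v @ slinks u (map Vx Q) v)"
    unfolding union_edges_def using P(4) Q(4) by (auto simp: plain_path link_edges_simps)
  moreover have "\<forall>z\<in>{u, v} \<union> attachment_points (map Vx P) \<union> attachment_points (map Vx Q).
        \<exists>i'\<in>{i, j}. \<exists>j'\<in>{i, j}. i' \<noteq> j' \<and> z \<in> verts (C i') \<inter> verts (C j')"
    using uv(2) ij(3) by (auto simp: plain_path)
  moreover have "distinct (u # v # sverts (map Vx P) @ sverts (map Vx Q))" using P(2) Q(2) dPQ by (auto simp: plain_path)
  moreover have "swf (map Vx P)" "2 \<le> length (sverts (map Vx P))" "swf (map Vx Q)" "2 \<le> length (sverts (map Vx Q))"
    using P Q by (auto simp: plain_path)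
  ultimately have "two_sided {i, j} u v (map Vx P) (map Vx Q)" "linked_cycles {i, j}"
    unfolding two_sided_def by auto
  then show ?thesis unfolding decomposed_def using ij(1,2) by blast
qed

lemma two_sided_grow:
  assumes T: "two_sided K u v g h" and xy: "{x, y} \<in> link_edges (slinks u g v)"
    and free: "{x, y} \<inter> ({u, v} \<union> attachment_points g) = {}"
    and Q: "distinct (x # Q @ [y])" "2 \<le> length Q" "set Q \<inter> union_verts C K = {}"
    and V: "union_verts C K' = union_verts C K \<union> set Q"
    and E: "union_edges C K' = union_edges C K \<union> path_edges (x # Q @ [y])"
    and K': "K \<subseteq> K'" "\<And>z. z \<in> {x, y} \<Longrightarrow> \<exists>i\<in>K'. \<exists>j\<in>K'. i \<noteq> j \<and> z \<in> verts (C i) \<inter> verts (C j)"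
  shows "\<exists>g'. two_sided K' u v g' h"
proof -
  have s: "swf g" "2 \<le> length (sverts g)" "swf h" "2 \<le> length (sverts h)"
     "distinct (u # v # sverts g @ sverts h)" "union_verts C K = set (u # v # sverts g @ sverts h)"
     "union_edges C K = link_edges ((u, v) # slinks u g v @ slinks u h v)"
    using T unfolding two_sided_def by simp_all
  have old: "\<exists>i\<in>K. \<exists>j\<in>K. i \<noteq> j \<and> z \<in> verts (C i) \<inter> verts (C j)"
    if "z \<in> {u, v} \<union> attachment_points g \<union> attachment_points h" for z
    using T that unfolding two_sided_def by blast
  obtain g' where g': "swf g'" "mset (sverts g') = mset (sverts g) + mset Q"
    "link_edges (slinks u g' v) = link_edges (slinks u g v) \<union> path_edges (x # Q @ [y])"
    "attachment_points g' = attachment_points g \<union> {x, y}"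
    using insert_plain_path[OF xy _ free s(1) Q(2)] s(5) by auto
  have sv: "set (sverts g') = set (sverts g) \<union> set Q" using g'(2) by (metis set_mset_mset set_mset_union)
  have len: "length (sverts g') = length (sverts g) + length Q" using g'(2) by (metis size_mset size_union)
  have "distinct (sverts g @ Q)" using s(5,6) Q(1,3) by auto
  then have "distinct (sverts g')" using g'(2) by (metis distinct_count_atmost_1 mset_append set_mset_mset)
  then have "distinct (u # v # sverts g' @ sverts h)" using s(5,6) Q(3) sv by auto
  moreover have "union_verts C K' = set (u # v # sverts g' @ sverts h)" unfolding V s(6) using sv by auto
  moreover have "union_edges C K' = link_edges ((u, v) # slinks u g' v @ slinks u h v)"
    unfolding E s(7) link_edges_simps g'(3) by auto
  moreover have "\<forall>z\<in>{u, v} \<union> attachment_points g' \<union> attachment_points h.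
      \<exists>i\<in>K'. \<exists>j\<in>K'. i \<noteq> j \<and> z \<in> verts (C i) \<inter> verts (C j)"
  proof
    fix z assume z: "z \<in> {u, v} \<union> attachment_points g' \<union> attachment_points h"
    show "\<exists>i\<in>K'. \<exists>j\<in>K'. i \<noteq> j \<and> z \<in> verts (C i) \<inter> verts (C j)"
    proof (cases "z \<in> {x, y}")
      case True then show ?thesis by (rule K'(2))
    next
      case False
      then have "z \<in> {u, v} \<union> attachment_points g \<union> attachment_points h" using z unfolding g'(4) by blast
      from old[OF this] show ?thesis using K'(1) by blast
    qed
  qed
  moreover have "2 \<le> length (sverts g')" using len s(2) by simp
  ultimately show ?thesis unfolding two_sided_def using g'(1) s(3,4) by blast
qed

text \<open>
  The new cycle meets the union of the old ones in one edge \<open>xy\<close> of a single cycle, whose ends lie on no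
  other cycle. Hence \<open>x\<close> and \<open>y\<close> are neither root nor attachment points, and the rest of the new cycle becomes
  an attachment at \<open>xy\<close>.
\<close>

lemma decomposed_grow:
  assumes K: "decomposed K" and i: "i \<in> I" "i \<notin> K" and j: "j \<in> K" "verts (C i) \<inter> verts (C j) \<noteq> {}"
  shows "decomposed (insert i K)"
proof -
  obtain u v g h where s: "K \<subseteq> I" "linked_cycles K" and T: "two_sided K u v g h"
    using K unfolding decomposed_def by blast
  have jI: "j \<in> I" "i \<noteq> j" using s(1) i j by auto
  obtain x y where xy: "x \<noteq> y" "verts (C i) \<inter> verts (C j) = {x, y}" "{x, y} \<in> edges (C i)" "{x, y} \<in> edges (C j)"
    using share[OF i(1) jI j(2)] by blast
  have others: "verts (C i) \<inter> verts (C l) = {}" if "l \<in> K" "l \<noteq> j" for l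
    using only_one_overlap[OF s i j that] .
  have iK: "verts (C i) \<inter> union_verts C K = {x, y}"
  proof
    show "verts (C i) \<inter> union_verts C K \<subseteq> {x, y}"
    proof
      fix z assume "z \<in> verts (C i) \<inter> union_verts C K"
      then obtain l where l: "l \<in> K" "z \<in> verts (C i)" "z \<in> verts (C l)" unfolding union_verts_def by auto
      then have "l = j" using others[OF l(1)] by blast
      then show "z \<in> {x, y}" using l xy(2) by blast
    qed
    show "{x, y} \<subseteq> verts (C i) \<inter> union_verts C K" using xy(2) j(1) unfolding union_verts_def by blast
  qed
  obtain xs where cyc: "cycle_list (C i) xs" using cycle i by metis
  obtain Q where Q: "2 \<le> length Q" "distinct (x # Q @ [y])" "verts (C i) = set (x # Q @ [y])"
    "edges (C i) = insert {x, y} (path_edges (x # Q @ [y]))" using cycle_open_edge[OF cyc xy(3)] .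
  have free: "z \<notin> {u, v} \<union> attachment_points g \<union> attachment_points h" if z: "z \<in> {x, y}" for z
  proof
    assume "z \<in> {u, v} \<union> attachment_points g \<union> attachment_points h"
    then obtain l m where lm: "l \<in> K" "m \<in> K" "l \<noteq> m" "z \<in> verts (C l)" "z \<in> verts (C m)"
      using T unfolding two_sided_def by blast
    have "z \<in> verts (C i)" using z xy(2) by blast
    then show False using others[OF lm(1)] others[OF lm(2)] lm by blast
  qed
  have eK: "{x, y} \<in> union_edges C K" using xy(4) j(1) unfolding union_edges_def by blast
  have newV: "set Q \<inter> union_verts C K = {}" using iK Q(2,3) by auto
  have V: "union_verts C (insert i K) = union_verts C K \<union> set Q"
  proof -
    have "union_verts C (insert i K) = union_verts C K \<union> verts (C i)" unfolding union_verts_def by auto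
    then show ?thesis using Q(3) iK by auto
  qed
  have E: "union_edges C (insert i K) = union_edges C K \<union> path_edges (x # Q @ [y])"
  proof -
    have "union_edges C (insert i K) = union_edges C K \<union> edges (C i)" unfolding union_edges_def by auto
    then show ?thesis using Q(4) eK by auto
  qed
  have pts: "\<exists>i'\<in>insert i K. \<exists>j'\<in>insert i K. i' \<noteq> j' \<and> z \<in> verts (C i') \<inter> verts (C j')"
    if "z \<in> {x, y}" for z using that jI(2) j(1) xy(2) by blast
  have link: "linked_cycles (insert i K)"
  proof -
    have mono: "(overlap (insert i K))\<^sup>*\<^sup>* a b" if "(overlap K)\<^sup>*\<^sup>* a b" for a b
      using that by (rule rtranclp_mono[THEN predicate2D, rotated]) (auto simp: overlap_def)
    have o: "overlap (insert i K) i j" "overlap (insert i K) j i" using j unfolding overlap_def by auto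
    have "(overlap (insert i K))\<^sup>*\<^sup>* a j \<and> (overlap (insert i K))\<^sup>*\<^sup>* j a" if "a \<in> insert i K" for a
    proof (cases "a = i")
      case True then show ?thesis using o by auto
    next
      case False then show ?thesis using that s(2) j(1) mono unfolding linked_cycles_def by auto
    qed
    then show ?thesis unfolding linked_cycles_def by (meson rtranclp_trans)
  qed
  have "{x, y} \<noteq> {u, v}" using free[of x] xy(1) by auto
  moreover have "union_edges C K = link_edges ((u, v) # slinks u g v @ slinks u h v)"
    using T unfolding two_sided_def by simp
  ultimately consider "{x, y} \<in> link_edges (slinks u g v)" | "{x, y} \<in> link_edges (slinks u h v)"
    using eK by (auto simp: link_edges_simps)
  then have "\<exists>g h. two_sided (insert i K) u v g h"
  proof cases
    case 1
    have "{x, y} \<inter> ({u, v} \<union> attachment_points g) = {}" using free[of x] free[of y] by auto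
    from two_sided_grow[OF T 1 this Q(2,1) newV V E _ pts] show ?thesis by blast
  next
    case 2
    have "{x, y} \<inter> ({u, v} \<union> attachment_points h) = {}" using free[of x] free[of y] by auto
    from two_sided_grow[OF two_sided_commute[OF T] 2 this Q(2,1) newV V E _ pts] show ?thesis by blast
  qed
  then show ?thesis unfolding decomposed_def using i(1) s(1) link by blast
qed

text \<open>
  A maximal decomposed set of cycles has no neighbours left, by \<open>decomposed_grow\<close>. A cycle that meets no
  other one is a root edge with a single attachment.
\<close>

lemma component_exists:
  assumes M: "M \<subseteq> I" "M \<noteq> {}"
  obtains K where "K \<subseteq> M" "K \<noteq> {}" "no_cheap_choice (union_verts C K) (union_edges C K)"
    "union_verts C K \<inter> union_verts C (M - K) = {}"
proof (cases "\<exists>i\<in>M. \<exists>j\<in>M. i \<noteq> j \<and> verts (C i) \<inter> verts (C j) \<noteq> {}")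
  case False
  obtain i where i: "i \<in> M" using M(2) by blast
  have "union_verts C {i} \<inter> union_verts C (M - {i}) = {}" using False i unfolding union_verts_def by blast
  moreover have "no_cheap_choice (union_verts C {i}) (union_edges C {i})"
    using single_cycle[of i] i M(1) unfolding union_verts_def union_edges_def by auto
  ultimately show thesis using that[of "{i}"] i by blast
next
  case True
  then obtain i j where ij: "i \<in> M" "j \<in> M" "i \<noteq> j" "verts (C i) \<inter> verts (C j) \<noteq> {}" by blast
  define F where "F = {K. K \<subseteq> M \<and> decomposed K}"
  have "finite M" using M(1) finite_I finite_subset by blast
  then have "finite F" unfolding F_def by simp
  moreover have "{i, j} \<in> F" unfolding F_def using decomposed_pair[OF _ _ ij(3,4)] ij(1,2) M(1) by auto
  ultimately obtain K where K: "K \<in> F" "{i, j} \<subseteq> K" "\<And>K'. K' \<in> F \<Longrightarrow> K \<subseteq> K' \<Longrightarrow> K = K'"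
    using finite_has_maximal2[of F "{i, j}"] by blast
  have "union_verts C K \<inter> union_verts C (M - K) = {}"
  proof (rule ccontr)
    assume "union_verts C K \<inter> union_verts C (M - K) \<noteq> {}"
    then obtain l m where lm: "l \<in> M - K" "m \<in> K" "verts (C l) \<inter> verts (C m) \<noteq> {}"
      unfolding union_verts_def by blast
    then have "decomposed (insert l K)" using decomposed_grow[of K l m] K(1) M(1) unfolding F_def by blast
    then have "insert l K \<in> F" using K(1) lm unfolding F_def by blast
    then show False using K(3)[of "insert l K"] lm by blast
  qed
  moreover have "K \<subseteq> M" "decomposed K" using K(1) unfolding F_def by simp_all
  moreover have "K \<noteq> {}" using K(2) by blast
  ultimately show thesis using that[of K] decomposed_imp[of K] by simp
qed

lemma no_cheap_choice_union: "M \<subseteq> I \<Longrightarrow> no_cheap_choice (union_verts C M) (union_edges C M)"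
proof (induction "card M" arbitrary: M rule: less_induct)
  case less
  have fM: "finite M" using less(2) finite_I finite_subset by blast
  show ?case
  proof (cases "M = {}")
    case True
    then show ?thesis unfolding no_cheap_choice_def union_verts_def union_edges_def by simp
  next
    case False
    obtain K where K: "K \<subseteq> M" "K \<noteq> {}" "no_cheap_choice (union_verts C K) (union_edges C K)"
      "union_verts C K \<inter> union_verts C (M - K) = {}" using component_exists[OF less(2) False] .
    have "card (M - K) < card M" using K(1,2) fM by (intro psubset_card_mono) auto
    then have "no_cheap_choice (union_verts C (M - K)) (union_edges C (M - K))" using less by auto
    moreover have "finite (union_verts C K)" "finite (union_verts C (M - K))"
      by (rule finite_union_verts, use K(1) less(2) in blast)+
    ultimately have "no_cheap_choice (union_verts C K \<union> union_verts C (M - K)) (union_edges C K \<union> union_edges C (M - K))"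
      using no_cheap_choice_disjoint[OF _ _ K(4,3)] by simp
    moreover have "union_verts C K \<union> union_verts C (M - K) = union_verts C M"
      "union_edges C K \<union> union_edges C (M - K) = union_edges C M"
      using K(1) unfolding union_verts_def union_edges_def by auto
    ultimately show ?thesis by simp
  qed
qed

end

section \<open>Trees of cycles\<close>

text \<open>
  Thetas are excluded by the drawing. One of them shows that a shared pair \<open>{u, v}\<close> is an edge of both
  cycles: if it were an edge of only one, \<open>u\<close> and \<open>v\<close> would be joined by the two halves of the other cycle
  and by the rest of the first.
\<close>

lemma tree_of_cycles_no_cheap_choice:
  assumes "tree_of_cycles k G"
  shows "no_cheap_choice (verts G) (edges G)"
proof -
  have simple: "simple_graph G" using assms unfolding tree_of_cycles_def by (elim conjE)
  obtain C a where C: "verts G = (\<Union>i\<in>{1..k}. verts (C i))" "edges G = (\<Union>i\<in>{1..k}. edges (C i))"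
    "\<forall>i\<in>{1..k}. 4 \<le> a i \<and> cycle_graph (a i) (C i)"
    "\<forall>i\<in>{1..k}. \<forall>j\<in>{1..k}. i \<noteq> j \<longrightarrow> verts (C i) \<inter> verts (C j) = {} \<or>
           (\<exists>u v. {u, v} \<in> edges G \<and> verts (C i) \<inter> verts (C j) = {u, v})"
    "\<forall>i\<in>{1..k}. \<forall>j\<in>{1..k}. \<forall>u v. i \<noteq> j \<and> verts (C i) \<inter> verts (C j) = {u, v} \<longrightarrow>
           (\<forall>l\<in>{1..k} - {i, j}. u \<notin> verts (C l) \<and> v \<notin> verts (C l))"
    using assms unfolding tree_of_cycles_def by (elim conjE exE) (rule that)
  obtain p \<gamma> where dr: "plane_drawing G p \<gamma>" "mg_tree (weak_dual G p \<gamma>)"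
    using assms unfolding tree_of_cycles_def by (elim conjE exE) (rule that)
  interpret plane_graph G p \<gamma> using simple dr(1) by unfold_locales
  have acyc: "\<not> (\<exists>vs es. mg_cycle (weak_dual G p \<gamma>) vs es)" using dr(2) unfolding mg_tree_def by blast
  let ?I = "{1..k}"
  have UE: "union_edges C ?I = edges G" "union_verts C ?I = verts G"
    unfolding union_edges_def union_verts_def C by simp_all
  have cyc: "\<exists>xs. cycle_list (C i) xs" if "i \<in> ?I" for i
    using C(3) that cycle_graph_imp_cycle_list by blast
  have onc: "on_cycle e" if e: "e \<in> edges G" for e
  proof -
    obtain i where i: "i \<in> ?I" "e \<in> edges (C i)" using e unfolding C(2) by blast
    obtain xs where xs: "cycle_list (C i) xs" using cyc[OF i(1)] by blast
    obtain x y where xy: "e = {x, y}" using cycle_edge_doubleton[OF xs i(2)] .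
    obtain Q where Q: "2 \<le> length Q" "distinct (x # Q @ [y])" "verts (C i) = set (x # Q @ [y])"
      "edges (C i) = insert {x, y} (path_edges (x # Q @ [y]))"
      using cycle_open_edge[OF xs] i(2) unfolding xy by metis
    have "edges (C i) \<subseteq> edges G" unfolding C(2) using i(1) by blast
    then show ?thesis unfolding xy using Q by (intro cycle_edge_on_cycle[of x Q y]) auto
  qed
  have theta: False if "distinct (s # t # P @ Q @ R)" "P \<noteq> []" "Q \<noteq> []" "R \<noteq> []"
    "path_edges (s # P @ [t]) \<subseteq> edges G" "path_edges (s # Q @ [t]) \<subseteq> edges G" "path_edges (s # R @ [t]) \<subseteq> edges G"
    for s t P Q R
    using no_theta[OF onc acyc that] .
  have meet: "\<exists>u v. u \<noteq> v \<and> verts (C i) \<inter> verts (C j) = {u, v} \<and> {u, v} \<in> edges G"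
    if ij: "i \<in> ?I" "j \<in> ?I" "i \<noteq> j" "verts (C i) \<inter> verts (C j) \<noteq> {}" for i j
  proof -
    obtain u v where uv: "{u, v} \<in> edges G" "verts (C i) \<inter> verts (C j) = {u, v}" using C(4) ij by blast
    have "card {u, v} = 2" using edgeD(4)[OF uv(1)] .
    then have "u \<noteq> v" by auto
    then show ?thesis using uv by blast
  qed
  have two: "verts (C i) \<inter> verts (C j) \<inter> verts (C l) = {}"
    if ijl: "i \<in> ?I" "j \<in> ?I" "l \<in> ?I" "i \<noteq> j" "i \<noteq> l" "j \<noteq> l" for i j l
  proof (cases "verts (C i) \<inter> verts (C j) = {}")
    case True then show ?thesis by blast
  next
    case False
    then obtain u v where uv: "verts (C i) \<inter> verts (C j) = {u, v}" using meet[OF ijl(1,2,4)] by blast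
    have "u \<notin> verts (C l) \<and> v \<notin> verts (C l)" using C(5) ijl uv by blast
    then show ?thesis using uv by auto
  qed
  have half: "{u, v} \<in> edges (C i)"
    if ij: "i \<in> ?I" "j \<in> ?I" "i \<noteq> j" and uv: "u \<noteq> v" "verts (C i) \<inter> verts (C j) = {u, v}" "{u, v} \<in> edges G" 
    for i j u v
  proof (rule ccontr)
    assume n: "{u, v} \<notin> edges (C i)"
    obtain l where l: "l \<in> ?I" "{u, v} \<in> edges (C l)" using uv(3) unfolding C(2) by blast
    obtain xs ys zs where xs: "cycle_list (C i) xs" "cycle_list (C j) ys" "cycle_list (C l) zs" using cyc ij l by metis
    obtain Q where Q: "2 \<le> length Q" "distinct (u # Q @ [v])" "verts (C l) = set (u # Q @ [v])"
      "edges (C l) = insert {u, v} (path_edges (u # Q @ [v]))" using cycle_open_edge[OF xs(3) l(2)] .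
    have "l = i \<or> l = j" using two[OF ij(1,2) l(1) ij(3)] uv(2) Q(3) by auto
    then have lj: "l = j" using n l(2) by blast
    have uvi: "u \<in> verts (C i)" "v \<in> verts (C i)" using uv(2) by blast+
    obtain A B where AB: "A \<noteq> []" "B \<noteq> []" "distinct (u # v # A @ B)" "set A \<union> set B \<subseteq> verts (C i)"
      "path_edges (u # A @ [v]) \<subseteq> edges (C i)" "path_edges (u # B @ [v]) \<subseteq> edges (C i)"
      using cycle_split_at_nonedge[OF xs(1) uvi uv(1) n] .
    have sub: "edges (C i) \<subseteq> edges G" "edges (C l) \<subseteq> edges G" unfolding C(2) using ij(1) l(1) by blast+
    have dis: "set Q \<inter> (set A \<union> set B) = {}"
    proof -
      have "set Q \<inter> (set A \<union> set B) \<subseteq> {u, v}" using uv(2) AB(4) Q(3) lj by auto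
      then show ?thesis using Q(2) by auto
    qed
    show False
      by (rule theta[of u v A B Q]) (use AB Q sub dis in auto)
  qed
  interpret F: cycle_forest C ?I
  proof
    show "finite ?I" by simp
    show "\<exists>xs. cycle_list (C i) xs" if "i \<in> ?I" for i using cyc[OF that] .
    show "\<exists>u v. u \<noteq> v \<and> verts (C i) \<inter> verts (C j) = {u, v} \<and> {u, v} \<in> edges (C i) \<and> {u, v} \<in> edges (C j)"
      if ij: "i \<in> ?I" "j \<in> ?I" "i \<noteq> j" "verts (C i) \<inter> verts (C j) \<noteq> {}" for i j
    proof -
      obtain u v where uv: "u \<noteq> v" "verts (C i) \<inter> verts (C j) = {u, v}" "{u, v} \<in> edges G" using meet[OF ij] by blast
      have "verts (C j) \<inter> verts (C i) = {u, v}" using uv(2) by blast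
      then have "{u, v} \<in> edges (C j)" using half[OF ij(2,1) _ uv(1) _ uv(3)] ij(3) by blast
      then show ?thesis using half[OF ij(1-3) uv] uv by blast
    qed
    show "verts (C i) \<inter> verts (C j) \<inter> verts (C l) = {}"
      if "i \<in> ?I" "j \<in> ?I" "l \<in> ?I" "i \<noteq> j" "i \<noteq> l" "j \<noteq> l" for i j l using two[OF that] .
    show False if "distinct (s # t # P @ Q @ R)" "P \<noteq> []" "Q \<noteq> []" "R \<noteq> []"
      "path_edges (s # P @ [t]) \<subseteq> union_edges C ?I" "path_edges (s # Q @ [t]) \<subseteq> union_edges C ?I" 
      "path_edges (s # R @ [t]) \<subseteq> union_edges C ?I" for s t P Q R
      using theta[OF that(1-4)] that(5-7) unfolding UE by blast
  qed
  show ?thesis using F.no_cheap_choice_union[OF order_refl] unfolding UE .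
qed

text \<open>
  A new vertex receives one colour more than it has neighbours among the old vertices, which are
  coloured first.
\<close>

lemma greedy_choice:
  fixes V :: "'a set"
  assumes "finite V" "\<And>e. e \<in> E \<Longrightarrow> e \<subseteq> V \<and> card e = 2"
  shows "\<exists>f. sum f V = card V + card E \<and>
    (\<forall>L :: 'a \<Rightarrow> nat set. (\<forall>v\<in>V. finite (L v) \<and> card (L v) = f v) \<longrightarrow> (\<exists>c. (\<forall>v\<in>V. c v \<in> L v) \<and> (\<forall>a b. {a, b} \<in> E \<longrightarrow> c a \<noteq> c b)))"
  using assms
proof (induction V arbitrary: E rule: finite_induct)
  case empty
  then have "E = {}" by fastforce
  then show ?case by (intro exI[of _ "\<lambda>_. 0"]) simp
next
  case (insert x V)
  define E' where "E' = {e \<in> E. x \<notin> e}"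
  define N where "N = {y \<in> V. {x, y} \<in> E}"
  have fN: "finite N" "x \<notin> N" "N \<subseteq> V" unfolding N_def using insert.hyps by auto
  have E'2: "e \<subseteq> V \<and> card e = 2" if "e \<in> E'" for e
    using insert.prems[of e] that unfolding E'_def by auto
  have "\<exists>f. sum f V = card V + card E' \<and>
    (\<forall>L :: 'a \<Rightarrow> nat set. (\<forall>v\<in>V. finite (L v) \<and> card (L v) = f v) \<longrightarrow>
       (\<exists>c. (\<forall>v\<in>V. c v \<in> L v) \<and> (\<forall>a b. {a, b} \<in> E' \<longrightarrow> c a \<noteq> c b)))"
    by (rule insert.IH) (rule E'2)
  then obtain f where f: "sum f V = card V + card E'"
    "\<forall>L :: 'a \<Rightarrow> nat set. (\<forall>v\<in>V. finite (L v) \<and> card (L v) = f v) \<longrightarrow>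
       (\<exists>c. (\<forall>v\<in>V. c v \<in> L v) \<and> (\<forall>a b. {a, b} \<in> E' \<longrightarrow> c a \<noteq> c b))"
    by (elim exE conjE)
  have E: "E = E' \<union> (\<lambda>y. {x, y}) ` N"
  proof
    show "E \<subseteq> E' \<union> (\<lambda>y. {x, y}) ` N"
    proof
      fix e assume e: "e \<in> E"
      show "e \<in> E' \<union> (\<lambda>y. {x, y}) ` N"
      proof (cases "x \<in> e")
        case True
        have "card e = 2" "e \<subseteq> insert x V" using insert.prems[OF e] by auto
        then obtain y where y: "e = {x, y}" "y \<noteq> x" using True by (auto simp: card_2_iff)
        then have "y \<in> N" using e \<open>e \<subseteq> insert x V\<close> unfolding N_def by auto
        then show ?thesis using y(1) by blast
      qed (use e in \<open>auto simp: E'_def\<close>)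
    qed
  qed (auto simp: E'_def N_def)
  have "E' \<subseteq> Pow V" using insert.prems unfolding E'_def by blast
  then have fE': "finite E'" using insert.hyps(1) finite_subset by blast
  have "inj_on (\<lambda>y. {x, y}) N" by (auto simp: inj_on_def doubleton_eq_iff)
  then have cE: "card E = card E' + card N"
    unfolding E using fE' fN(1) by (subst card_Un_disjoint) (auto simp: E'_def card_image)
  define f' where "f' = f(x := Suc (card N))"
  have "sum f' V = sum f V" unfolding f'_def using insert.hyps(2) by (intro sum.cong) auto
  then have s: "sum f' (insert x V) = card (insert x V) + card E"
    using f(1) cE insert.hyps by (simp add: f'_def)
  have "\<exists>c. (\<forall>v\<in>insert x V. c v \<in> L v) \<and> (\<forall>a b. {a, b} \<in> E \<longrightarrow> c a \<noteq> c b)"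
    if L: "\<forall>v\<in>insert x V. finite (L v) \<and> card (L v) = f' v" for L :: "'a \<Rightarrow> nat set"
  proof -
    have "\<forall>v\<in>V. finite (L v) \<and> card (L v) = f v" using L insert.hyps(2) unfolding f'_def by auto
    from f(2)[THEN spec, THEN mp, OF this]
    obtain c where c: "\<forall>v\<in>V. c v \<in> L v" "\<forall>a b. {a, b} \<in> E' \<longrightarrow> c a \<noteq> c b" by (elim exE conjE)
    have "card (c ` N) < card (L x)" using L card_image_le[OF fN(1), of c] unfolding f'_def by auto
    then have "\<not> L x \<subseteq> c ` N" using card_mono[of "c ` N" "L x"] fN(1) by auto
    then obtain q where q: "q \<in> L x" "q \<notin> c ` N" by blast
    have "\<forall>a b. {a, b} \<in> E \<longrightarrow> (c(x := q)) a \<noteq> (c(x := q)) b"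
    proof (intro allI impI)
      fix a b assume "{a, b} \<in> E"
      then consider "{a, b} \<in> E'" | y where "y \<in> N" "{a, b} = {x, y}" unfolding E by blast
      then show "(c(x := q)) a \<noteq> (c(x := q)) b"
      proof cases
        case 1
        then have "a \<noteq> x" "b \<noteq> x" unfolding E'_def by auto
        then show ?thesis using c(2) 1 by simp
      next
        case 2
        then have "y \<noteq> x" "c y \<noteq> q" using fN(2) q(2) by auto
        then show ?thesis using 2(2) by (auto simp: doubleton_eq_iff)
      qed
    qed
    moreover have "\<forall>v\<in>insert x V. (c(x := q)) v \<in> L v" using c(1) q(1) by auto
    ultimately show ?thesis by blast
  qed
  then show ?case using s by blast
qed

theorem corollary5p2:
  fixes G :: "'a graph" and k :: nat
  assumes "k \<ge> 1"
    and "tree_of_cycles k G"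
  shows "sc_greedy G"
proof -
  have simple: "finite (verts G)" "\<And>e. e \<in> edges G \<Longrightarrow> e \<subseteq> verts G \<and> card e = 2"
    using assms(2) unfolding tree_of_cycles_def simple_graph_def by auto
  have "\<exists>f. choice_function G f \<and> size_of G f = card (verts G) + card (edges G)"
    using greedy_choice[OF simple] unfolding choice_function_def f_assignment_def L_colorable_def size_of_def by blast
  moreover have "card (verts G) + card (edges G) \<le> s" if s: "\<exists>f. choice_function G f \<and> size_of G f = s" for s
  proof (rule ccontr)
    assume "\<not> card (verts G) + card (edges G) \<le> s"
    then obtain f where f: "choice_function G f" "sum f (verts G) < card (verts G) + card (edges G)"
      using s unfolding size_of_def by auto
    then obtain L where L: "fits f L (verts G)" "\<And>c. (\<forall>x\<in>verts G. c x \<in> L x) \<Longrightarrow> \<not> colours_edges c (edges G)"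
      using tree_of_cycles_no_cheap_choice[OF assms(2)] unfolding no_cheap_choice_def by blast
    then have "L_colorable G L" using f(1) unfolding choice_function_def f_assignment_def fits_def by blast
    then show False using L(2) unfolding L_colorable_def colours_edges_def by blast
  qed
  ultimately show ?thesis unfolding sc_greedy_def sum_choice_number_def by (intro Least_equality)
qed

end
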